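(* Let $n\ge 1$ and let $T:\mathcal S_{\mathbb C}(n)\to\mathcal S_{\mathbb C}(n)$ be a bijection. (1) If $T(f*g)=Tf\cdot Tg$ for all $f,g\in\mathcal S_{\mathbb C}(n)$, then there exists a $C^\infty$-diffeomorphism $u:\mathbb R^n\to\mathbb R^n$ such that either $(Tf)(u(x))=(\mathcal F f)(x)$ for all $f\in\mathcal S_{\mathbb C}(n)$ and $x\in\mathbb R^n$, or $(Tf)(u(x))=(\mathcal F\overline{f})(x)$ for all $f\in\mathcal S_{\mathbb C}(n)$ and $x\in\mathbb R^n$. (2) If $T(f\cdot g)=Tf*Tg$ for all $f,g\in\mathcal S_{\mathbb C}(n)$, then there exists a $C^\infty$-diffeomorphism $u:\mathbb R^n\to\mathbb R^n$ such that either $Tf=\mathcal F(f\circ u)$ for all $f\in\mathcal S_{\mathbb C}(n)$, or $Tf=\mathcal F(\overline{f\circ u})$ for all $f\in\mathcal S_{\mathbb C}(n)$.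
   Context: $\mathcal S_{\mathbb C}(n)$ is the Schwartz space of infinitely differentiable functions $f:\mathbb R^n\to\mathbb C$ such that $\sup_{x}|\partial^\alpha f(x)|(1+|x|^l)<\infty$ for every $l\in\mathbb Z_{\ge0}$ and every multi-index $\alpha$. Convolution is $(f*g)(x)=\int_{\mathbb R^n}f(y)g(x-y)\,dy$, products are pointwise, and the Fourier transform is $(\mathcal F f)(t)=\int_{\mathbb R^n}f(x)e^{-2\pi i\langle x,t\rangle}\,dx$. The bar denotes complex conjugation. *)

theory Defs
  imports "HOL-Analysis.Analysis"
begin

definition partial_deriv :: "'n::finite \<Rightarrow> (real^'n \<Rightarrow> 'b::real_normed_vector) \<Rightarrow> real^'n \<Rightarrow> 'b" where
  "partial_deriv i f x = vector_derivative (\<lambda>t. f (x + t *\<^sub>R axis i 1)) (at 0)"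

fun iter_pderiv :: "'n::finite list \<Rightarrow> (real^'n \<Rightarrow> 'b::real_normed_vector) \<Rightarrow> real^'n \<Rightarrow> 'b" where
  "iter_pderiv [] f = f"
| "iter_pderiv (i # is) f = partial_deriv i (iter_pderiv is f)"

definition smooth :: "(real^'n::finite \<Rightarrow> 'b::real_normed_vector) \<Rightarrow> bool" where
  "smooth f \<longleftrightarrow>
     (\<forall>is. continuous_on UNIV (iter_pderiv is f)) \<and>
     (\<forall>is i x. ((\<lambda>t. iter_pderiv is f (x + t *\<^sub>R axis i 1))
                  has_vector_derivative iter_pderiv (i # is) f x) (at 0))"

definition schwartz :: "(real^'n::finite \<Rightarrow> complex) set" where
  "schwartz = {f. smooth f \<and>
     (\<forall>(l::nat) is. \<exists>C. \<forall>x. norm (iter_pderiv is f x) * (1 + norm x ^ l) \<le> C)}"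

definition convolution :: "(real^'n::finite \<Rightarrow> complex) \<Rightarrow> (real^'n \<Rightarrow> complex) \<Rightarrow> real^'n \<Rightarrow> complex" where
  "convolution f g x = integral\<^sup>L lborel (\<lambda>y. f y * g (x - y))"

definition fourier :: "(real^'n::finite \<Rightarrow> complex) \<Rightarrow> real^'n \<Rightarrow> complex" where
  "fourier f t = integral\<^sup>L lborel (\<lambda>x. f x * cis (- 2 * pi * (x \<bullet> t)))"

definition smooth_diffeo :: "(real^'n::finite \<Rightarrow> real^'n) \<Rightarrow> bool" where
  "smooth_diffeo u \<longleftrightarrow> bij u \<and> smooth u \<and> smooth (inv u)"

end

theory Submission
  imports "HOL-Probability.Probability" "HOL-Complex_Analysis.Complex_Analysis" Defs
begin

text \<open>Conjugating \<open>T\<close> with the Fourier transform reduces both parts to multiplicative bijections of the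
  Schwartz space. The relation \<open>f * g = f\<close> is preserved, and it recovers the points: the values \<open>T g\<close> for
  \<open>g = 1\<close> near \<open>x\<close> are all \<open>1\<close> at exactly one point \<open>u x\<close>, the map \<open>u\<close> is a homeomorphism with inverse \<open>v\<close>, and
  \<open>T\<close> is local, so it extends to a multiplicative bijection \<open>L\<close> of the smooth functions. It remains to find \<open>L f (u x)\<close>.

  Regularity of \<open>L\<close> comes from gluing: if some failure could occur at points \<open>x\<^sub>k\<close> accumulating at \<open>x\<^sub>0\<close>, then
  tiny bumps, each witnessing the failure at \<open>x\<^sub>k\<close>, add up to one smooth \<open>F\<close> for which \<open>L F\<close> is not smooth at
  \<open>u x\<^sub>0\<close>. Hence outside a discrete set \<open>|L f (u x)| = |f x| powr p x\<close>, where \<open>p = 1\<close> since \<open>u\<close> and \<open>v\<close> turn out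
  to be differentiable, and \<open>L\<close> sends Weierstrass factors \<open>E\<^sub>K (a g)\<close> with \<open>g x = 0\<close> to functions with value \<open>1\<close> at
  \<open>u x\<close>. So \<open>L (1 - a g) (u x)\<close> is a product of characters of \<open>a, \<dots>, a ^ K\<close>; taking \<open>a = - 1 / (s \<omega>)\<close> and
  letting \<open>s\<close> tend to \<open>0\<close>, differentiability of \<open>L (g + s \<omega>)\<close> forces this product to converge up to a factor
  depending on \<open>s\<close> only, which kills the characters. Thus \<open>L f (u x)\<close> depends on \<open>f x\<close> only, and the real parts of
  the same limits show that the dependence is the identity or complex conjugation.\<close>

section \<open>Smooth functions on Euclidean space\<close>

text \<open>The obstacle is that \<open>T\<close> is neither additive nor continuous by hypothesis.
  At a single point multiplicativity allows wild behaviour: \<open>f x\<close> times a unimodular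
  character of the Taylor coefficients of \<open>log f\<close> at \<open>x\<close>, extended by 0 to
  functions vanishing there, is multiplicative, and Hamel bases supply such characters in abundance.
  They can be excluded only by letting points or functions vary, and gluing is the substitute for
  automatic continuity. The order of the conclusions is forced. The modulus comes first, because
  logarithms of moduli express the coordinates of the inverse point map and so make it
  differentiable. Phases come second: for \<open>g\<close> vanishing at \<open>x\<close>, the values
  of \<open>L (g + s \<omega>)\<close> at \<open>u x\<close> approach a zero of \<open>L g\<close>,
  and there a first-order expansion compares a wild phase with a fixed slope. Moduli see phases only
  through real parts, which is why \<open>\<omega>\<close> is taken to be 1 or the imaginary unit,
  and why conjugation survives.\<close>

definition has_pd :: "'n::finite \<Rightarrow> (real^'n \<Rightarrow> 'b::real_normed_vector) \<Rightarrow> (real^'n \<Rightarrow> 'b) \<Rightarrow> bool" where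
  "has_pd i f f' \<longleftrightarrow> (\<forall>x. ((\<lambda>t. f (x + t *\<^sub>R axis i 1)) has_vector_derivative f' x) (at 0))"

text \<open>\<open>iter_pderiv\<close> is built from a chosen \<open>vector_derivative\<close>; here
  a derivative is a witness that can be exhibited and fed to an induction hypothesis. Closure
  properties are proved for \<open>Ck n\<close> by induction on \<open>n\<close> and transferred by
  \<open>smooth_iff_Ck\<close>.\<close>

primrec Ck :: "nat \<Rightarrow> (real^'n::finite \<Rightarrow> 'b::real_normed_vector) \<Rightarrow> bool" where
  "Ck 0 f \<longleftrightarrow> continuous_on UNIV f"
| "Ck (Suc n) f \<longleftrightarrow> continuous_on UNIV f \<and> (\<forall>i. \<exists>f'. has_pd i f f' \<and> Ck n f')"

lemma has_pd_partial_deriv: "has_pd i f f' \<Longrightarrow> partial_deriv i f = f'"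
  unfolding has_pd_def partial_deriv_def by (auto intro: vector_derivative_at)

lemma has_pdD: "has_pd i f f' \<Longrightarrow> ((\<lambda>t. f (x + t *\<^sub>R axis i 1)) has_vector_derivative f' x) (at 0)"
  by (simp add: has_pd_def)

text \<open>\<open>has_pd\<close> speaks of parameter 0 only, but at every base point; moving the
  base point along the line reaches every parameter.\<close>

lemma has_pd_line:
  assumes "has_pd i f f'"
  shows "((\<lambda>t. f (x + t *\<^sub>R axis i 1)) has_vector_derivative f' (x + t *\<^sub>R axis i 1)) (at t within S)"
proof -
  have "((\<lambda>s. f ((x + t *\<^sub>R axis i 1) + s *\<^sub>R axis i 1)) has_vector_derivative f' (x + t *\<^sub>R axis i 1)) (at (t - t))"
    using has_pdD[OF assms, of "x + t *\<^sub>R axis i 1"] by simp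
  then have "(((\<lambda>s. f ((x + t *\<^sub>R axis i 1) + s *\<^sub>R axis i 1)) \<circ> (\<lambda>s. s - t)) has_vector_derivative (1 *\<^sub>R f' (x + t *\<^sub>R axis i 1))) (at t)"
    by (intro vector_diff_chain_at) (auto intro!: derivative_eq_intros)
  moreover have "((\<lambda>s. f ((x + t *\<^sub>R axis i 1) + s *\<^sub>R axis i 1)) \<circ> (\<lambda>s. s - t)) = (\<lambda>t. f (x + t *\<^sub>R axis i 1))"
    by (auto simp: o_def algebra_simps)
  ultimately show ?thesis by (auto intro: has_vector_derivative_at_within)
qed

lemma Ck_Suc_lower: "Ck (Suc n) f \<Longrightarrow> Ck n f"
proof (induction n arbitrary: f)
  case 0 then show ?case by simp
next
  case (Suc n)
  then show ?case by (metis Ck.simps(2))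
qed

text \<open>The recursion adds derivatives on the outside, while product and chain rules act on the
  innermost one. Inductions from the right end of the list rest on this switch.\<close>

lemma iter_pderiv_append: "iter_pderiv (js @ [i]) f = iter_pderiv js (partial_deriv i f)"
  by (induction js) auto

lemma smooth_partial_deriv:
  assumes "smooth f"
  shows "has_pd i f (partial_deriv i f)" "smooth (partial_deriv i f)"
proof -
  have "((\<lambda>t. f (x + t *\<^sub>R axis i 1)) has_vector_derivative partial_deriv i f x) (at 0)" for x
    using assms[unfolded smooth_def] by (metis iter_pderiv.simps)
  then show "has_pd i f (partial_deriv i f)" by (simp add: has_pd_def)
  show "smooth (partial_deriv i f)"
    unfolding smooth_def
  proof (intro conjI allI)
    fix js show "continuous_on UNIV (iter_pderiv js (partial_deriv i f))"
      using assms unfolding smooth_def by (metis iter_pderiv_append)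
  next
    fix js j x
    have "((\<lambda>t. iter_pderiv (js @ [i]) f (x + t *\<^sub>R axis j 1)) has_vector_derivative iter_pderiv (j # js @ [i]) f x) (at 0)"
      using assms unfolding smooth_def by blast
    then show "((\<lambda>t. iter_pderiv js (partial_deriv i f) (x + t *\<^sub>R axis j 1)) has_vector_derivative
        iter_pderiv (j # js) (partial_deriv i f) x) (at 0)"
      by (simp add: iter_pderiv_append)
  qed
qed

lemma smooth_continuous: "smooth f \<Longrightarrow> continuous_on UNIV f"
  unfolding smooth_def by (metis iter_pderiv.simps(1))

lemma smooth_imp_Ck: "smooth f \<Longrightarrow> Ck n f"
proof (induction n arbitrary: f)
  case (Suc n)
  then show ?case using smooth_continuous smooth_partial_deriv by (simp, blast)
qed (simp add: smooth_continuous)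

lemma Ck_iter_pderiv: "Ck (length js + n) f \<Longrightarrow> Ck n (iter_pderiv js f)"
proof (induction js arbitrary: n)
  case Nil then show ?case by simp
next
  case (Cons i js)
  then have "Ck (Suc n) (iter_pderiv js f)" by (metis add_Suc_shift length_Cons)
  then obtain f' where "has_pd i (iter_pderiv js f) f'" "Ck n f'" by auto
  then show ?case using has_pd_partial_deriv by fastforce
qed

lemma smooth_iff_Ck: "smooth f \<longleftrightarrow> (\<forall>n. Ck n f)"
proof
  assume *: "\<forall>n. Ck n f"
  have "Ck 1 (iter_pderiv js f)" for js
    using * Ck_iter_pderiv by blast
  then have "continuous_on UNIV (iter_pderiv js f)" "\<exists>f'. has_pd i (iter_pderiv js f) f'" for i js
    by (auto simp: numeral_eq_Suc)
  then have "continuous_on UNIV (iter_pderiv js f)" "has_pd i (iter_pderiv js f) (iter_pderiv (i # js) f)" for i js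
    using has_pd_partial_deriv by fastforce+
  then show "smooth f" unfolding smooth_def has_pd_def by blast
qed (simp add: smooth_imp_Ck)

lemma smooth_stepI:
  assumes "continuous_on UNIV f" "\<And>i. has_pd i f (f' i)" "\<And>i. smooth (f' i)"
  shows "smooth f"
  unfolding smooth_iff_Ck
proof
  fix n show "Ck n f" using assms by (cases n) (auto simp: smooth_iff_Ck)
qed

lemma smooth_iter_pderiv: "smooth f \<Longrightarrow> smooth (iter_pderiv js f)"
  by (induction js) (auto simp: smooth_partial_deriv)

lemma has_pd_const: "has_pd i (\<lambda>x. c) (\<lambda>x. 0)"
  by (simp add: has_pd_def)

lemma smooth_const [simp]: "smooth (\<lambda>x::real^'n::finite. c :: 'b::real_normed_vector)"
proof -
  have "Ck n (\<lambda>x::real^'n. c)" for n and c :: 'b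
  proof (induction n arbitrary: c)
    case (Suc n) then show ?case by (simp, metis has_pd_const)
  qed simp
  then show ?thesis by (simp add: smooth_iff_Ck)
qed

lemma has_pd_add: "has_pd i f f' \<Longrightarrow> has_pd i g g' \<Longrightarrow> has_pd i (\<lambda>x. f x + g x) (\<lambda>x. f' x + g' x)"
  unfolding has_pd_def by (auto intro!: derivative_intros)

lemma Ck_add: "Ck n f \<Longrightarrow> Ck n g \<Longrightarrow> Ck n (\<lambda>x. f x + g x)"
proof (induction n arbitrary: f g)
  case (Suc n)
  then show ?case by (auto intro!: continuous_intros) (metis has_pd_add)
qed (auto intro!: continuous_intros)

lemma smooth_add: "smooth f \<Longrightarrow> smooth g \<Longrightarrow> smooth (\<lambda>x. f x + g x)"
  by (simp add: smooth_iff_Ck Ck_add)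

lemma has_pd_linear:
  assumes "bounded_linear B" "has_pd i f f'"
  shows "has_pd i (\<lambda>x. B (f x)) (\<lambda>x. B (f' x))"
  using assms unfolding has_pd_def by (auto intro: bounded_linear.has_vector_derivative)

lemma Ck_linear: "bounded_linear B \<Longrightarrow> Ck n f \<Longrightarrow> Ck n (\<lambda>x. B (f x))"
proof (induction n arbitrary: f)
  case 0 then show ?case by (auto intro: bounded_linear.continuous_on)
next
  case (Suc n)
  then show ?case by (auto intro: bounded_linear.continuous_on) (metis has_pd_linear)
qed

lemma smooth_linear: "bounded_linear B \<Longrightarrow> smooth f \<Longrightarrow> smooth (\<lambda>x. B (f x))"
  by (simp add: smooth_iff_Ck Ck_linear)

lemma smooth_minus: "smooth f \<Longrightarrow> smooth (\<lambda>x. - f x)"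
  using smooth_linear[OF bounded_linear_minus[OF bounded_linear_ident], of f] .

lemma smooth_diff: "smooth f \<Longrightarrow> smooth g \<Longrightarrow> smooth (\<lambda>x. f x - g x)"
  using smooth_add[of f "\<lambda>x. - g x"] smooth_minus[of g] by simp

lemma smooth_cnj: "smooth f \<Longrightarrow> smooth (\<lambda>x. cnj (f x))"
  by (rule smooth_linear[OF bounded_linear_cnj])

lemma smooth_of_real: "smooth f \<Longrightarrow> smooth (\<lambda>x. of_real (f x) :: 'b :: real_normed_algebra_1)"
  by (rule smooth_linear[OF bounded_linear_of_real])

lemma has_pd_mult:
  fixes f g :: "real^'n \<Rightarrow> 'b::real_normed_algebra"
  shows "has_pd i f f' \<Longrightarrow> has_pd i g g' \<Longrightarrow> has_pd i (\<lambda>x. f x * g x) (\<lambda>x. f x * g' x + f' x * g x)"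
  unfolding has_pd_def
  by (auto intro!: derivative_eq_intros)

lemma Ck_mult:
  fixes f g :: "real^'n \<Rightarrow> 'b::real_normed_algebra"
  shows "Ck n f \<Longrightarrow> Ck n g \<Longrightarrow> Ck n (\<lambda>x. f x * g x)"
proof (induction n arbitrary: f g)
  case (Suc n)
  show ?case
  proof (simp, intro conjI allI)
    show "continuous_on UNIV (\<lambda>x. f x * g x)" using Suc.prems by (auto intro!: continuous_intros)
    fix i
    obtain f' g' where "has_pd i f f'" "has_pd i g g'" "Ck n f'" "Ck n g'"
      using Suc.prems by fastforce
    moreover have "Ck n f" "Ck n g" using Suc.prems Ck_Suc_lower by blast+
    ultimately show "\<exists>h. has_pd i (\<lambda>x. f x * g x) h \<and> Ck n h"
      using has_pd_mult[of i f f' g g']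
      by (intro exI[of _ "\<lambda>x. f x * g' x + f' x * g x"]) (auto intro!: Ck_add Suc.IH)
  qed
qed (auto intro!: continuous_intros)

lemma smooth_mult:
  fixes f g :: "real^'n \<Rightarrow> 'b::real_normed_algebra"
  shows "smooth f \<Longrightarrow> smooth g \<Longrightarrow> smooth (\<lambda>x. f x * g x)"
  by (simp add: smooth_iff_Ck Ck_mult)

lemma smooth_power:
  fixes f :: "real^'n \<Rightarrow> 'b::real_normed_algebra_1"
  shows "smooth f \<Longrightarrow> smooth (\<lambda>x. f x ^ k)"
  by (induction k) (auto intro: smooth_mult)

lemma smooth_sum: "(\<And>a. a \<in> A \<Longrightarrow> smooth (f a)) \<Longrightarrow> smooth (\<lambda>x. \<Sum>a\<in>A. f a x)"
  by (induction A rule: infinite_finite_induct) (auto intro: smooth_add)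

lemma has_pd_nth: "has_pd i (\<lambda>x::real^'n. x $ j) (\<lambda>x. if i = j then 1 else 0)"
  unfolding has_pd_def by (auto simp: axis_def intro!: derivative_eq_intros)

lemma smooth_nth: "smooth (\<lambda>x::real^'n. x $ j)"
  by (rule smooth_stepI[OF _ has_pd_nth]) (auto intro!: continuous_intros)

lemma smooth_affine_comp:
  fixes f :: "real^'n \<Rightarrow> 'b::real_normed_vector"
  assumes "smooth f"
  shows "smooth (\<lambda>x. f (a + c *\<^sub>R x))"
proof -
  have pd: "has_pd i (\<lambda>x. f (a + c *\<^sub>R x)) (\<lambda>x. c *\<^sub>R f' (a + c *\<^sub>R x))" if "has_pd i f f'" for i and f f' :: "real^'n \<Rightarrow> 'b"
    unfolding has_pd_def
  proof
    fix x
    have "((\<lambda>t. f (a + c *\<^sub>R x + t *\<^sub>R axis i 1)) has_vector_derivative f' (a + c *\<^sub>R x)) (at (c * 0))"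
      using has_pdD[OF that, of "a + c *\<^sub>R x"] by simp
    then have "(((\<lambda>t. f (a + c *\<^sub>R x + t *\<^sub>R axis i 1)) \<circ> (\<lambda>t. c * t)) has_vector_derivative (c *\<^sub>R f' (a + c *\<^sub>R x))) (at 0)"
      by (intro vector_diff_chain_at) (auto intro!: derivative_eq_intros)
    then show "((\<lambda>t. f (a + c *\<^sub>R (x + t *\<^sub>R axis i 1))) has_vector_derivative (c *\<^sub>R f' (a + c *\<^sub>R x))) (at 0)"
      by (simp add: o_def algebra_simps)
  qed
  have "Ck n (\<lambda>x. f (a + c *\<^sub>R x))" if "Ck n f" for n and f :: "real^'n \<Rightarrow> 'b"
    using that
  proof (induction n arbitrary: f)
    case 0 then show ?case by (auto intro!: continuous_on_compose2[of UNIV f] continuous_intros)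
  next
    case (Suc n)
    show ?case
    proof (simp, intro conjI allI)
      show "continuous_on UNIV (\<lambda>x. f (a + c *\<^sub>R x))"
        using Suc.prems by (auto intro!: continuous_on_compose2[of UNIV f] continuous_intros)
      fix i obtain f' where "has_pd i f f'" "Ck n f'" using Suc.prems by auto
      then show "\<exists>g. has_pd i (\<lambda>x. f (a + c *\<^sub>R x)) g \<and> Ck n g"
        using pd Suc.IH Ck_linear[OF bounded_linear_scaleR_right] by blast
    qed
  qed
  with assms show ?thesis by (simp add: smooth_iff_Ck)
qed

lemma has_pd_field_compose:
  fixes g :: "real^'n \<Rightarrow> 'b::real_normed_field"
  assumes "\<And>z. (F has_field_derivative F' z) (at z)" "has_pd i g g'"
  shows "has_pd i (\<lambda>x. F (g x)) (\<lambda>x. g' x * F' (g x))"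
  unfolding has_pd_def
proof
  fix x
  have "(F has_field_derivative F' (g x)) (at (g (x + 0 *\<^sub>R axis i 1)))" using assms(1) by simp
  with has_pdD[OF assms(2), of x]
  show "((\<lambda>t. F (g (x + t *\<^sub>R axis i 1))) has_vector_derivative g' x * F' (g x)) (at 0)"
    using field_vector_diff_chain_at[of "\<lambda>t. g (x + t *\<^sub>R axis i 1)" "g' x" 0 F "F' (g x)"]
    by (simp add: o_def)
qed

text \<open>\<open>P\<close> is a class of outer functions closed under differentiation: the
  derivative of the composite involves \<open>F'\<close>, so the induction has to range over all of
  \<open>P\<close>. It is used for \<open>exp\<close> alone and for all \<open>flat_fun p\<close>
  together.\<close>

lemma smooth_field_compose:
  fixes g :: "real^'n \<Rightarrow> 'b::real_normed_field"
  assumes step: "\<And>F. P F \<Longrightarrow> \<exists>F'. P F' \<and> (\<forall>z. (F has_field_derivative F' z) (at z))"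
    and "P F" "smooth g"
  shows "smooth (\<lambda>x. F (g x))"
proof -
  have "Ck n (\<lambda>x. F (g x))" if "P F" for n F
    using that
  proof (induction n arbitrary: F)
    case (0 F)
    then show ?case using step[OF 0] smooth_continuous[OF \<open>smooth g\<close>]
      by (auto intro!: continuous_on_compose2[of UNIV F UNIV g] DERIV_continuous_on)
  next
    case (Suc n)
    obtain F' where F': "P F'" "\<And>z. (F has_field_derivative F' z) (at z)" using step Suc.prems by blast
    show ?case
    proof (simp, intro conjI allI)
      show "continuous_on UNIV (\<lambda>x. F (g x))"
        using F' smooth_continuous[OF \<open>smooth g\<close>]
        by (auto intro!: continuous_on_compose2[of UNIV F UNIV g] DERIV_continuous_on)
      fix i
      show "\<exists>f'. has_pd i (\<lambda>x. F (g x)) f' \<and> Ck n f'"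
        using has_pd_field_compose[OF F'(2) smooth_partial_deriv(1)[OF \<open>smooth g\<close>]]
          Ck_mult[OF smooth_imp_Ck[OF smooth_partial_deriv(2)[OF \<open>smooth g\<close>]] Suc.IH[OF F'(1)]]
        by blast
    qed
  qed
  with assms(2) show ?thesis by (simp add: smooth_iff_Ck)
qed

lemma smooth_exp:
  fixes g :: "real^'n \<Rightarrow> 'b::{real_normed_field,banach}"
  assumes "smooth g" shows "smooth (\<lambda>x. exp (g x))"
  by (rule smooth_field_compose[where P = "\<lambda>F. F = exp" and F = exp]) (use assms DERIV_exp in auto)

text \<open>Inversion is not differentiable at 0, so \<open>smooth_field_compose\<close> does not
  apply. The derivative is again built from \<open>inverse (g x)\<close>, so order \<open>n\<close>
  of the inverse yields order \<open>n + 1\<close>.\<close>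

lemma smooth_inverse:
  fixes g :: "real^'n \<Rightarrow> 'b::real_normed_field"
  assumes "smooth g" "\<And>x. g x \<noteq> 0"
  shows "smooth (\<lambda>x. inverse (g x))"
proof -
  have pd: "has_pd i (\<lambda>x. inverse (g x)) (\<lambda>x. - (inverse (g x) * partial_deriv i g x * inverse (g x)))" for i
    unfolding has_pd_def
  proof
    fix x
    have "(inverse has_derivative (\<lambda>h. - (inverse (g x) * h * inverse (g x)))) (at (g (x + 0 *\<^sub>R axis i 1)))"
      using has_derivative_inverse'[OF assms(2), of x UNIV] by simp
    from vector_derivative_diff_chain_within[OF has_pdD[OF smooth_partial_deriv(1)[OF assms(1)], of x i, unfolded has_vector_derivative_def[symmetric]] has_derivative_at_withinI[OF this]]
    show "((\<lambda>t. inverse (g (x + t *\<^sub>R axis i 1))) has_vector_derivative - (inverse (g x) * partial_deriv i g x * inverse (g x))) (at 0)"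
      by (simp add: o_def)
  qed
  have "Ck n (\<lambda>x. inverse (g x))" for n
  proof (induction n)
    case 0 show ?case using assms smooth_continuous by (auto intro!: continuous_intros)
  next
    case (Suc n)
    have "Ck n (\<lambda>x. - (inverse (g x) * partial_deriv i g x * inverse (g x)))" for i
      using Ck_linear[OF bounded_linear_minus[OF bounded_linear_ident] Ck_mult[OF Ck_mult[OF Suc smooth_imp_Ck[OF smooth_partial_deriv(2)[OF assms(1)]]] Suc]] .
    moreover have "continuous_on UNIV (\<lambda>x. inverse (g x))"
      using assms smooth_continuous by (auto intro!: continuous_intros)
    ultimately show ?case using pd by auto
  qed
  then show ?thesis by (simp add: smooth_iff_Ck)
qed

lemma partial_deriv_cong_ev:
  assumes "\<forall>\<^sub>F y in nhds x. f y = g y"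
  shows "partial_deriv i f x = partial_deriv i g x"
proof -
  have "((\<lambda>t. x + t *\<^sub>R axis i 1) \<longlongrightarrow> x + 0 *\<^sub>R axis i 1) (nhds 0)"
    by (intro tendsto_intros filterlim_ident)
  then have lim: "filterlim (\<lambda>t. x + t *\<^sub>R axis i 1) (nhds x) (nhds (0::real))" by simp
  have ev: "\<forall>\<^sub>F t in nhds (0::real). f (x + t *\<^sub>R axis i 1) = g (x + t *\<^sub>R axis i 1)"
    using filterlim_iff[THEN iffD1, OF lim] assms by blast
  show ?thesis unfolding partial_deriv_def
    by (rule vector_derivative_cong_eq) (use ev in auto)
qed

lemma iter_pderiv_cong_ev:
  assumes "\<forall>\<^sub>F y in nhds x. f y = g y"
  shows "\<forall>\<^sub>F y in nhds x. iter_pderiv js f y = iter_pderiv js g y"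
proof (induction js)
  case (Cons i js)
  then have "\<forall>\<^sub>F y in nhds x. \<forall>\<^sub>F z in nhds y. iter_pderiv js f z = iter_pderiv js g z"
    by (simp add: eventually_eventually)
  then show ?case by (rule eventually_mono) (auto intro: partial_deriv_cong_ev)
qed (use assms in auto)

text \<open>Derivatives depend on germs only, so near each point those of \<open>f\<close> agree
  with those of a local model; the model may change from point to point.\<close>

lemma smooth_local:
  assumes "\<And>x. \<exists>g. smooth g \<and> (\<forall>\<^sub>F y in nhds x. f y = g y)"
  shows "smooth f"
proof -
  have "Ck n f" if "\<And>x. \<exists>g. Ck n g \<and> (\<forall>\<^sub>F y in nhds x. f y = g y)" for n and f :: "real^'a \<Rightarrow> 'b"
    using that
  proof (induction n arbitrary: f)
    case (0 f)
    have "isCont f x" for x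
    proof -
      obtain g where "Ck 0 g" "\<forall>\<^sub>F y in nhds x. f y = g y" using 0 by blast
      then show ?thesis by (auto simp: continuous_on_eq_continuous_at isCont_cong)
    qed
    then show ?case by (simp add: continuous_at_imp_continuous_on)
  next
    case (Suc n f)
    have "isCont f x" for x
    proof -
      obtain g where "Ck (Suc n) g" "\<forall>\<^sub>F y in nhds x. f y = g y" using Suc.prems by blast
      then show ?thesis by (auto simp: continuous_on_eq_continuous_at isCont_cong)
    qed
    moreover have "has_pd i f (partial_deriv i f) \<and> Ck n (partial_deriv i f)" for i
    proof
      show "has_pd i f (partial_deriv i f)" unfolding has_pd_def
      proof
        fix x
        obtain g where g: "Ck (Suc n) g" "\<forall>\<^sub>F y in nhds x. f y = g y" using Suc.prems by blast
        then have pg: "has_pd i g (partial_deriv i g)" by (auto dest: has_pd_partial_deriv)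
        have "((\<lambda>t. x + t *\<^sub>R axis i 1) \<longlongrightarrow> x + 0 *\<^sub>R axis i 1) (nhds 0)"
          by (intro tendsto_intros filterlim_ident)
        then have lim: "filterlim (\<lambda>t. x + t *\<^sub>R axis i 1) (nhds x) (nhds (0::real))" by simp
        have "\<forall>\<^sub>F t in nhds (0::real). f (x + t *\<^sub>R axis i 1) = g (x + t *\<^sub>R axis i 1)"
          using filterlim_iff[THEN iffD1, OF lim] g(2) by blast
        then show "((\<lambda>t. f (x + t *\<^sub>R axis i 1)) has_vector_derivative partial_deriv i f x) (at 0)"
          using has_pdD[OF pg, of x] partial_deriv_cong_ev[OF g(2), of i]
          by (subst has_vector_derivative_cong_ev[OF _ _ ]) (auto elim: eventually_mono dest: eventually_nhds_x_imp_x)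
      qed
      show "Ck n (partial_deriv i f)"
      proof (rule Suc.IH)
        fix x
        obtain g where g: "Ck (Suc n) g" "\<forall>\<^sub>F y in nhds x. f y = g y" using Suc.prems by blast
        then have "Ck n (partial_deriv i g)" by (auto dest: has_pd_partial_deriv)
        moreover have "\<forall>\<^sub>F y in nhds x. partial_deriv i f y = partial_deriv i g y"
          using iter_pderiv_cong_ev[OF g(2), of "[i]"] by simp
        ultimately show "\<exists>g. Ck n g \<and> (\<forall>\<^sub>F y in nhds x. partial_deriv i f y = g y)" by blast
      qed
    qed
    ultimately show ?case by (auto simp: continuous_at_imp_continuous_on)
  qed
  with assms show ?thesis unfolding smooth_iff_Ck by meson
qed

section \<open>Bump functions\<close>

text \<open>The increment is split into axis steps, one per coordinate, and each is compared with
  its linear part by the mean value inequality; continuity of the partial derivatives makes the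
  errors small relative to \<open>norm h\<close>.\<close>

lemma smooth_has_derivative:
  fixes f :: "real^'n \<Rightarrow> 'b::real_normed_vector"
  assumes "smooth f"
  shows "(f has_derivative (\<lambda>h. \<Sum>i\<in>UNIV. h $ i *\<^sub>R partial_deriv i f x)) (at x)"
proof -
  let ?P = "\<lambda>A h::real^'n. \<Sum>i\<in>A. h $ i *\<^sub>R (axis i 1 :: real^'n)"
  have nP: "norm (?P A h) \<le> real (card A) * norm h" for A h
  proof -
    have "norm (?P A h) \<le> (\<Sum>i\<in>A. norm h)"
      by (rule sum_norm_le) (simp add: norm_axis_1 component_le_norm_cart)
    then show ?thesis by simp
  qed
  have main: "\<forall>e>0. \<exists>d>0. \<forall>h. norm h < d \<longrightarrow>
      norm (f (x + ?P A h) - f x - (\<Sum>i\<in>A. h $ i *\<^sub>R partial_deriv i f x)) \<le> e * norm h" if "finite A" for A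
    using that
  proof (induction A rule: finite_induct)
    case empty then show ?case by (auto intro: exI[of _ 1])
  next
    case (insert j A)
    show ?case
    proof (intro allI impI)
      fix e :: real assume "e > 0"
      then obtain d1 where d1: "d1 > 0" "\<And>h. norm h < d1 \<Longrightarrow>
        norm (f (x + ?P A h) - f x - (\<Sum>i\<in>A. h $ i *\<^sub>R partial_deriv i f x)) \<le> (e/2) * norm h"
        using insert.IH[rule_format, of "e/2"] by auto
      have "isCont (partial_deriv j f) x"
        using smooth_continuous[OF smooth_partial_deriv(2)[OF assms]] by (simp add: continuous_on_eq_continuous_at)
      then obtain d2 where d2: "d2 > 0" "\<And>y. dist y x < d2 \<Longrightarrow> dist (partial_deriv j f y) (partial_deriv j f x) < e/2"
        using \<open>e > 0\<close> by (metis continuous_at_eps_delta half_gt_zero)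
      \<comment> \<open>The intermediate points lie within \<open>(card A + 1) * norm h\<close> of
        \<open>x\<close>, hence this share of \<open>d2\<close>.\<close>
      define d where "d = min d1 (d2 / (real (card A) + 1))"
      have "d > 0" using d1 d2 by (simp add: d_def)
      moreover have "norm (f (x + ?P (insert j A) h) - f x - (\<Sum>i\<in>insert j A. h $ i *\<^sub>R partial_deriv i f x)) \<le> e * norm h"
        if h: "norm h < d" for h
      proof -
        define z where "z = x + ?P A h"
        let ?k = "\<lambda>t. f (z + t *\<^sub>R axis j 1) - t *\<^sub>R partial_deriv j f x"
        have "norm (?k (h $ j) - ?k 0) \<le> (e/2) * norm (h $ j - 0)"
        proof (rule differentiable_bound[where S = "closed_segment 0 (h $ j)"])
          fix t assume t: "t \<in> closed_segment 0 (h $ j)"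
          have tn: "\<bar>t\<bar> \<le> norm h"
            using t component_le_norm_cart[of h j] by (auto simp: closed_segment_eq_real_ivl split: if_splits)
          show "(?k has_derivative (\<lambda>s. s *\<^sub>R (partial_deriv j f (z + t *\<^sub>R axis j 1) - partial_deriv j f x)))
              (at t within closed_segment 0 (h $ j))"
            unfolding has_vector_derivative_def[symmetric]
            by (auto intro!: derivative_eq_intros has_pd_line smooth_partial_deriv assms)
          have "norm (?P A h + t *\<^sub>R axis j 1) \<le> real (card A) * norm h + norm h"
            using nP[where A = A and h = h] tn by (intro norm_triangle_le) (simp add: norm_axis_1)
          also have "\<dots> < d2"
            using h by (simp add: d_def field_simps)
          finally have "dist (z + t *\<^sub>R axis j 1) x < d2" by (simp add: z_def dist_norm algebra_simps)
          then have "norm (partial_deriv j f (z + t *\<^sub>R axis j 1) - partial_deriv j f x) \<le> e/2"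
            using d2(2) by (force simp: dist_norm)
          then show "onorm (\<lambda>s. s *\<^sub>R (partial_deriv j f (z + t *\<^sub>R axis j 1) - partial_deriv j f x)) \<le> e/2"
          proof (intro onorm_le)
            fix s :: real
            assume "norm (partial_deriv j f (z + t *\<^sub>R axis j 1) - partial_deriv j f x) \<le> e/2"
            from mult_left_mono[OF this abs_ge_zero[of s]]
            show "norm (s *\<^sub>R (partial_deriv j f (z + t *\<^sub>R axis j 1) - partial_deriv j f x)) \<le> e/2 * norm s"
              by (simp add: mult.commute)
          qed
        qed auto
        also have "\<dots> \<le> (e/2) * norm h"
          using component_le_norm_cart[of h j] \<open>e > 0\<close> by (intro mult_left_mono) auto
        finally have 1: "norm (f (z + h $ j *\<^sub>R axis j 1) - f z - h $ j *\<^sub>R partial_deriv j f x) \<le> (e/2) * norm h"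
          by (simp add: algebra_simps)
        have 2: "norm (f z - f x - (\<Sum>i\<in>A. h $ i *\<^sub>R partial_deriv i f x)) \<le> (e/2) * norm h"
          using d1(2)[of h] h by (simp add: z_def d_def)
        have eq: "f (x + ?P (insert j A) h) - f x - (\<Sum>i\<in>insert j A. h $ i *\<^sub>R partial_deriv i f x)
          = (f (z + h $ j *\<^sub>R axis j 1) - f z - h $ j *\<^sub>R partial_deriv j f x) + (f z - f x - (\<Sum>i\<in>A. h $ i *\<^sub>R partial_deriv i f x))"
          using insert.hyps by (simp add: z_def algebra_simps)
        show ?thesis by (subst eq, rule order_trans[OF norm_triangle_mono[OF 1 2]]) (simp only: field_sum_of_halves flip: distrib_right)
      qed
      ultimately show "\<exists>d>0. \<forall>h. norm h < d \<longrightarrow>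
         norm (f (x + ?P (insert j A) h) - f x - (\<Sum>i\<in>insert j A. h $ i *\<^sub>R partial_deriv i f x)) \<le> e * norm h"
        by blast
    qed
  qed
  have UP: "?P UNIV h = h" for h
    using basis_expansion[of h] by (simp add: scalar_mult_eq_scaleR)
  show ?thesis
    unfolding has_derivative_within_alt
  proof (intro conjI allI impI)
    show "bounded_linear (\<lambda>h. \<Sum>i\<in>UNIV. h $ i *\<^sub>R partial_deriv i f x)"
      by (intro bounded_linear_sum bounded_linear_compose[OF bounded_linear_scaleR_left bounded_linear_vec_nth])
    fix e :: real assume "e > 0"
    then obtain d where d: "d > 0" "\<And>h. norm h < d \<Longrightarrow>
        norm (f (x + ?P UNIV h) - f x - (\<Sum>i\<in>UNIV. h $ i *\<^sub>R partial_deriv i f x)) \<le> e * norm h"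
      using main[OF finite, rule_format, OF \<open>e > 0\<close>] by blast
    have "norm (f y - f x - (\<Sum>i\<in>UNIV. (y - x) $ i *\<^sub>R partial_deriv i f x)) \<le> e * norm (y - x)"
      if "norm (y - x) < d" for y
      using d(2)[OF that] unfolding UP by simp
    then show "\<exists>d>0. \<forall>y\<in>UNIV. norm (y - x) < d \<longrightarrow> norm (f y - f x - (\<Sum>i\<in>UNIV. (y - x) $ i *\<^sub>R partial_deriv i f x)) \<le> e * norm (y - x)"
      using d(1) by auto
  qed
qed

lemma smooth_differentiable: "smooth f \<Longrightarrow> f differentiable (at x)"
  using smooth_has_derivative differentiable_def by blast

lemma smooth_ball_bound:
  fixes f :: "real^'n \<Rightarrow> 'b::real_normed_vector"
  assumes "smooth f" "\<And>i y. y \<in> ball x r \<Longrightarrow> norm (partial_deriv i f y) \<le> B" "y \<in> ball x r"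
  shows "norm (f y - f x) \<le> real CARD('n) * B * norm (y - x)"
proof (rule differentiable_bound[where S = "ball x r"])
  fix z assume z: "z \<in> ball x r"
  show "(f has_derivative (\<lambda>h. \<Sum>i\<in>UNIV. h $ i *\<^sub>R partial_deriv i f z)) (at z within ball x r)"
    by (rule has_derivative_at_withinI[OF smooth_has_derivative[OF assms(1)]])
  show "onorm (\<lambda>h. \<Sum>i\<in>UNIV. h $ i *\<^sub>R partial_deriv i f z) \<le> real CARD('n) * B"
  proof (rule onorm_le)
    fix h :: "real^'n"
    have "norm (\<Sum>i\<in>UNIV. h $ i *\<^sub>R partial_deriv i f z) \<le> (\<Sum>i\<in>(UNIV::'n set). norm h * B)"
      by (rule sum_norm_le) (auto intro!: mult_mono assms(2)[OF z] component_le_norm_cart)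
    then show "norm (\<Sum>i\<in>UNIV. h $ i *\<^sub>R partial_deriv i f z) \<le> real CARD('n) * B * norm h"
      by (simp add: mult_ac)
  qed
qed (use assms le_less_trans[OF zero_le_dist] in auto)

text \<open>The polynomial parameter makes the family closed under differentiation, as
  \<open>smooth_field_compose\<close> wants; the bumps use \<open>p = 1\<close>.\<close>

definition flat_fun :: "real poly \<Rightarrow> real \<Rightarrow> real" where
  "flat_fun p t = (if t > 0 then poly p (inverse t) * exp (- inverse t) else 0)"

lemma poly_exp_tendsto: "((\<lambda>s. poly p s * exp (- s)) \<longlongrightarrow> (0::real)) at_top"
proof -
  have "((\<lambda>s. \<Sum>i\<le>degree p. coeff p i * (s ^ i / exp s)) \<longlongrightarrow> (\<Sum>i\<le>degree p. coeff p i * 0)) at_top"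
    by (intro tendsto_intros tendsto_power_div_exp_0)
  then show ?thesis
    by (simp add: poly_altdef sum_distrib_right exp_minus divide_inverse mult.assoc)
qed

text \<open>With \<open>s = 1/t\<close>, differentiation sends \<open>p(s) exp(-s)\<close> to
  \<open>s^2 (p(s) - p'(s)) exp(-s)\<close>, and \<open>[:0,0,1:]\<close> is the monomial of degree
  two. At 0 the difference quotient is \<open>s p(s) exp(-s)\<close>, which tends to 0.\<close>

lemma flat_fun_deriv:
  "(flat_fun p has_field_derivative flat_fun ([:0,0,1:] * (p - pderiv p)) t) (at t)"
proof -
  consider "t > 0" | "t < 0" | "t = 0" by linarith
  then show ?thesis
  proof cases
    case 1
    have "((\<lambda>t. poly p (inverse t) * exp (- inverse t)) has_field_derivative flat_fun ([:0,0,1:] * (p - pderiv p)) t) (at t)"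
      using 1 by (auto intro!: derivative_eq_intros simp: flat_fun_def field_simps power2_eq_square)
    then show ?thesis
      by (rule has_field_derivative_transform_within_open[where S = "{0<..}"]) (use 1 in \<open>auto simp: flat_fun_def\<close>)
  next
    case 2
    have "((\<lambda>t. 0) has_field_derivative flat_fun ([:0,0,1:] * (p - pderiv p)) t) (at t)"
      using 2 by (auto simp: flat_fun_def)
    then show ?thesis
      by (rule has_field_derivative_transform_within_open[where S = "{..<0}"]) (use 2 in \<open>auto simp: flat_fun_def\<close>)
  next
    case 3
    have "((\<lambda>t. flat_fun p t / t) \<longlongrightarrow> 0) (at 0)"
    proof (rule filterlim_split_at)
      show "((\<lambda>t. flat_fun p t / t) \<longlongrightarrow> 0) (at_left 0)"
        by (rule tendsto_eventually) (auto simp: eventually_at_left_field flat_fun_def intro!: exI[of _ "-1"])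
      have "((\<lambda>t. poly (pCons 0 p) (inverse t) * exp (- inverse t)) \<longlongrightarrow> 0) (at_right (0::real))"
        using filterlim_compose[OF poly_exp_tendsto[of "pCons 0 p"] filterlim_inverse_at_top_right] .
      then show "((\<lambda>t. flat_fun p t / t) \<longlongrightarrow> 0) (at_right 0)"
        by (rule tendsto_cong[THEN iffD1, rotated])
          (auto simp: eventually_at_right_field flat_fun_def field_simps intro!: exI[of _ 1])
    qed
    then show ?thesis using 3 by (simp add: has_field_derivative_iff flat_fun_def)
  qed
qed

lemma smooth_flat_fun: "smooth g \<Longrightarrow> smooth (\<lambda>x. flat_fun p (g x))"
  by (rule smooth_field_compose[where P = "\<lambda>F. \<exists>p. F = flat_fun p"]) (use flat_fun_deriv in blast)+

lemma flat_fun_1_pos_iff: "flat_fun 1 t > 0 \<longleftrightarrow> t > 0" and flat_fun_1_nonneg: "flat_fun 1 t \<ge> 0"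
  and flat_fun_1_0: "t \<le> 0 \<Longrightarrow> flat_fun 1 t = 0"
  by (auto simp: flat_fun_def)

text \<open>The first flat function vanishes once \<open>x \<bullet> x\<close> is at least 1/2, the
  second while it is at most 1/4, and they never vanish together. The quotient is therefore 1 up to
  radius 1/2 and 0 from a radius below 3/4 on.\<close>

definition std_bump :: "real^'n::finite \<Rightarrow> complex" where
  "std_bump x = of_real (flat_fun 1 (1 - 2 * (x \<bullet> x)) * inverse (flat_fun 1 (1 - 2 * (x \<bullet> x)) + flat_fun 1 (4 * (x \<bullet> x) - 1)))"

lemma smooth_inner_self: "smooth (\<lambda>x::real^'n. x \<bullet> x)"
  unfolding inner_vec_def by (intro smooth_sum) (auto intro!: smooth_mult smooth_nth)

lemma bump_denom_pos: "flat_fun 1 (1 - 2 * s) + flat_fun 1 (4 * s - 1) > 0"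
proof (cases "s < 1/2")
  case True
  then show ?thesis using flat_fun_1_pos_iff[of "1 - 2 * s"] flat_fun_1_nonneg[of "4 * s - 1"] by simp
next
  case False
  then show ?thesis using flat_fun_1_pos_iff[of "4 * s - 1"] flat_fun_1_nonneg[of "1 - 2 * s"] by simp
qed

lemma smooth_std_bump: "smooth (std_bump :: real^'n::finite \<Rightarrow> complex)"
proof -
  have "smooth (\<lambda>x::real^'n. a * (x \<bullet> x) - b)" for a b :: real
    by (intro smooth_diff smooth_mult smooth_inner_self smooth_const)
  moreover have "smooth (\<lambda>x::real^'n. 1 - 2 * (x \<bullet> x))"
    by (intro smooth_diff smooth_mult smooth_inner_self smooth_const)
  ultimately show ?thesis
    unfolding std_bump_def
    by (intro smooth_of_real smooth_mult smooth_flat_fun smooth_inverse smooth_add) (use bump_denom_pos in \<open>auto simp: less_le\<close>)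
qed

lemma std_bump_1: "norm x \<le> 1/2 \<Longrightarrow> std_bump x = 1"
proof -
  assume "norm x \<le> 1/2"
  then have "4 * (x \<bullet> x) \<le> 1" using power_mono[of "norm x" "1/2" 2] by (simp add: power2_norm_eq_inner) (simp add: power2_eq_square)
  then show ?thesis using bump_denom_pos[of "x \<bullet> x"] by (simp add: std_bump_def flat_fun_1_0)
qed

lemma std_bump_0: "norm x \<ge> 3/4 \<Longrightarrow> std_bump x = 0"
proof -
  assume "norm x \<ge> 3/4"
  then have "2 * (x \<bullet> x) \<ge> 1" using power_mono[of "3/4" "norm x" 2] by (simp add: power2_norm_eq_inner) (simp add: power2_eq_square)
  then show ?thesis by (simp add: std_bump_def flat_fun_1_0)
qed

lemma std_bump_range: "\<exists>t. std_bump x = of_real t \<and> 0 \<le> t \<and> t \<le> 1"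
  using bump_denom_pos[of "x \<bullet> x"] flat_fun_1_nonneg[of "1 - 2 * (x \<bullet> x)"] flat_fun_1_nonneg[of "4 * (x \<bullet> x) - 1"]
  by (auto simp: std_bump_def intro!: exI[of _ "flat_fun 1 (1 - 2 * (x \<bullet> x)) * inverse (flat_fun 1 (1 - 2 * (x \<bullet> x)) + flat_fun 1 (4 * (x \<bullet> x) - 1))"])
    (auto simp: field_simps)

definition bump :: "real^'n::finite \<Rightarrow> real \<Rightarrow> real^'n \<Rightarrow> complex" where
  "bump x r y = std_bump ((1 / r) *\<^sub>R (y - x))"

lemma smooth_bump: "smooth (bump x r)"
proof -
  have "bump x r = (\<lambda>y. std_bump ((- (1/r) *\<^sub>R x) + (1/r) *\<^sub>R y))"
    by (auto simp: bump_def algebra_simps)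
  then show ?thesis using smooth_affine_comp[OF smooth_std_bump] by metis
qed

lemma bump_1: "r > 0 \<Longrightarrow> dist x y \<le> r/2 \<Longrightarrow> bump x r y = 1"
  unfolding bump_def norm_scaleR by (rule std_bump_1) (simp add: dist_norm norm_minus_commute divide_simps del: scaleR_right_diff_distrib)

text \<open>The radius 3/4 instead of 1 leaves a margin, since \<open>iter_pderiv_outside\<close>
  kills derivatives only strictly beyond the radius of vanishing.\<close>

lemma bump_0: "r > 0 \<Longrightarrow> dist x y \<ge> 3/4 * r \<Longrightarrow> bump x r y = 0"
  unfolding bump_def by (rule std_bump_0) (simp add: dist_norm norm_minus_commute divide_simps)

lemma bump_1_ev: "r > 0 \<Longrightarrow> \<forall>\<^sub>F y in nhds x. bump x r y = 1"
  by (rule eventually_mono[OF eventually_nhds_in_open[of "ball x (r/2)"]]) (auto intro: bump_1)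

lemma bump_range: "\<exists>t. bump x r y = of_real t \<and> 0 \<le> t \<and> t \<le> 1"
  unfolding bump_def by (rule std_bump_range)

lemma iter_pderiv_outside:
  assumes "\<And>y. dist x y \<ge> \<rho> \<Longrightarrow> h y = 0" "dist x y > \<rho>"
  shows "iter_pderiv js h y = 0"
proof -
  have "\<forall>\<^sub>F z in nhds y. h z = 0"
    by (rule eventually_mono[OF eventually_nhds_in_open[of "- cball x \<rho>"]]) (use assms in auto)
  then have "iter_pderiv js h y = iter_pderiv js (\<lambda>_. 0) y"
    using iter_pderiv_cong_ev eventually_nhds_x_imp_x by fast
  also have "\<dots> = 0"
  proof -
    have "iter_pderiv js (\<lambda>_. 0) = (\<lambda>_::real^'a. 0 :: 'b)"
      by (induction js) (auto simp: has_pd_partial_deriv[OF has_pd_const])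
    then show ?thesis by simp
  qed
  finally show ?thesis .
qed

lemma iter_pderiv_linear:
  assumes "bounded_linear B" "smooth f"
  shows "iter_pderiv js (\<lambda>x. B (f x)) = (\<lambda>x. B (iter_pderiv js f x))"
proof (induction js)
  case (Cons i js)
  then show ?case
    using has_pd_partial_deriv[OF has_pd_linear[OF assms(1) smooth_partial_deriv(1)[OF smooth_iter_pderiv[OF assms(2)]]]]
    by simp
qed simp

lemma iter_pderiv_add:
  assumes "smooth f" "smooth g"
  shows "iter_pderiv js (\<lambda>x. f x + g x) = (\<lambda>x. iter_pderiv js f x + iter_pderiv js g x)"
proof (induction js)
  case (Cons i js)
  then show ?case
    using has_pd_partial_deriv[OF has_pd_add[OF smooth_partial_deriv(1)[OF smooth_iter_pderiv[OF assms(1)]] smooth_partial_deriv(1)[OF smooth_iter_pderiv[OF assms(2)]]]]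
    by simp
qed simp

text \<open>Only finitely many derivative lists have length at most \<open>k\<close>, so the sum of
  the absolute constants serves them all. Index set and weight are abstract, to cover both a single
  function and a family at several scales.\<close>

lemma uniform_pderiv_bound:
  assumes "\<And>js. length js \<le> k \<Longrightarrow> \<exists>C. \<forall>a\<in>I. P js a \<longrightarrow> N js a \<le> (C::real) * w a" "\<And>a. a \<in> I \<Longrightarrow> w a \<ge> (0::real)"
  shows "\<exists>C\<ge>0. \<forall>js::'n::finite list. length js \<le> k \<longrightarrow> (\<forall>a\<in>I. P js a \<longrightarrow> N js a \<le> C * w a)"
proof -
  have fin: "finite {js::'n list. length js \<le> k}"
    using finite_lists_length_le[of "UNIV :: 'n set" k] by simp
  have "\<forall>js\<in>{js::'n list. length js \<le> k}. \<exists>C. \<forall>a\<in>I. P js a \<longrightarrow> N js a \<le> C * w a"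
    using assms(1) by blast
  then obtain C where C: "\<And>js a. length (js::'n list) \<le> k \<Longrightarrow> a \<in> I \<Longrightarrow> P js a \<Longrightarrow> N js a \<le> C js * w a"
    by (metis mem_Collect_eq)
  let ?D = "\<Sum>js | length (js::'n list) \<le> k. \<bar>C js\<bar>"
  have "N js a \<le> ?D * w a" if "length js \<le> k" "a \<in> I" "P js a" for js a
  proof -
    have "\<bar>C js\<bar> \<le> ?D" by (rule member_le_sum) (use that fin in auto)
    then have "C js * w a \<le> ?D * w a" by (intro mult_right_mono assms(2) that) auto
    then show ?thesis using C[OF that] by linarith
  qed
  moreover have "?D \<ge> 0" by (intro sum_nonneg) auto
  ultimately show ?thesis by blast
qed

lemma compact_support_bound:
  fixes h :: "real^'n::finite \<Rightarrow> 'b::real_normed_vector"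
  assumes "smooth h" "\<And>y. dist x y \<ge> \<rho> \<Longrightarrow> h y = 0"
  shows "\<exists>C\<ge>0. \<forall>js. length js \<le> k \<longrightarrow> (\<forall>y. norm (iter_pderiv js h y) \<le> C)"
proof -
  have "\<exists>C. \<forall>a\<in>UNIV. True \<longrightarrow> norm (iter_pderiv js h a) \<le> C * 1" for js
  proof -
    have "compact (iter_pderiv js h ` cball x \<rho>)"
      by (intro compact_continuous_image continuous_on_subset[OF smooth_continuous[OF smooth_iter_pderiv[OF assms(1)]]]) auto
    then have "bounded (iter_pderiv js h ` cball x \<rho>)" by (rule compact_imp_bounded)
    then obtain C where C: "\<And>y. y \<in> cball x \<rho> \<Longrightarrow> norm (iter_pderiv js h y) \<le> C"
      unfolding bounded_iff by blast
    have "norm (iter_pderiv js h y) \<le> max C 0" for y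
    proof (cases "y \<in> cball x \<rho>")
      case True then show ?thesis using C by fastforce
    next
      case False
      then show ?thesis using iter_pderiv_outside[where x = x and \<rho> = \<rho> and h = h and y = y and js = js] assms(2) by auto
    qed
    then show ?thesis by auto
  qed
  then have "\<exists>C\<ge>0. \<forall>js::'n list. length js \<le> k \<longrightarrow> (\<forall>a\<in>UNIV. True \<longrightarrow> norm (iter_pderiv js h a) \<le> C * 1)"
    by (intro uniform_pderiv_bound) simp_all
  then show ?thesis by simp
qed

section \<open>Gluing bumps along a convergent sequence\<close>

text \<open>One number bounds both the order and the size: if \<open>small k (f k)\<close> for every
  \<open>k\<close>, then for a fixed derivative all but finitely many terms of the series are
  dominated by the geometric series.\<close>

definition small :: "nat \<Rightarrow> (real^'n::finite \<Rightarrow> 'b::real_normed_vector) \<Rightarrow> bool" where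
  "small k f \<longleftrightarrow> (\<forall>js. length js \<le> k \<longrightarrow> (\<forall>y. norm (iter_pderiv js f y) \<le> (1/2)^k))"

text \<open>For each list \<open>js\<close> the M-test applies from index \<open>length js\<close>
  on; the limits \<open>S js\<close> are then partial derivatives of one another by termwise
  differentiation along axis lines.\<close>

lemma smooth_suminf:
  fixes f :: "nat \<Rightarrow> real^'n \<Rightarrow> 'b::banach"
  assumes "\<And>k. smooth (f k)" "\<And>k. small k (f k)"
  shows "smooth (\<lambda>y. \<Sum>k. f k y)"
proof -
  define S where "S js y = (\<Sum>k. iter_pderiv js (f k) y)" for js y
  have bd: "norm (iter_pderiv js (f k) y) \<le> (1/2)^k" if "k \<ge> length js" for js k y
    using assms(2)[of k] that unfolding small_def by blast
  have unif: "uniform_limit UNIV (\<lambda>n y. \<Sum>k<n. iter_pderiv js (f k) y) (S js) sequentially" for js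
    unfolding S_def
    by (rule Weierstrass_m_test_ev[where M = "\<lambda>k. (1/2)^k"])
      (use bd in \<open>auto simp: eventually_sequentially intro!: exI[of _ "length js"] summable_geometric\<close>)
  have cont: "continuous_on UNIV (S js)" for js
    by (rule uniform_limit_theorem[OF _ unif])
      (intro always_eventually allI continuous_on_sum smooth_continuous[OF smooth_iter_pderiv[OF assms(1)]], simp)
  have pd: "has_pd i (S js) (S (i # js))" for i js
    unfolding has_pd_def
  proof
    fix x :: "real^'n"
    have "\<exists>g. \<forall>t\<in>UNIV. (\<lambda>k. iter_pderiv js (f k) (x + t *\<^sub>R axis i 1)) sums g t \<and>
        (g has_derivative (\<lambda>h. h *\<^sub>R S (i # js) (x + t *\<^sub>R axis i 1))) (at t within UNIV)"
    proof (rule has_derivative_series[where f' = "\<lambda>k t h. h *\<^sub>R iter_pderiv (i # js) (f k) (x + t *\<^sub>R axis i 1)" and x = 0 and l = "S js (x + 0 *\<^sub>R axis i 1)"])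
      show "((\<lambda>t. iter_pderiv js (f k) (x + t *\<^sub>R axis i 1)) has_derivative (\<lambda>h. h *\<^sub>R iter_pderiv (i # js) (f k) (x + t *\<^sub>R axis i 1))) (at t within UNIV)" for k t
        using has_pd_line[OF smooth_partial_deriv(1)[OF smooth_iter_pderiv[OF assms(1)]]]
        by (simp add: has_vector_derivative_def)
      fix e :: real assume "e > 0"
      then have "\<forall>\<^sub>F n in sequentially. \<forall>y\<in>UNIV. dist (\<Sum>k<n. iter_pderiv (i # js) (f k) y) (S (i # js) y) < e"
        using unif[of "i # js"] by (simp add: uniform_limit_iff)
      then show "\<forall>\<^sub>F n in sequentially. \<forall>t\<in>UNIV. \<forall>h. norm ((\<Sum>k<n. h *\<^sub>R iter_pderiv (i # js) (f k) (x + t *\<^sub>R axis i 1)) - h *\<^sub>R S (i # js) (x + t *\<^sub>R axis i 1)) \<le> e * norm h"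
      proof eventually_elim
        case (elim n)
        show ?case
        proof (intro ballI allI)
          fix t h :: real
          have "norm ((\<Sum>k<n. iter_pderiv (i # js) (f k) (x + t *\<^sub>R axis i 1)) - S (i # js) (x + t *\<^sub>R axis i 1)) \<le> e"
            using elim by (auto simp: dist_norm intro: less_imp_le)
          then have "\<bar>h\<bar> * norm ((\<Sum>k<n. iter_pderiv (i # js) (f k) (x + t *\<^sub>R axis i 1)) - S (i # js) (x + t *\<^sub>R axis i 1)) \<le> \<bar>h\<bar> * e"
            by (rule mult_left_mono) auto
          then show "norm ((\<Sum>k<n. h *\<^sub>R iter_pderiv (i # js) (f k) (x + t *\<^sub>R axis i 1)) - h *\<^sub>R S (i # js) (x + t *\<^sub>R axis i 1)) \<le> e * norm h"
            by (simp only: flip: scaleR_sum_right scaleR_diff_right) (simp add: mult.commute)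
        qed
      qed
    next
      show "(\<lambda>k. iter_pderiv js (f k) (x + 0 *\<^sub>R axis i 1)) sums S js (x + 0 *\<^sub>R axis i 1)"
        using tendsto_uniform_limitI[OF unif[of js]] by (simp add: sums_def)
    qed auto
    then obtain g where g: "\<And>t. (\<lambda>k. iter_pderiv js (f k) (x + t *\<^sub>R axis i 1)) sums g t"
       "(g has_derivative (\<lambda>h. h *\<^sub>R S (i # js) (x + 0 *\<^sub>R axis i 1))) (at 0)"
      by blast
    have "g = (\<lambda>t. S js (x + t *\<^sub>R axis i 1))"
      using g(1) by (auto simp: S_def sums_iff)
    with g(2) show "((\<lambda>t. S js (x + t *\<^sub>R axis i 1)) has_vector_derivative S (i # js) x) (at 0)"
      by (simp add: has_vector_derivative_def)
  qed
  have "Ck n (S js)" for n js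
    by (induction n arbitrary: js) (use cont pd in \<open>auto, blast\<close>)
  then have "smooth (S [])" by (simp add: smooth_iff_Ck)
  moreover have "S [] = (\<lambda>y. \<Sum>k. f k y)" by (simp add: S_def fun_eq_iff)
  ultimately show ?thesis by simp
qed

text \<open>The engine of every regularity argument. Points are chosen with distances to
  \<open>x0\<close> more than halving, and bumps of a quarter of that distance sit in disjoint
  shells. Between the shells \<open>F\<close> vanishes, which supplies the second sequence
  \<open>Z\<close>. The property \<open>Q\<close> of a piece is carried along, to be transferred to
  \<open>F\<close> by locality.\<close>

lemma glue_bumps:
  fixes x0 :: "real^'n" and Q :: "nat \<Rightarrow> real^'n \<Rightarrow> real \<Rightarrow> (real^'n \<Rightarrow> 'b::banach) \<Rightarrow> bool"
  assumes lim: "x0 islimpt B"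
    and ex: "\<And>x k r. x \<in> B \<Longrightarrow> 0 < r \<Longrightarrow> r < 1 \<Longrightarrow> \<exists>f. smooth f \<and> (\<forall>y. r \<le> dist x y \<longrightarrow> f y = 0) \<and> small k f \<and> Q k x r f"
  shows "\<exists>F X Z. smooth F \<and> X \<longlonglongrightarrow> x0 \<and> Z \<longlonglongrightarrow> x0 \<and> (\<forall>k. \<forall>\<^sub>F y in nhds (Z k). F y = 0) \<and>
    (\<forall>k. X k \<in> B \<and> (\<exists>f r. r > 0 \<and> smooth f \<and> (\<forall>y\<in>ball (X k) r. F y = f y) \<and> Q k (X k) r f))"
proof -
  have "\<exists>X. \<forall>k. (X k \<in> B \<and> X k \<noteq> x0 \<and> dist (X k) x0 < (1/2)^k) \<and> dist (X (Suc k)) x0 < dist (X k) x0 / 2"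
  proof (rule dependent_nat_choice)
    show "\<exists>x. x \<in> B \<and> x \<noteq> x0 \<and> dist x x0 < (1/2)^0"
      using lim[unfolded islimpt_approachable, rule_format, of 1] by auto
    fix x and k :: nat
    assume "x \<in> B \<and> x \<noteq> x0 \<and> dist x x0 < (1/2)^k"
    then show "\<exists>y. (y \<in> B \<and> y \<noteq> x0 \<and> dist y x0 < (1/2)^Suc k) \<and> dist y x0 < dist x x0 / 2"
      using lim[unfolded islimpt_approachable, rule_format, of "min ((1/2)^Suc k) (dist x x0 / 2)"] by auto
  qed
  then obtain X where X: "\<And>k. X k \<in> B" "\<And>k. X k \<noteq> x0" "\<And>k. dist (X k) x0 < (1/2)^k"
    "\<And>k. dist (X (Suc k)) x0 < dist (X k) x0 / 2" by blast
  define d where "d k = dist (X k) x0" for k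
  have dpos: "d k > 0" for k using X(2) by (simp add: d_def)
  have d1: "d k < (1/2)^k" for k using X(3) by (simp add: d_def)
  have dstep: "d (Suc k) < d k / 2" for k using X(4) by (simp add: d_def)
  have dle: "d k \<le> d j" if "j \<le> k" for j k
  proof -
    have "d (Suc k) \<le> d k" for k using dstep[of k] dpos[of k] by linarith
    then show ?thesis using lift_Suc_antimono_le[of d] that by blast
  qed
  have dlt: "d k < d j / 2" if "j < k" for j k
    using dle[of "Suc j" k] dstep[of j] that by linarith
  have Xlim: "X \<longlonglongrightarrow> x0"
  proof (rule metric_tendsto_imp_tendsto[of "\<lambda>k. (1/2::real)^k" 0])
    show "(\<lambda>k. (1/2::real)^k) \<longlonglongrightarrow> 0" by (rule LIMSEQ_realpow_zero) auto
    show "\<forall>\<^sub>F k in sequentially. dist (X k) x0 \<le> dist ((1/2::real)^k) 0"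
      using X(3) by (auto intro!: always_eventually less_imp_le)
  qed
  have "d k / 4 < 1" for k using d1[of k] power_le_one[of "1/2::real" k] by linarith
  from this have "\<forall>k. \<exists>f. smooth f \<and> (\<forall>y. d k / 4 \<le> dist (X k) y \<longrightarrow> f y = 0) \<and> small k f \<and> Q k (X k) (d k / 4) f"
    by (intro allI ex[OF X(1)]) (use dpos in simp_all)
  then obtain f where f: "\<And>k. smooth (f k)" "\<And>k y. d k / 4 \<le> dist (X k) y \<Longrightarrow> f k y = 0" "\<And>k. small k (f k)"
    "\<And>k. Q k (X k) (d k / 4) (f k)" by metis
  define F where "F y = (\<Sum>k. f k y)" for y
  have smF: "smooth F" unfolding F_def by (rule smooth_suminf[OF f(1) f(3)])
  \<comment> \<open>The shell of the k-th bump; distances more than halve, so the next shell ends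
    below \<open>5/8 * d k\<close>.\<close>
  have range: "3/4 * d k < dist y x0 \<and> dist y x0 < 5/4 * d k" if "dist (X k) y < d k / 4" for k y
  proof -
    have "dist (X k) x0 \<le> dist (X k) y + dist y x0" "dist y x0 \<le> dist (X k) y + dist (X k) x0"
      by (simp_all add: dist_triangle dist_triangle3)
    then show ?thesis using that unfolding d_def[symmetric] by linarith
  qed
  have Fball: "F y = f k y" if "y \<in> ball (X k) (d k / 4)" for k y
  proof -
    have "f j y = 0" if "j \<noteq> k" for j
    proof (rule ccontr)
      assume "f j y \<noteq> 0"
      then have j: "3/4 * d j < dist y x0" "dist y x0 < 5/4 * d j" using f(2)[of j y] range[of j y] by force+
      have k: "3/4 * d k < dist y x0" "dist y x0 < 5/4 * d k" using range[of k y] \<open>y \<in> ball (X k) (d k / 4)\<close> by auto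
      show False
        using dlt[of j k] dlt[of k j] that j k dpos[of j] dpos[of k] by (cases "j < k") auto
    qed
    then have "(\<Sum>i. f i y) = (\<Sum>i\<in>{k}. f i y)" by (intro suminf_finite) auto
    then show ?thesis by (simp add: F_def)
  qed
  \<comment> \<open>The factor 7/10 lies in the gap between 5/8 and 3/4.\<close>
  define Z where "Z k = x0 + (7/10) *\<^sub>R (X k - x0)" for k
  have dZ: "dist (Z k) x0 = 7/10 * d k" for k by (simp add: Z_def d_def dist_norm)
  have Zlim: "Z \<longlonglongrightarrow> x0"
  proof -
    have "Z \<longlonglongrightarrow> x0 + (7/10) *\<^sub>R (x0 - x0)" unfolding Z_def by (intro tendsto_intros Xlim)
    then show ?thesis by simp
  qed
  have Zev: "\<forall>\<^sub>F y in nhds (Z k). F y = 0" for k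
  proof -
    have "open ((\<lambda>y. dist y x0) -` {5/8 * d k <..< 3/4 * d k})"
      by (intro open_vimage continuous_intros)
    then have "\<forall>\<^sub>F y in nhds (Z k). y \<in> (\<lambda>y. dist y x0) -` {5/8 * d k <..< 3/4 * d k}"
      by (rule eventually_nhds_in_open) (use dpos[of k] in \<open>auto simp: dZ\<close>)
    then show ?thesis
    proof eventually_elim
      case (elim y)
      have "f j y = 0" for j
      proof (rule ccontr)
        assume "f j y \<noteq> 0"
        then have j: "3/4 * d j < dist y x0" "dist y x0 < 5/4 * d j" using f(2)[of j y] range[of j y] by force+
        show False
          using dle[of j k] dlt[of k j] j elim by (cases "j \<le> k") auto
      qed
      then show ?case by (simp add: F_def)
    qed
  qed
  show ?thesis
    by (rule exI[of _ F], rule exI[of _ X], rule exI[of _ Z])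
      (use smF Xlim Zlim Zev X(1) Fball f(1,4) dpos in \<open>auto intro!: exI[of _ "f _"] exI[of _ "d _ / 4"]\<close>)
qed

section \<open>Estimates at shrinking scales\<close>

text \<open>Families of smooth functions indexed by \<open>a \<in> I\<close>: after rescaling the ball of radius \<open>r a\<close> around \<open>x\<close>
  to the unit ball, all derivatives of order at most \<open>n\<close> are \<open>O(r a ^ m)\<close>, uniformly in \<open>a\<close>.\<close>

primrec fam :: "'a set \<Rightarrow> ('a \<Rightarrow> real) \<Rightarrow> real^'n::finite \<Rightarrow> nat \<Rightarrow> nat \<Rightarrow> ('a \<Rightarrow> real^'n \<Rightarrow> 'b::real_normed_vector) \<Rightarrow> bool" where
  "fam I r x m 0 h \<longleftrightarrow> (\<exists>C. \<forall>a\<in>I. \<forall>y\<in>ball x (r a). norm (h a y) \<le> C * r a ^ m)"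
| "fam I r x m (Suc n) h \<longleftrightarrow> (\<exists>C. \<forall>a\<in>I. \<forall>y\<in>ball x (r a). norm (h a y) \<le> C * r a ^ m) \<and>
     (\<forall>i. \<exists>h'. (\<forall>a\<in>I. has_pd i (h a) (h' a)) \<and> fam I r x m n (\<lambda>a y. r a *\<^sub>R h' a y))"

lemma fam_SucD:
  assumes "fam I r x m (Suc n) h"
  obtains h' where "\<forall>a\<in>I. has_pd i (h a) (h' a)" "fam I r x m n (\<lambda>a y. r a *\<^sub>R h' a y)"
  using assms[unfolded fam.simps(2), THEN conjunct2, rule_format, of i] by blast

lemma fam_SucI:
  assumes "\<exists>C. \<forall>a\<in>I. \<forall>y\<in>ball x (r a). norm (h a y) \<le> C * r a ^ m"
    and "\<And>i a. a \<in> I \<Longrightarrow> has_pd i (h a) (h' i a)" "\<And>i. fam I r x m n (\<lambda>a y. r a *\<^sub>R h' i a y)"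
  shows "fam I r x m (Suc n) h"
  using assms unfolding fam.simps(2) by blast

lemma fam_0: "fam I r x m n h \<Longrightarrow> fam I r x m 0 h"
  by (cases n) auto

lemma fam_Suc_lower: "fam I r x m (Suc n) h \<Longrightarrow> fam I r x m n h"
proof (induction n arbitrary: h)
  case (Suc n)
  have 1: "\<exists>C. \<forall>a\<in>I. \<forall>y\<in>ball x (r a). norm (h a y) \<le> C * r a ^ m"
    using Suc.prems unfolding fam.simps(2)[of I r x m "Suc n"] by (rule conjunct1)
  have 2: "\<forall>i. \<exists>h'. (\<forall>a\<in>I. has_pd i (h a) (h' a)) \<and> fam I r x m (Suc n) (\<lambda>a y. r a *\<^sub>R h' a y)"
    using Suc.prems unfolding fam.simps(2)[of I r x m "Suc n"] by (rule conjunct2)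
  have "\<exists>h'. (\<forall>a\<in>I. has_pd i (h a) (h' a)) \<and> fam I r x m n (\<lambda>a y. r a *\<^sub>R h' a y)" for i
    using 2[rule_format, of i] Suc.IH by blast
  then show ?case unfolding fam.simps(2)[of I r x m n] using 1 by blast
qed simp

lemma fam_add: "fam I r x m n h \<Longrightarrow> fam I r x m n g \<Longrightarrow> fam I r x m n (\<lambda>a y. h a y + g a y)"
proof (induction n arbitrary: h g)
  case 0
  then obtain C D where "\<forall>a\<in>I. \<forall>y\<in>ball x (r a). norm (h a y) \<le> C * r a ^ m" "\<forall>a\<in>I. \<forall>y\<in>ball x (r a). norm (g a y) \<le> D * r a ^ m"
    by auto
  then show ?case by (auto intro!: exI[of _ "C + D"] norm_triangle_mono simp: distrib_right)
next
  case (Suc n)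
  have "fam I r x m 0 (\<lambda>a y. h a y + g a y)"
  proof -
    obtain C D where "\<forall>a\<in>I. \<forall>y\<in>ball x (r a). norm (h a y) \<le> C * r a ^ m" "\<forall>a\<in>I. \<forall>y\<in>ball x (r a). norm (g a y) \<le> D * r a ^ m"
      using Suc.prems by auto
    then show ?thesis by (auto intro!: exI[of _ "C + D"] norm_triangle_mono simp: distrib_right)
  qed
  moreover have "\<exists>k. (\<forall>a\<in>I. has_pd i (\<lambda>y. h a y + g a y) (k a)) \<and> fam I r x m n (\<lambda>a y. r a *\<^sub>R k a y)" for i
  proof -
    obtain h' where h: "\<forall>a\<in>I. has_pd i (h a) (h' a)" "fam I r x m n (\<lambda>a y. r a *\<^sub>R h' a y)"
      using fam_SucD[OF Suc.prems(1)] .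
    obtain g' where g: "\<forall>a\<in>I. has_pd i (g a) (g' a)" "fam I r x m n (\<lambda>a y. r a *\<^sub>R g' a y)"
      using fam_SucD[OF Suc.prems(2)] .
    have "fam I r x m n (\<lambda>a y. r a *\<^sub>R (h' a y + g' a y))"
      using Suc.IH[OF h(2) g(2)] by (simp add: scaleR_add_right)
    moreover have "\<forall>a\<in>I. has_pd i (\<lambda>y. h a y + g a y) (\<lambda>y. h' a y + g' a y)"
      using h(1) g(1) by (intro ballI has_pd_add) auto
    ultimately show ?thesis by (intro exI[of _ "\<lambda>a y. h' a y + g' a y"] conjI)
  qed
  ultimately show ?case by simp
qed

text \<open>Orders of smallness add like exponents; in the Leibniz rule the factor
  \<open>r a\<close> goes with whichever function is differentiated.\<close>

lemma fam_mult:
  fixes h g :: "'a \<Rightarrow> real^'n \<Rightarrow> 'b::real_normed_algebra"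
  shows "fam I r x m n h \<Longrightarrow> fam I r x m' n g \<Longrightarrow> (\<And>a. a \<in> I \<Longrightarrow> 0 \<le> r a) \<Longrightarrow> fam I r x (m + m') n (\<lambda>a y. h a y * g a y)"
proof (induction n arbitrary: h g)
  case 0
  then obtain C D where CD: "\<forall>a\<in>I. \<forall>y\<in>ball x (r a). norm (h a y) \<le> C * r a ^ m" "\<forall>a\<in>I. \<forall>y\<in>ball x (r a). norm (g a y) \<le> D * r a ^ m'"
    by auto
  have "norm (h a y * g a y) \<le> (C * D) * r a ^ (m + m')" if "a \<in> I" "y \<in> ball x (r a)" for a y
  proof -
    have "norm (h a y * g a y) \<le> norm (h a y) * norm (g a y)" by (rule norm_mult_ineq)
    also have "\<dots> \<le> (C * r a ^ m) * (D * r a ^ m')"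
      using CD that by (intro mult_mono norm_ge_zero) (blast intro: order_trans[OF norm_ge_zero])+
    finally show ?thesis by (simp add: power_add mult_ac)
  qed
  then show ?case by (simp only: fam.simps) blast
next
  case (Suc n)
  have "fam I r x (m + m') 0 (\<lambda>a y. h a y * g a y)"
  proof -
    obtain C D where CD: "\<forall>a\<in>I. \<forall>y\<in>ball x (r a). norm (h a y) \<le> C * r a ^ m" "\<forall>a\<in>I. \<forall>y\<in>ball x (r a). norm (g a y) \<le> D * r a ^ m'"
      using Suc.prems by auto
    have "norm (h a y * g a y) \<le> (C * D) * r a ^ (m + m')" if "a \<in> I" "y \<in> ball x (r a)" for a y
    proof -
      have "norm (h a y * g a y) \<le> norm (h a y) * norm (g a y)" by (rule norm_mult_ineq)
      also have "\<dots> \<le> (C * r a ^ m) * (D * r a ^ m')"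
        using CD that by (intro mult_mono norm_ge_zero) (blast intro: order_trans[OF norm_ge_zero])+
      finally show ?thesis by (simp add: power_add mult_ac)
    qed
    then show ?thesis by (simp only: fam.simps) blast
  qed
  moreover have "\<exists>k. (\<forall>a\<in>I. has_pd i (\<lambda>y. h a y * g a y) (k a)) \<and> fam I r x (m + m') n (\<lambda>a y. r a *\<^sub>R k a y)" for i
  proof -
    obtain h' where h: "\<forall>a\<in>I. has_pd i (h a) (h' a)" "fam I r x m n (\<lambda>a y. r a *\<^sub>R h' a y)"
      using fam_SucD[OF Suc.prems(1)] .
    obtain g' where g: "\<forall>a\<in>I. has_pd i (g a) (g' a)" "fam I r x m' n (\<lambda>a y. r a *\<^sub>R g' a y)"
      using fam_SucD[OF Suc.prems(2)] .
    note * = h g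
    have "fam I r x (m + m') n (\<lambda>a y. h a y * (r a *\<^sub>R g' a y) + (r a *\<^sub>R h' a y) * g a y)"
      by (intro fam_add Suc.IH * Suc.prems fam_Suc_lower[OF Suc.prems(1)] fam_Suc_lower[OF Suc.prems(2)])
    then have "fam I r x (m + m') n (\<lambda>a y. r a *\<^sub>R (h a y * g' a y + h' a y * g a y))"
      by (simp add: scaleR_add_right)
    moreover have "\<forall>a\<in>I. has_pd i (\<lambda>y. h a y * g a y) (\<lambda>y. h a y * g' a y + h' a y * g a y)"
      using h(1) g(1) by (intro ballI has_pd_mult) auto
    ultimately show ?thesis by (intro exI[of _ "\<lambda>a y. h a y * g' a y + h' a y * g a y"] conjI)
  qed
  ultimately show ?case by simp
qed

lemma fam_scaleR:
  assumes "\<And>a. a \<in> I \<Longrightarrow> \<bar>c a\<bar> \<le> D * r a ^ j" "\<And>a. a \<in> I \<Longrightarrow> 0 \<le> r a"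
  shows "fam I r x m n h \<Longrightarrow> fam I r x (m + j) n (\<lambda>a y. c a *\<^sub>R h a y)"
proof (induction n arbitrary: h)
  case 0
  then obtain C where C: "\<forall>a\<in>I. \<forall>y\<in>ball x (r a). norm (h a y) \<le> C * r a ^ m" by auto
  have "norm (c a *\<^sub>R h a y) \<le> (C * D) * r a ^ (m + j)" if "a \<in> I" "y \<in> ball x (r a)" for a y
  proof -
    have "\<bar>c a\<bar> * norm (h a y) \<le> (D * r a ^ j) * (C * r a ^ m)"
      using C that assms(1)[OF that(1)] by (intro mult_mono) (auto intro: order_trans[OF abs_ge_zero])
    then show ?thesis by (simp add: power_add mult_ac)
  qed
  then show ?case by (simp only: fam.simps) blast
next
  case (Suc n)
  have "fam I r x (m + j) 0 (\<lambda>a y. c a *\<^sub>R h a y)"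
  proof -
    obtain C where C: "\<forall>a\<in>I. \<forall>y\<in>ball x (r a). norm (h a y) \<le> C * r a ^ m" using Suc.prems by auto
    have "norm (c a *\<^sub>R h a y) \<le> (C * D) * r a ^ (m + j)" if "a \<in> I" "y \<in> ball x (r a)" for a y
    proof -
      have "\<bar>c a\<bar> * norm (h a y) \<le> (D * r a ^ j) * (C * r a ^ m)"
        using C that assms(1)[OF that(1)] by (intro mult_mono) (auto intro: order_trans[OF abs_ge_zero])
      then show ?thesis by (simp add: power_add mult_ac)
    qed
    then show ?thesis by (simp only: fam.simps) blast
  qed
  moreover have "\<exists>k. (\<forall>a\<in>I. has_pd i (\<lambda>y. c a *\<^sub>R h a y) (k a)) \<and> fam I r x (m + j) n (\<lambda>a y. r a *\<^sub>R k a y)" for i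
  proof -
    obtain h' where *: "\<forall>a\<in>I. has_pd i (h a) (h' a)" "fam I r x m n (\<lambda>a y. r a *\<^sub>R h' a y)"
      using fam_SucD[OF Suc.prems] .
    have "fam I r x (m + j) n (\<lambda>a y. r a *\<^sub>R (c a *\<^sub>R h' a y))"
      using Suc.IH[OF *(2)] by (simp add: mult.commute)
    moreover have "\<forall>a\<in>I. has_pd i (\<lambda>y. c a *\<^sub>R h a y) (\<lambda>y. c a *\<^sub>R h' a y)"
      using *(1) by (intro ballI has_pd_linear[OF bounded_linear_scaleR_right]) auto
    ultimately show ?thesis by (intro exI[of _ "\<lambda>a y. c a *\<^sub>R h' a y"] conjI)
  qed
  ultimately show ?case by simp
qed

lemma fam_const_smooth:
  fixes f :: "real^'n \<Rightarrow> 'b::real_normed_vector"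
  assumes r: "\<And>a. a \<in> I \<Longrightarrow> 0 \<le> r a \<and> r a \<le> 1"
  shows "smooth f \<Longrightarrow> fam I r x 0 n (\<lambda>a. f)"
proof (induction n arbitrary: f)
  case 0
  have "bounded (f ` cball x 1)"
    by (intro compact_imp_bounded compact_continuous_image continuous_on_subset[OF smooth_continuous[OF 0]]) auto
  then obtain C where "\<forall>y\<in>cball x 1. norm (f y) \<le> C" by (auto simp: bounded_iff)
  then show ?case using r by (fastforce intro!: exI[of _ C])
next
  case (Suc n)
  have "bounded (f ` cball x 1)"
    by (intro compact_imp_bounded compact_continuous_image continuous_on_subset[OF smooth_continuous[OF Suc.prems]]) auto
  then obtain C where "\<forall>y\<in>cball x 1. norm (f y) \<le> C" by (auto simp: bounded_iff)
  then have "\<exists>C. \<forall>a\<in>I. \<forall>y\<in>ball x (r a). norm (f y) \<le> C * r a ^ 0"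
    using r by (fastforce intro!: exI[of _ C])
  moreover have "fam I r x 0 n (\<lambda>a y. r a *\<^sub>R partial_deriv i f y)" for i
    using fam_scaleR[where j = 0 and D = 1 and c = r and r = r and I = I and m = 0, OF _ _ Suc.IH[OF smooth_partial_deriv(2)[OF Suc.prems]]] r
    by simp
  ultimately show ?case using smooth_partial_deriv(1)[OF Suc.prems] by (intro fam_SucI[where h' = "\<lambda>i a. partial_deriv i f"])
qed

text \<open>The mean value inequality treats the value at order 0; every derivative already carries
  one factor \<open>r a\<close>.\<close>

lemma fam_vanishing:
  fixes g :: "real^'n \<Rightarrow> 'b::real_normed_vector"
  assumes r: "\<And>a. a \<in> I \<Longrightarrow> 0 \<le> r a \<and> r a \<le> 1" and "smooth g" "g x = 0"
  shows "fam I r x 1 n (\<lambda>a. g)"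
proof -
  have "\<exists>B\<ge>0. \<forall>i. \<forall>y\<in>ball x 1. norm (partial_deriv i g y) \<le> B"
  proof -
    have "bounded (partial_deriv i g ` cball x 1)" for i
      by (intro compact_imp_bounded compact_continuous_image continuous_on_subset[OF smooth_continuous[OF smooth_partial_deriv(2)[OF assms(2)]]]) auto
    then have "\<forall>i. \<exists>B. \<forall>y\<in>cball x 1. norm (partial_deriv i g y) \<le> B" by (auto simp: bounded_iff)
    then obtain B where B: "\<And>i y. y \<in> cball x 1 \<Longrightarrow> norm (partial_deriv i g y) \<le> B i" by metis
    have "norm (partial_deriv i g y) \<le> (\<Sum>i\<in>UNIV. \<bar>B i\<bar>)" if "y \<in> ball x 1" for i y
      using B[of y i] that member_le_sum[of i UNIV "\<lambda>i. \<bar>B i\<bar>"] by auto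
    moreover have "(\<Sum>i\<in>UNIV. \<bar>B i\<bar>) \<ge> 0" by (intro sum_nonneg) auto
    ultimately show ?thesis by blast
  qed
  then obtain B where B: "B \<ge> 0" "\<And>i y. y \<in> ball x 1 \<Longrightarrow> norm (partial_deriv i g y) \<le> B" by blast
  have "norm (g y) \<le> (real CARD('n) * B) * r a ^ 1" if "a \<in> I" "y \<in> ball x (r a)" for a y
  proof -
    have "norm (g y - g x) \<le> real CARD('n) * B * norm (y - x)"
      by (rule smooth_ball_bound[where r = 1]) (use assms B r[OF that(1)] that(2) in auto)
    also have "\<dots> \<le> (real CARD('n) * B) * r a ^ 1"
      using that(2) B(1) by (intro mult_left_mono) (auto simp: dist_norm norm_minus_commute)
    finally show ?thesis using assms by simp
  qed
  then have zero: "\<exists>C. \<forall>a\<in>I. \<forall>y\<in>ball x (r a). norm (g y) \<le> C * r a ^ 1" by blast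
  show ?thesis
  proof (cases n)
    case 0 then show ?thesis using zero by simp
  next
    case (Suc k)
    have "fam I r x 1 k (\<lambda>a y. r a *\<^sub>R partial_deriv i g y)" for i
      using fam_scaleR[where j = 1 and D = 1 and c = r and r = r and I = I and m = 0, OF _ _ fam_const_smooth[OF r smooth_partial_deriv(2)[OF assms(2)]]] r
      by simp
    then show ?thesis unfolding Suc using zero smooth_partial_deriv(1)[OF assms(2)]
      by (intro fam_SucI[where h' = "\<lambda>i a. partial_deriv i g"])
  qed
qed

text \<open>Each derivative costs a factor \<open>1 / r a\<close>, exactly what the rescaling in
  \<open>fam\<close> gives back. This is the estimate for shrinking cutoffs.\<close>

lemma fam_rescaled:
  fixes b :: "real^'n \<Rightarrow> 'b::real_normed_vector"
  assumes r: "\<And>a. a \<in> I \<Longrightarrow> 0 < r a"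
  shows "smooth b \<Longrightarrow> fam I r x 0 n (\<lambda>a y. b ((1 / r a) *\<^sub>R (y - x)))"
proof (induction n arbitrary: b)
  case 0
  have "bounded (b ` cball 0 1)"
    by (intro compact_imp_bounded compact_continuous_image continuous_on_subset[OF smooth_continuous[OF 0]]) auto
  then obtain C where "\<forall>y\<in>cball 0 1. norm (b y) \<le> C" by (auto simp: bounded_iff)
  moreover have "(1 / r a) *\<^sub>R (y - x) \<in> cball 0 1" if "a \<in> I" "y \<in> ball x (r a)" for a y
    using that r[OF that(1)] by (simp add: dist_norm norm_minus_commute divide_simps del: scaleR_right_diff_distrib)
  ultimately show ?case by (auto intro!: exI[of _ C] simp del: mem_ball mem_cball)
next
  case (Suc n)
  have "fam I r x 0 0 (\<lambda>a y. b ((1 / r a) *\<^sub>R (y - x)))"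
  proof -
    have "bounded (b ` cball 0 1)"
      by (intro compact_imp_bounded compact_continuous_image continuous_on_subset[OF smooth_continuous[OF Suc.prems]]) auto
    then obtain C where "\<forall>y\<in>cball 0 1. norm (b y) \<le> C" by (auto simp: bounded_iff)
    moreover have "(1 / r a) *\<^sub>R (y - x) \<in> cball 0 1" if "a \<in> I" "y \<in> ball x (r a)" for a y
      using that r[OF that(1)] by (simp add: dist_norm norm_minus_commute divide_simps del: scaleR_right_diff_distrib)
    ultimately show ?thesis by (auto intro!: exI[of _ C] simp del: mem_ball mem_cball)
  qed
  moreover have "\<exists>k. (\<forall>a\<in>I. has_pd i (\<lambda>y. b ((1 / r a) *\<^sub>R (y - x))) (k a)) \<and> fam I r x 0 n (\<lambda>a y. r a *\<^sub>R k a y)" for i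
  proof (intro exI conjI ballI)
    fix a assume "a \<in> I"
    show "has_pd i (\<lambda>y. b ((1 / r a) *\<^sub>R (y - x))) (\<lambda>y. inverse (r a) *\<^sub>R partial_deriv i b ((1 / r a) *\<^sub>R (y - x)))"
      unfolding has_pd_def
    proof
      fix y
      have "((\<lambda>t. b ((1 / r a) *\<^sub>R (y - x) + t *\<^sub>R axis i 1)) has_vector_derivative partial_deriv i b ((1 / r a) *\<^sub>R (y - x))) (at (inverse (r a) * 0))"
        using has_pdD[OF smooth_partial_deriv(1)[OF Suc.prems]] by simp
      then have "(((\<lambda>t. b ((1 / r a) *\<^sub>R (y - x) + t *\<^sub>R axis i 1)) \<circ> (\<lambda>t. inverse (r a) * t)) has_vector_derivative (inverse (r a) *\<^sub>R partial_deriv i b ((1 / r a) *\<^sub>R (y - x)))) (at 0)"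
        by (intro vector_diff_chain_at) (auto intro!: derivative_eq_intros)
      moreover have "(1 / r a) *\<^sub>R (y - x) + (inverse (r a) * t) *\<^sub>R axis i 1 = (1 / r a) *\<^sub>R (y + t *\<^sub>R axis i 1 - x)" for t
        by (simp add: algebra_simps divide_inverse)
      ultimately show "((\<lambda>t. b ((1 / r a) *\<^sub>R (y + t *\<^sub>R axis i 1 - x))) has_vector_derivative
          (inverse (r a) *\<^sub>R partial_deriv i b ((1 / r a) *\<^sub>R (y - x)))) (at 0)"
        by (simp add: o_def)
    qed
  next
    have "fam I r x 0 n (\<lambda>a y. partial_deriv i b ((1 / r a) *\<^sub>R (y - x)))"
      by (rule Suc.IH[OF smooth_partial_deriv(2)[OF Suc.prems]])
    then have "fam I r x (0 + 0) n (\<lambda>a y. (r a * inverse (r a)) *\<^sub>R partial_deriv i b ((1 / r a) *\<^sub>R (y - x)))"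
      using r by (intro fam_scaleR[where D = 1]) (auto simp: less_imp_le right_inverse[OF less_imp_neq[THEN not_sym]])
    then show "fam I r x 0 n (\<lambda>a y. r a *\<^sub>R inverse (r a) *\<^sub>R partial_deriv i b ((1 / r a) *\<^sub>R (y - x)))"
      by simp
  qed
  ultimately show ?case by simp
qed

text \<open>As \<open>\<phi>\<close> vanishes at \<open>x\<close>, the exponent stays bounded on the
  ball of radius \<open>r a\<close>, and the factors \<open>1 / r a\<close> from differentiation are
  absorbed by \<open>fam\<close>. With \<open>r = 1/N\<close> this is the \<open>N\<close>-th power
  of \<open>exp \<phi>\<close>.\<close>

lemma fam_exp:
  fixes \<phi> :: "real^'n \<Rightarrow> complex"
  assumes r: "\<And>a. a \<in> I \<Longrightarrow> 0 < r a \<and> r a \<le> 1" and "smooth \<phi>" "\<phi> x = 0"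
  shows "fam I r x 0 n (\<lambda>a y. exp (\<phi> y / of_real (r a)))"
proof -
  obtain C where C: "\<And>a y. a \<in> I \<Longrightarrow> y \<in> ball x (r a) \<Longrightarrow> norm (\<phi> y) \<le> C * r a"
  proof -
    have "fam I r x 1 0 (\<lambda>a. \<phi>)" using assms by (intro fam_vanishing) (auto simp: less_imp_le)
    then obtain C where "\<forall>a\<in>I. \<forall>y\<in>ball x (r a). norm (\<phi> y) \<le> C * r a" by auto
    then show ?thesis by (intro that[of C]) blast
  qed
  have zero: "\<exists>C. \<forall>a\<in>I. \<forall>y\<in>ball x (r a). norm (exp (\<phi> y / of_real (r a))) \<le> C * r a ^ 0"
  proof (rule exI[of _ "exp C"], intro ballI)
    fix a y assume "a \<in> I" "y \<in> ball x (r a)"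
    then have "norm (\<phi> y / of_real (r a)) \<le> C" using C[of a y] r[of a] by (simp add: norm_divide field_simps)
    then show "norm (exp (\<phi> y / of_real (r a))) \<le> exp C * r a ^ 0"
      by (intro order_trans[OF norm_exp]) simp
  qed
  show ?thesis
  proof (induction n)
    case 0 then show ?case using zero by simp
  next
    case (Suc n)
    have "\<exists>k. (\<forall>a\<in>I. has_pd i (\<lambda>y. exp (\<phi> y / of_real (r a))) (k a)) \<and> fam I r x 0 n (\<lambda>a y. r a *\<^sub>R k a y)" for i
    proof (intro exI conjI ballI)
      fix a assume "a \<in> I"
      have "has_pd i (\<lambda>y. \<phi> y / of_real (r a)) (\<lambda>y. partial_deriv i \<phi> y / of_real (r a))"
        by (rule has_pd_linear[OF bounded_linear_divide smooth_partial_deriv(1)[OF assms(2)]])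
      from has_pd_field_compose[OF DERIV_exp this]
      show "has_pd i (\<lambda>y. exp (\<phi> y / of_real (r a))) (\<lambda>y. partial_deriv i \<phi> y / of_real (r a) * exp (\<phi> y / of_real (r a)))" .
    next
      have "fam I r x 0 n (\<lambda>a y. (r a * inverse (r a)) *\<^sub>R (partial_deriv i \<phi> y * exp (\<phi> y / of_real (r a))))"
        using fam_scaleR[where j = 0 and D = 1 and c = "\<lambda>a. r a * inverse (r a)" and r = r and I = I,
          OF _ _ fam_mult[OF fam_const_smooth[OF _ smooth_partial_deriv(2)[OF assms(2)]] Suc]] r
        by (force simp: less_imp_le right_inverse[OF less_imp_neq[THEN not_sym]])
      then show "fam I r x 0 n (\<lambda>a y. r a *\<^sub>R (partial_deriv i \<phi> y / of_real (r a) * exp (\<phi> y / of_real (r a))))"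
        by (simp add: scaleR_conv_of_real divide_inverse mult_ac)
    qed
    then show ?case using zero by simp
  qed
qed

lemma fam_iter_pderiv:
  assumes "\<And>a. a \<in> I \<Longrightarrow> smooth (h a)" "\<And>a. a \<in> I \<Longrightarrow> 0 \<le> r a"
  shows "fam I r x m n h \<Longrightarrow> length js \<le> n \<Longrightarrow> \<exists>C. \<forall>a\<in>I. \<forall>y\<in>ball x (r a). r a ^ length js * norm (iter_pderiv js (h a) y) \<le> C * r a ^ m"
  using assms
proof (induction js arbitrary: n h rule: rev_induct)
  case Nil
  then show ?case using fam_0 by fastforce
next
  case (snoc i js)
  then obtain k where n: "n = Suc k" by (cases n) auto
  obtain h' where h': "\<forall>a\<in>I. has_pd i (h a) (h' a)" "fam I r x m k (\<lambda>a y. r a *\<^sub>R h' a y)"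
    using fam_SucD[OF snoc.prems(1)[unfolded n]] .
  have h'_eq: "partial_deriv i (h a) = h' a" if "a \<in> I" for a using h'(1) that has_pd_partial_deriv by blast
  then have smh: "smooth (h' a)" if "a \<in> I" for a
    using smooth_partial_deriv(2)[OF snoc.prems(3)[OF that], of i] that by simp
  have "\<exists>C. \<forall>a\<in>I. \<forall>y\<in>ball x (r a). r a ^ length js * norm (iter_pderiv js (\<lambda>y. r a *\<^sub>R h' a y) y) \<le> C * r a ^ m"
    by (rule snoc.IH[OF h'(2)]) (use snoc.prems smh n in \<open>auto intro: smooth_linear[OF bounded_linear_scaleR_right]\<close>)
  then obtain C where C: "\<And>a y. a \<in> I \<Longrightarrow> y \<in> ball x (r a) \<Longrightarrow> r a ^ length js * norm (iter_pderiv js (\<lambda>y. r a *\<^sub>R h' a y) y) \<le> C * r a ^ m"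
    by blast
  have "r a ^ length (js @ [i]) * norm (iter_pderiv (js @ [i]) (h a) y) \<le> C * r a ^ m" if "a \<in> I" "y \<in> ball x (r a)" for a y
    using C[OF that] snoc.prems(4)[OF that(1)]
    by (simp add: iter_pderiv_append h'_eq[OF that(1)] iter_pderiv_linear[OF bounded_linear_scaleR_right smh[OF that(1)]] mult_ac)
  then show ?case by blast
qed

text \<open>Undoing the rescaling costs at most \<open>r a ^ k\<close>, since the radii are at most
  1; beyond the ball everything is 0 because the support ends at 3/4 of the radius.\<close>

lemma fam_support_bound:
  fixes h :: "'a \<Rightarrow> real^'n::finite \<Rightarrow> 'b::real_normed_vector"
  assumes "fam I r x m k h" "\<And>a. a \<in> I \<Longrightarrow> smooth (h a)" "\<And>a. a \<in> I \<Longrightarrow> 0 < r a \<and> r a \<le> 1"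
    "\<And>a y. a \<in> I \<Longrightarrow> 3/4 * r a \<le> dist x y \<Longrightarrow> h a y = 0"
  shows "\<exists>C\<ge>0. \<forall>js. length js \<le> k \<longrightarrow> (\<forall>a\<in>I. \<forall>y. r a ^ k * norm (iter_pderiv js (h a) y) \<le> C * r a ^ m)"
proof -
  have "\<exists>C. \<forall>p\<in>I \<times> UNIV. True \<longrightarrow> r (fst p) ^ k * norm (iter_pderiv js (h (fst p)) (snd p)) \<le> C * r (fst p) ^ m"
    if js: "length js \<le> k" for js
  proof -
    obtain C where C: "\<And>a y. a \<in> I \<Longrightarrow> y \<in> ball x (r a) \<Longrightarrow> r a ^ length js * norm (iter_pderiv js (h a) y) \<le> C * r a ^ m"
      using fam_iter_pderiv[OF assms(2) _ assms(1) js] assms(3) by (meson less_imp_le)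
    have "r a ^ k * norm (iter_pderiv js (h a) y) \<le> max C 0 * r a ^ m" if a: "a \<in> I" for a y
    proof (cases "y \<in> ball x (r a)")
      case True
      have "r a ^ k * norm (iter_pderiv js (h a) y) \<le> r a ^ length js * norm (iter_pderiv js (h a) y)"
        using assms(3)[OF a] js by (intro mult_right_mono power_decreasing) auto
      also have "\<dots> \<le> max C 0 * r a ^ m"
        using C[OF a True] assms(3)[OF a] by (auto intro: order_trans mult_right_mono)
      finally show ?thesis .
    next
      case False
      then have "dist x y > 3/4 * r a" using assms(3)[OF a] by auto
      then have "iter_pderiv js (h a) y = 0"
        using iter_pderiv_outside[where x = x and \<rho> = "3/4 * r a" and h = "h a"] assms(4)[OF a] by blast
      then show ?thesis using assms(3)[OF a] by simp
    qed
    then show ?thesis by (intro exI[of _ "max C 0"]) auto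
  qed
  then have "\<exists>C\<ge>0. \<forall>js::'n list. length js \<le> k \<longrightarrow> (\<forall>p\<in>I \<times> UNIV. True \<longrightarrow>
      r (fst p) ^ k * norm (iter_pderiv js (h (fst p)) (snd p)) \<le> C * r (fst p) ^ m)"
    by (rule uniform_pderiv_bound) (use assms(3) in \<open>auto intro: less_imp_le\<close>)
  then show ?thesis by auto
qed

text \<open>Integrating from the zero at \<open>x\<close> gains one power of the radius and one
  order of differentiation, which spares computing higher derivatives of \<open>E\<close>.\<close>

lemma fam_primitive:
  fixes E :: "real^'n \<Rightarrow> 'b::real_normed_vector"
  assumes r: "\<And>a. a \<in> I \<Longrightarrow> 0 \<le> r a" and "smooth E" "E x = 0"
    and pd: "\<And>i. fam I r x k n (\<lambda>a. partial_deriv i E)"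
  shows "fam I r x (k + 1) (Suc n) (\<lambda>a. E)"
proof (rule fam_SucI[where h' = "\<lambda>i a. partial_deriv i E"])
  have "\<exists>C. \<forall>a\<in>I. \<forall>y\<in>ball x (r a). norm (partial_deriv i E y) \<le> C * r a ^ k" for i
    using fam_0[OF pd[of i]] by simp
  then obtain B where B: "\<And>i a y. a \<in> I \<Longrightarrow> y \<in> ball x (r a) \<Longrightarrow> norm (partial_deriv i E y) \<le> B i * r a ^ k"
    by metis
  let ?B = "\<Sum>i\<in>UNIV. \<bar>B i\<bar>"
  have B': "norm (partial_deriv i E y) \<le> ?B * r a ^ k" if "a \<in> I" "y \<in> ball x (r a)" for i a y
  proof -
    have "B i \<le> ?B" using member_le_sum[of i UNIV "\<lambda>i. \<bar>B i\<bar>"] by simp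
    then have "B i * r a ^ k \<le> ?B * r a ^ k" by (rule mult_right_mono) (use r[OF that(1)] in simp)
    then show ?thesis using B[OF that, of i] by linarith
  qed
  have "norm (E y) \<le> (real CARD('n) * ?B) * r a ^ (k + 1)" if "a \<in> I" "y \<in> ball x (r a)" for a y
  proof -
    have "norm (E y - E x) \<le> real CARD('n) * (?B * r a ^ k) * norm (y - x)"
      by (rule smooth_ball_bound[where r = "r a"]) (use assms(2) B'[OF that(1)] that in auto)
    also have "\<dots> \<le> real CARD('n) * (?B * r a ^ k) * r a"
      using that r[OF that(1)] by (intro mult_left_mono mult_nonneg_nonneg sum_nonneg) (auto simp: dist_norm norm_minus_commute)
    finally show ?thesis using assms(3) by (simp add: mult_ac)
  qed
  then show "\<exists>C. \<forall>a\<in>I. \<forall>y\<in>ball x (r a). norm (E y) \<le> C * r a ^ (k + 1)" by blast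
  show "has_pd i E (partial_deriv i E)" for i by (rule smooth_partial_deriv(1)[OF assms(2)])
  show "fam I r x (k + 1) n (\<lambda>a y. r a *\<^sub>R partial_deriv i E y)" for i
    by (rule fam_scaleR[where D = 1, OF _ _ pd]) (use r in auto)
qed

lemma fam_power:
  fixes h :: "'a \<Rightarrow> real^'n \<Rightarrow> 'b::real_normed_algebra_1"
  assumes r: "\<And>a. a \<in> I \<Longrightarrow> 0 \<le> r a \<and> r a \<le> 1" and "fam I r x m n h"
  shows "fam I r x (j * m) n (\<lambda>a y. h a y ^ j)"
proof (induction j)
  case 0
  then show ?case using fam_const_smooth[OF r smooth_const[of 1]] by simp
next
  case (Suc j)
  have "fam I r x (m + j * m) n (\<lambda>a y. h a y * h a y ^ j)"
    by (rule fam_mult[OF assms(2) Suc]) (use r in auto)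
  then show ?case by simp
qed

text \<open>The constant is uniform in base point and direction. A sequence of points whose
  constants tend to infinity contradicts it, as in \<open>discrete_bad_taylor\<close>.\<close>

lemma smooth_taylor2:
  fixes G :: "real^'n \<Rightarrow> 'b::real_normed_vector"
  assumes "smooth G"
  shows "\<exists>C\<ge>0. \<forall>y\<in>ball z 1. \<forall>t i. \<bar>t\<bar> < 1 \<longrightarrow>
    norm (G (y + t *\<^sub>R axis i 1) - G y - t *\<^sub>R partial_deriv i G y) \<le> C * t\<^sup>2"
proof -
  have "\<exists>B. \<forall>y\<in>cball z 2. norm (partial_deriv i (partial_deriv i G) y) \<le> B" for i
  proof -
    have "bounded (partial_deriv i (partial_deriv i G) ` cball z 2)"
      by (intro compact_imp_bounded compact_continuous_image continuous_on_subset[OF smooth_continuous] smooth_partial_deriv assms) auto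
    then show ?thesis by (auto simp: bounded_iff)
  qed
  then obtain B where B: "\<And>i y. y \<in> cball z 2 \<Longrightarrow> norm (partial_deriv i (partial_deriv i G) y) \<le> B i" by metis
  define C where "C = (\<Sum>i\<in>UNIV. \<bar>B i\<bar>)"
  have C0: "C \<ge> 0" unfolding C_def by (intro sum_nonneg) auto
  have C: "norm (partial_deriv i (partial_deriv i G) y) \<le> C" if "y \<in> cball z 2" for i y
    using B[OF that, of i] member_le_sum[of i UNIV "\<lambda>i. \<bar>B i\<bar>"] by (simp add: C_def)
  have "norm (G (y + t *\<^sub>R axis i 1) - G y - t *\<^sub>R partial_deriv i G y) \<le> C * t\<^sup>2"
    if y: "y \<in> ball z 1" and t: "\<bar>t\<bar> < 1" for y t i
  proof -
    have mem: "y + s *\<^sub>R axis i 1 \<in> cball z 2" if "\<bar>s\<bar> < 1" for s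
    proof -
      have "dist z (y + s *\<^sub>R axis i 1) \<le> dist z y + dist y (y + s *\<^sub>R axis i 1)" by (rule dist_triangle)
      also have "dist y (y + s *\<^sub>R axis i 1) = \<bar>s\<bar>" by (simp add: dist_norm)
      finally show ?thesis using y that by simp
    qed
    have seg: "\<bar>s\<bar> \<le> \<bar>b\<bar>" if "s \<in> closed_segment 0 b" for s b :: real
      using that by (auto simp: closed_segment_eq_real_ivl split: if_splits)
    have 1: "norm (partial_deriv i G (y + s *\<^sub>R axis i 1) - partial_deriv i G y) \<le> C * \<bar>s\<bar>" if s: "\<bar>s\<bar> < 1" for s
    proof -
      have "norm ((\<lambda>s. partial_deriv i G (y + s *\<^sub>R axis i 1)) s - (\<lambda>s. partial_deriv i G (y + s *\<^sub>R axis i 1)) 0) \<le> C * norm (s - 0)"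
      proof (rule differentiable_bound[where S = "closed_segment 0 s"])
        fix w assume w: "w \<in> closed_segment 0 s"
        show "((\<lambda>s. partial_deriv i G (y + s *\<^sub>R axis i 1)) has_derivative
            (\<lambda>h. h *\<^sub>R partial_deriv i (partial_deriv i G) (y + w *\<^sub>R axis i 1))) (at w within closed_segment 0 s)"
          unfolding has_vector_derivative_def[symmetric]
          by (rule has_pd_line) (intro smooth_partial_deriv assms)
        have "norm (partial_deriv i (partial_deriv i G) (y + w *\<^sub>R axis i 1)) \<le> C"
          using seg[OF w] s by (intro C mem) simp
        from mult_left_mono[OF this abs_ge_zero]
        show "onorm (\<lambda>h. h *\<^sub>R partial_deriv i (partial_deriv i G) (y + w *\<^sub>R axis i 1)) \<le> C"
          by (intro onorm_le) (simp add: mult.commute)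
      qed auto
      then show ?thesis by simp
    qed
    have "norm ((\<lambda>s. G (y + s *\<^sub>R axis i 1) - s *\<^sub>R partial_deriv i G y) t - (\<lambda>s. G (y + s *\<^sub>R axis i 1) - s *\<^sub>R partial_deriv i G y) 0)
        \<le> (C * \<bar>t\<bar>) * norm (t - 0)"
    proof (rule differentiable_bound[where S = "closed_segment 0 t"])
      fix w assume w: "w \<in> closed_segment 0 t"
      show "((\<lambda>s. G (y + s *\<^sub>R axis i 1) - s *\<^sub>R partial_deriv i G y) has_derivative
          (\<lambda>h. h *\<^sub>R (partial_deriv i G (y + w *\<^sub>R axis i 1) - partial_deriv i G y))) (at w within closed_segment 0 t)"
        unfolding has_vector_derivative_def[symmetric]
        by (auto intro!: derivative_eq_intros has_pd_line smooth_partial_deriv assms)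
      have "C * \<bar>w\<bar> \<le> C * \<bar>t\<bar>" by (rule mult_left_mono[OF seg[OF w] C0])
      then have "norm (partial_deriv i G (y + w *\<^sub>R axis i 1) - partial_deriv i G y) \<le> C * \<bar>t\<bar>"
        using 1[of w] seg[OF w] t by linarith
      from mult_left_mono[OF this abs_ge_zero]
      show "onorm (\<lambda>h. h *\<^sub>R (partial_deriv i G (y + w *\<^sub>R axis i 1) - partial_deriv i G y)) \<le> C * \<bar>t\<bar>"
        by (intro onorm_le) (simp add: mult_ac)
    qed auto
    then show ?thesis by (simp add: algebra_simps power2_eq_square)
  qed
  with C0 show ?thesis by blast
qed

text \<open>The inverse is \<open>cnj f\<close> over \<open>|f|^2 + 1 - bump\<close>: where the bump
  is nonzero \<open>f\<close> has no zero, elsewhere the added term is 1, so the denominator never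
  vanishes, and near \<open>x\<close> it is \<open>|f|^2\<close>.\<close>

lemma local_inverse:
  fixes f :: "real^'n \<Rightarrow> complex"
  assumes "smooth f" "f x \<noteq> 0"
  shows "\<exists>g. smooth g \<and> (\<forall>\<^sub>F y in nhds x. f y * g y = 1)"
proof -
  have "isCont f x" using smooth_continuous[OF assms(1)] by (simp add: continuous_on_eq_continuous_at)
  then obtain r where r: "r > 0" "\<And>y. dist x y < r \<Longrightarrow> f y \<noteq> 0"
    using continuous_at_avoid[of x f 0] assms(2) by blast
  define D where "D y = f y * cnj (f y) + (1 - bump x r y)" for y
  have D: "D y \<noteq> 0" for y
  proof
    assume "D y = 0"
    obtain t where t: "bump x r y = of_real t" "0 \<le> t" "t \<le> 1" using bump_range by blast
    have "D y = of_real ((cmod (f y))\<^sup>2 + (1 - t))" by (simp add: D_def t complex_norm_square[symmetric] flip: of_real_power)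
    with \<open>D y = 0\<close> have "(cmod (f y))\<^sup>2 + (1 - t) = 0" by (simp only: of_real_eq_0_iff)
    then have "f y = 0" "t = 1" using t zero_le_power2[of "cmod (f y)"] by (auto simp: add_nonneg_eq_0_iff)
    then have "bump x r y \<noteq> 0" using t by simp
    then have "dist x y < r" using bump_0[OF r(1), of x y] r(1) by force
    then show False using r(2) \<open>f y = 0\<close> by blast
  qed
  have "smooth (\<lambda>y. cnj (f y) * inverse (D y))"
    by (intro smooth_mult smooth_cnj smooth_inverse D assms(1))
      (auto simp: D_def intro!: smooth_add smooth_mult smooth_cnj assms(1) smooth_diff smooth_bump)
  moreover have "\<forall>\<^sub>F y in nhds x. f y * (cnj (f y) * inverse (D y)) = 1"
    using bump_1_ev[OF r(1)]
  proof eventually_elim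
    case (elim y)
    then have "D y = f y * cnj (f y)" by (simp add: D_def)
    then show ?case using right_inverse[OF D[of y]] by (simp only: mult.assoc)
  qed
  ultimately show ?thesis by blast
qed

section \<open>Multiplicative maps of nonzero complex numbers\<close>

text \<open>While \<open>w\<close> is within 1/2 of 1, \<open>|w + 1|\<close> is at least 3/2, so
  squaring expands the distance to 1 by a factor of at least 3/2. Staying within 1/2 through
  \<open>n\<close> squarings requires an exponentially small start.\<close>

lemma pow2_close:
  fixes w :: complex
  assumes "\<And>i. i \<le> n \<Longrightarrow> norm (w ^ (2 ^ i) - 1) \<le> 1/2"
  shows "norm (w - 1) \<le> (2/3)^n / 2"
  using assms
proof (induction n arbitrary: w)
  case 0 then show ?case by force
next
  case (Suc n)
  have "norm ((w^2) ^ (2 ^ i) - 1) \<le> 1/2" if "i \<le> n" for i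
    using Suc.prems[of "Suc i"] that by (simp add: power_mult)
  then have 1: "norm (w^2 - 1) \<le> (2/3)^n / 2" by (rule Suc.IH)
  have "norm (w - 1) \<le> 1/2" using Suc.prems[of 0] by simp
  then have "norm (w + 1) \<ge> 3/2"
    using norm_triangle_ineq4[of "w + 1" "w - 1"] by simp
  moreover have "norm (w^2 - 1) = norm (w - 1) * norm (w + 1)"
    by (simp add: norm_mult[symmetric] algebra_simps power2_eq_square)
  ultimately have "norm (w - 1) * (3/2) \<le> norm (w^2 - 1)" using mult_left_mono[of "3/2" "norm (w + 1)" "norm (w - 1)"] by simp
  with 1 show ?case by simp
qed

text \<open>A power amplifies any value other than 1 to a definite distance from 1, so a mere
  inequality is enough to feed \<open>discrete_far_from_1\<close>.\<close>

lemma pow_far: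
  fixes w :: complex
  assumes "w \<noteq> 1"
  shows "\<exists>N. norm (w ^ N - 1) > 1/2"
proof (rule ccontr)
  assume "\<not> ?thesis"
  then have "norm (w - 1) \<le> (2/3)^n / 2" for n by (intro pow2_close) (force simp: not_less)
  moreover have "(\<lambda>n. (2/3::real)^n / 2) \<longlonglongrightarrow> 0 / 2" by (intro tendsto_intros LIMSEQ_realpow_zero) auto
  ultimately have "norm (w - 1) \<le> 0" by (intro LIMSEQ_le_const[of "\<lambda>n. (2/3::real)^n / 2"]) auto
  with assms show False by simp
qed

text \<open>Dividing by the power that fits \<open>m (1/2)\<close> leaves a homomorphism
  \<open>g\<close> with \<open>g 2 = 1\<close>. Powers of 2 move any \<open>c\<close> into the
  annulus between \<open>\<epsilon>/2\<close> and \<open>\<epsilon>\<close>, where \<open>g\<close>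
  is bounded; a bounded homomorphism into the positive reals is 1.\<close>

lemma bounded_hom_powr:
  fixes m :: "complex \<Rightarrow> real"
  assumes mult: "\<And>c d. c \<noteq> 0 \<Longrightarrow> d \<noteq> 0 \<Longrightarrow> m (c * d) = m c * m d" and pos: "\<And>c. c \<noteq> 0 \<Longrightarrow> m c > 0"
    and bd: "\<epsilon> > 0" "\<And>c. c \<noteq> 0 \<Longrightarrow> norm c \<le> \<epsilon> \<Longrightarrow> m c \<le> K"
    and "c \<noteq> 0"
  shows "m c = norm c powr (- log 2 (m (1/2)))"
proof -
  define p where "p = - log 2 (m (1/2))"
  define g where "g c = m c / norm c powr p" for c
  have g_mult: "g (c * d) = g c * g d" if "c \<noteq> 0" "d \<noteq> 0" for c d
    using that by (simp add: g_def mult norm_mult powr_mult)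
  have g_pos: "g c > 0" if "c \<noteq> 0" for c using that pos by (simp add: g_def)
  have g1: "g 1 = 1" using g_mult[of 1 1] g_pos[of 1] by simp
  have g_half: "g (1/2) = 1"
  proof -
    have "(1/2::real) powr p = m (1/2)"
      using pos[of "1/2"] by (simp add: p_def powr_minus powr_divide field_simps)
    then show ?thesis using pos[of "1/2"] by (simp add: g_def norm_divide)
  qed
  have g2: "g 2 = 1" using g_mult[of "1/2" 2] g_half g1 by simp
  have g_pow: "g (c ^ n) = g c ^ n" if "c \<noteq> 0" for c n
    by (induction n) (use that g1 in \<open>auto simp: g_mult\<close>)
  \<comment> \<open>The minimum over both ends bounds \<open>norm c powr p\<close> from below for
    either sign of \<open>p\<close>.\<close>
  define K' where "K' = \<bar>K\<bar> / min (\<epsilon> powr p) ((\<epsilon>/2) powr p)"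
  have annulus: "g c \<le> K'" if "\<epsilon>/2 \<le> norm c" "norm c \<le> \<epsilon>" for c
  proof -
    have c: "c \<noteq> 0" using that bd(1) by auto
    have "min (\<epsilon> powr p) ((\<epsilon>/2) powr p) \<le> norm c powr p"
    proof (cases "p \<ge> 0")
      case True then show ?thesis using powr_mono2[of p "\<epsilon>/2" "norm c"] that bd(1) by auto
    next
      case False then show ?thesis using powr_mono2'[of p "norm c" \<epsilon>] that bd(1) c by auto
    qed
    moreover have "m c \<le> \<bar>K\<bar>" using bd(2)[OF c that(2)] by simp
    moreover have "0 < min (\<epsilon> powr p) ((\<epsilon>/2) powr p)" using bd(1) by auto
    ultimately show ?thesis unfolding g_def K'_def using pos[OF c] by (intro frac_le) auto
  qed
  have g_le: "g c \<le> K'" if c: "c \<noteq> 0" for c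
  proof -
    define j where "j = \<lfloor>log 2 (\<epsilon> / norm c)\<rfloor>"
    have j1: "2 powr (real_of_int j) \<le> \<epsilon> / norm c"
      using bd(1) c by (simp add: j_def le_log_iff[symmetric])
    have j2: "\<epsilon> / norm c < 2 powr (real_of_int j + 1)"
      using bd(1) c by (simp add: j_def log_less_iff[symmetric])
    have "\<epsilon>/2 \<le> 2 powr (real_of_int j) * norm c" "2 powr (real_of_int j) * norm c \<le> \<epsilon>"
      using j1 j2 c by (auto simp: powr_add field_simps)
    moreover have "\<exists>d. d \<noteq> 0 \<and> norm d = 2 powr (real_of_int j) \<and> g d = 1"
    proof (cases "j \<ge> 0")
      case True
      then obtain n where "j = int n" using nonneg_int_cases by blast
      then show ?thesis by (intro exI[of _ "2 ^ n"]) (simp add: norm_power g_pow g2 powr_realpow)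
    next
      case False
      then obtain n where "j = - int n" by (metis linear nonpos_int_cases)
      moreover have "g ((1/2) ^ n) = 1" using g_pow[of "1/2" n] g_half by simp
      ultimately show ?thesis by (intro exI[of _ "(1/2) ^ n"]) (simp add: norm_power norm_divide powr_minus powr_realpow power_one_over inverse_eq_divide)
    qed
    then obtain d where "d \<noteq> 0" "norm d = 2 powr (real_of_int j)" "g d = 1" by blast
    ultimately show ?thesis using annulus[of "d * c"] g_mult[of d c] c by (simp add: norm_mult)
  qed
  have g_le1: "g c \<le> 1" if c: "c \<noteq> 0" for c
  proof (rule ccontr)
    assume "\<not> g c \<le> 1"
    then obtain n where "K' < g c ^ n" using real_arch_pow[of "g c" K'] by auto
    then show False using g_le[of "c ^ n"] g_pow[OF c] c by simp
  qed
  have "g c = 1"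
    using g_le1[OF assms(5)] g_le1[of "inverse c"] g_mult[of c "inverse c"] g1 assms(5) g_pos[OF assms(5)] g_pos[of "inverse c"]
    by (smt (verit, best) mult_left_le nonzero_imp_inverse_nonzero right_inverse)
  then show ?thesis using assms(5) by (simp add: g_def p_def)
qed

section \<open>Sets without limit points\<close>

text \<open>No limit point anywhere in the space, not merely none inside the set: such a set is
  closed, and in \<open>real^'n\<close> its complement is dense, so it can be removed by
  continuity.\<close>

definition discrete_set :: "'a::topological_space set \<Rightarrow> bool" where
  "discrete_set B \<longleftrightarrow> (\<forall>x. \<not> x islimpt B)"

lemma discrete_set_Un: "discrete_set A \<Longrightarrow> discrete_set B \<Longrightarrow> discrete_set (A \<union> B)"
  by (simp add: discrete_set_def islimpt_Un)

lemma discrete_set_mono: "discrete_set A \<Longrightarrow> B \<subseteq> A \<Longrightarrow> discrete_set B"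
  unfolding discrete_set_def using islimpt_subset by blast

text \<open>A ball contained in \<open>B\<close> would make its centre a limit point of
  \<open>B\<close>, so every ball meets the complement.\<close>

lemma discrete_set_seq:
  fixes B :: "(real^'n) set"
  assumes "discrete_set B"
  shows "\<exists>X. (\<forall>k. X k \<notin> B) \<and> X \<longlonglongrightarrow> x"
proof -
  have "\<exists>y. y \<notin> B \<and> dist y x < inverse (real (Suc k))" for k
  proof (rule ccontr)
    assume "\<not> ?thesis"
    then have "ball x (inverse (real (Suc k))) \<subseteq> B" by (auto simp: dist_commute)
    then have "x \<in> interior B" by (intro interiorI[of "ball x (inverse (real (Suc k)))"]) auto
    then show False using assms interior_limit_point unfolding discrete_set_def by blast
  qed
  then obtain X where X: "\<And>k. X k \<notin> B" "\<And>k. dist (X k) x < inverse (real (Suc k))" by metis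
  have "X \<longlonglongrightarrow> x"
    by (rule metric_tendsto_imp_tendsto[OF LIMSEQ_inverse_real_of_nat]) (use X(2) in \<open>auto intro!: always_eventually less_imp_le\<close>)
  with X(1) show ?thesis by blast
qed

lemma discrete_set_eqI:
  fixes f g :: "real^'n \<Rightarrow> 'b::t2_space"
  assumes "discrete_set B" "continuous_on UNIV f" "continuous_on UNIV g" "\<And>x. x \<notin> B \<Longrightarrow> f x = g x"
  shows "f x = g x"
proof -
  obtain X where X: "\<And>k. X k \<notin> B" "X \<longlonglongrightarrow> x" using discrete_set_seq[OF assms(1)] by blast
  have "(\<lambda>k. f (X k)) \<longlonglongrightarrow> f x" "(\<lambda>k. g (X k)) \<longlonglongrightarrow> g x"
    using assms(2,3) X(2) continuous_on_tendsto_compose by (blast intro: always_eventually)+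
  then show ?thesis using assms(4)[OF X(1)] LIMSEQ_unique by force
qed

section \<open>Multiplicative isomorphisms of smooth functions\<close>

lemma bump_outside: "r > 0 \<Longrightarrow> r \<le> dist x y \<Longrightarrow> bump x r y = 0"
  by (rule bump_0) auto

lemma eps_bound: "0 \<le> e \<Longrightarrow> 0 \<le> C \<Longrightarrow> e / (C + 1) * C \<le> (e::real)"
  by (simp add: field_simps)

lemma small_Suc: assumes "small (Suc k) f" shows "small k f"
  unfolding small_def
proof (intro allI impI)
  fix js :: "'a list" and y assume "length js \<le> k"
  then have "norm (iter_pderiv js f y) \<le> (1/2)^Suc k" using assms unfolding small_def by auto
  also have "\<dots> \<le> (1/2)^k" by simp
  finally show "norm (iter_pderiv js f y) \<le> (1/2)^k" .
qed

text \<open>The hypotheses are symmetric, so each fact about \<open>L\<close> holds for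
  \<open>M\<close> through \<open>swap\<close>. Locality is phrased at \<open>u x\<close>: the germ
  at \<open>x\<close> decides the value there.\<close>

locale mult_iso =
  fixes L M :: "(real^'n::finite \<Rightarrow> complex) \<Rightarrow> real^'n \<Rightarrow> complex" and u v :: "real^'n \<Rightarrow> real^'n"
  assumes L_smooth: "smooth f \<Longrightarrow> smooth (L f)" and M_smooth: "smooth f \<Longrightarrow> smooth (M f)"
    and L_mult: "smooth f \<Longrightarrow> smooth g \<Longrightarrow> L (\<lambda>x. f x * g x) = (\<lambda>y. L f y * L g y)"
    and M_mult: "smooth f \<Longrightarrow> smooth g \<Longrightarrow> M (\<lambda>x. f x * g x) = (\<lambda>y. M f y * M g y)"
    and L_M: "smooth f \<Longrightarrow> L (M f) = f" and M_L: "smooth f \<Longrightarrow> M (L f) = f"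
    and uv: "u (v y) = y" and vu: "v (u x) = x"
    and cont_u: "continuous_on UNIV u" and cont_v: "continuous_on UNIV v"
    and L_local: "smooth f \<Longrightarrow> smooth g \<Longrightarrow> \<forall>\<^sub>F z in nhds x. f z = g z \<Longrightarrow> L f (u x) = L g (u x)"
    and M_local: "smooth f \<Longrightarrow> smooth g \<Longrightarrow> \<forall>\<^sub>F z in nhds y. f z = g z \<Longrightarrow> M f (v y) = M g (v y)"
begin

lemma swap: "mult_iso M L v u"
  by unfold_locales (fact L_smooth M_smooth L_mult M_mult L_M M_L uv vu cont_u cont_v L_local M_local)+

lemma L_1: "L (\<lambda>_. 1) y = 1"
proof -
  have "L (\<lambda>x. M (\<lambda>_. 1) x * 1) = (\<lambda>y. L (M (\<lambda>_. 1)) y * L (\<lambda>_. 1) y)"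
    by (rule L_mult) (auto intro: M_smooth)
  then show ?thesis using L_M[of "\<lambda>_. 1"] by (simp add: fun_eq_iff)
qed

lemma L_nonzero: assumes "smooth f" "f x \<noteq> 0" shows "L f (u x) \<noteq> 0"
proof -
  obtain g where g: "smooth g" "\<forall>\<^sub>F y in nhds x. f y * g y = 1" using local_inverse[of f x] assms by blast
  have "L (\<lambda>y. f y * g y) (u x) = L (\<lambda>_. 1) (u x)"
    by (rule L_local) (use assms g in \<open>auto intro: smooth_mult\<close>)
  then show ?thesis using L_mult[OF assms(1) g(1)] L_1 by auto
qed

text \<open>Nonvanishing for the inverse map \<open>M\<close>, read backwards.\<close>

lemma L_zero: assumes "smooth f" "f x = 0" shows "L f (u x) = 0"
proof (rule ccontr)
  assume "L f (u x) \<noteq> 0"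
  then have "M (L f) (v (u x)) \<noteq> 0" by (intro mult_iso.L_nonzero[OF swap] L_smooth assms)
  then show False using M_L[OF assms(1)] assms(2) by (simp add: vu)
qed

lemma L_power: "smooth f \<Longrightarrow> L (\<lambda>x. f x ^ k) y = L f y ^ k"
proof (induction k)
  case (Suc k)
  then show ?case using L_mult[OF Suc.prems smooth_power[OF Suc.prems, of k]] by simp
qed (simp add: L_1)

lemma cont_Lu: "smooth f \<Longrightarrow> continuous_on UNIV (\<lambda>x. L f (u x))"
  by (intro continuous_on_compose2[OF smooth_continuous[OF L_smooth] cont_u]) auto

lemma tendsto_Lu: "smooth f \<Longrightarrow> X \<longlonglongrightarrow> x \<Longrightarrow> (\<lambda>k. L f (u (X k))) \<longlonglongrightarrow> L f (u x)"
  by (rule continuous_on_tendsto_compose[OF cont_Lu]) auto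

text \<open>At a limit point of \<open>B\<close> the pieces glue to one smooth \<open>F\<close>, and
  \<open>L F\<close> would be unbounded along a convergent sequence.\<close>

lemma discrete_unbounded:
  assumes "\<And>x k r. x \<in> B \<Longrightarrow> 0 < r \<Longrightarrow> r < 1 \<Longrightarrow> \<exists>f. smooth f \<and> (\<forall>y. r \<le> dist x y \<longrightarrow> f y = 0) \<and> small k f \<and> norm (L f (u x)) > real k"
  shows "discrete_set B"
  unfolding discrete_set_def
proof (intro allI notI)
  fix x0 assume "x0 islimpt B"
  from glue_bumps[OF this, where Q = "\<lambda>k x r f. norm (L f (u x)) > real k", OF assms]
  obtain F X where F: "smooth F" "X \<longlonglongrightarrow> x0"
    and ex: "\<And>k. \<exists>f r. r > 0 \<and> smooth f \<and> (\<forall>y\<in>ball (X k) r. F y = f y) \<and> norm (L f (u (X k))) > real k"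
    by blast
  have "norm (L F (u (X k))) > real k" for k
  proof -
    obtain f r where f: "r > 0" "smooth f" "\<forall>y\<in>ball (X k) r. F y = f y" "norm (L f (u (X k))) > real k"
      using ex[of k] by blast
    have "L F (u (X k)) = L f (u (X k))"
      by (rule L_local[OF F(1) f(2)], rule eventually_mono[OF eventually_nhds_in_open[of "ball (X k) r"]]) (use f in auto)
    then show ?thesis using f by simp
  qed
  moreover have "Bseq (\<lambda>k. L F (u (X k)))"
    using tendsto_Lu[OF F] by (intro convergent_imp_Bseq convergentI)
  then obtain K where "\<And>k. norm (L F (u (X k))) \<le> K" by (auto simp: Bseq_def)
  moreover obtain k :: nat where "K < real k" using reals_Archimedean2 by blast
  ultimately show False by (meson less_le_trans less_trans not_less)
qed

text \<open>The gaps between the bumps pin \<open>L (1 + F)\<close> to 1 at points tending to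
  \<open>u x0\<close>, hence at \<open>u x0\<close> itself, while the bumps keep it 1/2 away at
  other points tending there.\<close>

lemma discrete_far_from_1:
  assumes "\<And>x k r. x \<in> B \<Longrightarrow> 0 < r \<Longrightarrow> r < 1 \<Longrightarrow> \<exists>f. smooth f \<and> (\<forall>y. r \<le> dist x y \<longrightarrow> f y = 0) \<and> small k f \<and>
    norm (L (\<lambda>y. 1 + f y) (u x) - 1) > 1/2"
  shows "discrete_set B"
  unfolding discrete_set_def
proof (intro allI notI)
  fix x0 assume "x0 islimpt B"
  from glue_bumps[OF this, where Q = "\<lambda>k x r f. norm (L (\<lambda>y. 1 + f y) (u x) - 1) > 1/2", OF assms]
  obtain F X Z where F: "smooth F" "X \<longlonglongrightarrow> x0" "Z \<longlonglongrightarrow> x0" "\<And>k. \<forall>\<^sub>F y in nhds (Z k). F y = 0"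
    and ex: "\<And>k. \<exists>f r. r > 0 \<and> smooth f \<and> (\<forall>y\<in>ball (X k) r. F y = f y) \<and> norm (L (\<lambda>y. 1 + f y) (u (X k)) - 1) > 1/2"
    by blast
  have sm: "smooth (\<lambda>y. 1 + F y)" by (intro smooth_add smooth_const F)
  have far: "norm (L (\<lambda>y. 1 + F y) (u (X k)) - 1) \<ge> 1/2" for k
  proof -
    obtain f r where f: "r > 0" "smooth f" "\<forall>y\<in>ball (X k) r. F y = f y" "norm (L (\<lambda>y. 1 + f y) (u (X k)) - 1) > 1/2"
      using ex[of k] by blast
    have "L (\<lambda>y. 1 + F y) (u (X k)) = L (\<lambda>y. 1 + f y) (u (X k))"
      by (rule L_local[OF sm], intro smooth_add smooth_const f, rule eventually_mono[OF eventually_nhds_in_open[of "ball (X k) r"]]) (use f in auto)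
    then show ?thesis using f by simp
  qed
  have "L (\<lambda>y. 1 + F y) (u (Z k)) = 1" for k
  proof -
    have "L (\<lambda>y. 1 + F y) (u (Z k)) = L (\<lambda>_. 1) (u (Z k))"
      by (rule L_local[OF sm]) (use F(4)[of k] in \<open>auto elim: eventually_mono\<close>)
    then show ?thesis by (simp add: L_1)
  qed
  then have "L (\<lambda>y. 1 + F y) (u x0) = 1"
    using tendsto_Lu[OF sm F(3)] by (simp add: LIMSEQ_const_iff)
  then have "(\<lambda>k. norm (L (\<lambda>y. 1 + F y) (u (X k)) - 1)) \<longlonglongrightarrow> norm ((1::complex) - 1)"
    using tendsto_Lu[OF sm F(2)] by (intro tendsto_intros) simp
  from LIMSEQ_le_const[OF this] far have "1/2 \<le> norm ((1::complex) - 1)" by blast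
  then show False by simp
qed

section \<open>Exceptional points for constants, exponentials and finite order\<close>

text \<open>The points where the homomorphism of constants is unbounded near 0, which is what blocks
  \<open>bounded_hom_powr\<close>.\<close>

definition bad_const :: "(real^'n) set" where
  "bad_const = {x. \<forall>\<epsilon>>0. \<forall>K. \<exists>c. c \<noteq> 0 \<and> norm c \<le> \<epsilon> \<and> norm (L (\<lambda>_. c) (u x)) > K}"

text \<open>A fixed cutoff has derivatives bounded by some \<open>C\<close>. A constant below
  \<open>(1/2)^k / (C + 1)\<close> makes the product small, and unboundedness near 0 supplies such
  constants with large images.\<close>

lemma discrete_bad_const: "discrete_set bad_const"
proof (rule discrete_unbounded)
  fix x k and r :: real assume x: "x \<in> bad_const" and r: "0 < r" "r < 1"
  obtain C where C: "C \<ge> 0" "\<And>js y. length js \<le> k \<Longrightarrow> norm (iter_pderiv js (bump x r) y) \<le> C"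
    using compact_support_bound[OF smooth_bump bump_0[OF r(1)], where k = k] by blast
  have "(1/2)^k / (C + 1) > 0" using C(1) by simp
  then obtain c where c: "c \<noteq> 0" "norm c \<le> (1/2)^k / (C + 1)" "norm (L (\<lambda>_. c) (u x)) > real k"
    using x unfolding bad_const_def by blast
  let ?f = "\<lambda>y. c * bump x r y"
  have "small k ?f"
    unfolding small_def
  proof (intro allI impI)
    fix js :: "'n list" and y assume js: "length js \<le> k"
    have "norm (iter_pderiv js ?f y) = norm c * norm (iter_pderiv js (bump x r) y)"
      by (simp add: iter_pderiv_linear[OF bounded_linear_mult_right smooth_bump] norm_mult)
    also have "\<dots> \<le> (1/2)^k / (C + 1) * C"
      using c C js by (intro mult_mono) auto
    also have "\<dots> \<le> (1/2)^k" using C(1) by (intro eps_bound) auto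
    finally show "norm (iter_pderiv js ?f y) \<le> (1/2)^k" .
  qed
  moreover have "L ?f (u x) = L (\<lambda>_. c) (u x)"
    by (rule L_local) (use bump_1_ev[OF r(1), of x] in \<open>auto intro!: smooth_mult smooth_bump elim: eventually_mono\<close>)
  moreover have "\<forall>y. r \<le> dist x y \<longrightarrow> ?f y = 0" using bump_outside[OF r(1)] by auto
  ultimately show "\<exists>f. smooth f \<and> (\<forall>y. r \<le> dist x y \<longrightarrow> f y = 0) \<and> small k f \<and> norm (L f (u x)) > real k"
    using c(3) by (intro exI[of _ ?f]) (auto intro!: smooth_mult smooth_bump)
qed

text \<open>The exponent \<open>p\<close> for which constants satisfy
  \<open>|L c| = |c| powr p\<close> at \<open>u x\<close>, read off at \<open>c = 1/2\<close>. Being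
  given by a formula at every point, it is continuous across the exceptional set too.\<close>

definition pw :: "real^'n \<Rightarrow> real" where
  "pw x = - log 2 (norm (L (\<lambda>_. 1/2) (u x)))"

lemma L_const_mult: "L (\<lambda>_. c * d) y = L (\<lambda>_. c) y * L (\<lambda>_. d) y"
  using L_mult[of "\<lambda>_. c" "\<lambda>_. d"] by (simp add: fun_eq_iff)

lemma norm_L_const:
  assumes "x \<notin> bad_const" "c \<noteq> 0"
  shows "norm (L (\<lambda>_. c) (u x)) = norm c powr pw x"
proof -
  obtain \<epsilon> K where "\<epsilon> > 0" "\<And>c. c \<noteq> 0 \<Longrightarrow> norm c \<le> \<epsilon> \<Longrightarrow> norm (L (\<lambda>_. c) (u x)) \<le> K"
    using assms(1) unfolding bad_const_def by (force simp: not_less)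
  from bounded_hom_powr[where m = "\<lambda>c. norm (L (\<lambda>_. c) (u x))", OF _ _ this assms(2)]
  show ?thesis using L_nonzero[OF smooth_const] by (simp add: L_const_mult norm_mult pw_def)
qed

definition bad_exp :: "(real^'n) set" where
  "bad_exp = {x. \<exists>\<phi>. smooth \<phi> \<and> \<phi> x = 0 \<and> norm (L (\<lambda>y. exp (\<phi> y)) (u x)) > 1}"

lemma exp_growth:
  fixes \<mu> t :: real assumes "\<mu> > 0" "t > 1"
  shows "\<exists>i\<ge>i0. \<mu> ^ (k * i + j0) * t ^ (2 ^ i) > real k"
proof -
  define a b where "a = ln \<mu>" and "b = ln t"
  have b: "b > 0" using assms by (simp add: b_def)
  have "filterlim (\<lambda>i. exp (a * (real k * real i + real j0) + b * 2 powr real i)) at_top sequentially"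
    using b by real_asymp
  then have "\<forall>\<^sub>F i in sequentially. exp (a * (real k * real i + real j0) + b * 2 powr real i) > real k"
    by (simp add: filterlim_at_top_dense)
  then obtain i1 where i1: "\<And>i. i \<ge> i1 \<Longrightarrow> exp (a * (real k * real i + real j0) + b * 2 powr real i) > real k"
    by (auto simp: eventually_sequentially)
  have "exp (a * (real k * real i + real j0) + b * 2 powr real i) = \<mu> ^ (k * i + j0) * t ^ (2 ^ i)" for i
  proof -
    have "\<mu> ^ (k * i + j0) = exp (a * (real k * real i + real j0))"
      using assms by (simp add: a_def exp_of_nat_mult[symmetric] mult.commute flip: exp_of_nat2_mult)
        (metis exp_ln exp_of_nat2_mult of_nat_add of_nat_mult)
    moreover have "t ^ (2 ^ i) = exp (b * 2 powr real i)"
      using assms by (metis b_def exp_ln exp_of_nat2_mult less_trans of_nat_numeral of_nat_power powr_realpow zero_less_numeral zero_less_one)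
    ultimately show ?thesis by (simp add: exp_add)
  qed
  then show ?thesis using i1[of "max i0 i1"] by (intro exI[of _ "max i0 i1"]) auto
qed

text \<open>With \<open>N = 2 ^ i\<close>, the function \<open>exp (N \<phi>)\<close> cut off at
  scale \<open>1/N\<close> has derivatives up to order \<open>k\<close> of size at most
  \<open>C * N ^ k\<close>. Damping by a suitable constant makes it small and multiplies the image
  by something only exponential in \<open>i\<close>, whereas the \<open>N\<close>-th power of a
  value above 1 grows doubly exponentially in \<open>i\<close>.\<close>

lemma discrete_bad_exp: "discrete_set bad_exp"
proof (rule discrete_unbounded)
  fix x k and r :: real assume x: "x \<in> bad_exp" and r: "0 < r" "r < 1"
  obtain \<phi> where phi: "smooth \<phi>" "\<phi> x = 0" "norm (L (\<lambda>y. exp (\<phi> y)) (u x)) > 1"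
    using x by (auto simp: bad_exp_def)
  define rr :: "nat \<Rightarrow> real" where "rr N = 1 / real N" for N
  define h where "h N y = bump x (rr N) y * exp (\<phi> y / of_real (rr N))" for N y
  let ?I = "{1..} :: nat set"
  have rr: "0 < rr N \<and> rr N \<le> 1" if "N \<in> ?I" for N using that by (simp add: rr_def)
  have smh: "smooth (h N)" for N
    unfolding h_def by (intro smooth_mult smooth_bump smooth_exp smooth_linear[OF bounded_linear_divide] phi)
  have "fam ?I rr x (0 + 0) k h"
    unfolding h_def bump_def
    by (intro fam_mult fam_rescaled smooth_std_bump fam_exp phi) (use rr less_imp_le in auto)
  from fam_support_bound[OF this smh rr]
  obtain C where C: "C \<ge> 0" "\<And>js N y. length js \<le> k \<Longrightarrow> N \<ge> 1 \<Longrightarrow> rr N ^ k * norm (iter_pderiv js (h N) y) \<le> C * rr N ^ 0"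
    using bump_0 rr by (force simp: h_def)
  obtain j0 where j0: "C * (1/2)^j0 \<le> (1/2)^k"
  proof -
    have "(\<lambda>j. C * (1/2)^j) \<longlonglongrightarrow> C * 0" by (intro tendsto_intros LIMSEQ_realpow_zero) auto
    then have "\<forall>\<^sub>F j in sequentially. C * (1/2)^j < (1/2)^k" by (rule order_tendstoD) simp
    then show ?thesis using that by (auto simp: eventually_sequentially intro: less_imp_le)
  qed
  obtain i0 where i0: "1 / r < 2 ^ i0" using real_arch_pow[of 2 "1/r"] by auto
  define \<mu> where "\<mu> = norm (L (\<lambda>_. 1/2) (u x))"
  have "\<mu> > 0" using L_nonzero[OF smooth_const, of "1/2" x] by (simp add: \<mu>_def)
  from exp_growth[OF this phi(3), of i0 k j0]
  obtain i where i: "i \<ge> i0" "\<mu> ^ (k * i + j0) * norm (L (\<lambda>y. exp (\<phi> y)) (u x)) ^ (2 ^ i) > real k" by blast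
  define N :: nat where "N = 2 ^ i"
  have N1: "N \<ge> 1" by (simp add: N_def)
  have Nr: "rr N < r"
  proof -
    have "1 / r < 2 ^ i" using i0 power_increasing[OF i(1), of "2::real"] by linarith
    then show ?thesis using r by (simp add: rr_def N_def field_simps)
  qed
  \<comment> \<open>\<open>(1/2) ^ (k * i)\<close> cancels \<open>N ^ k\<close>, and the extra
    \<open>j0\<close> factors absorb the constant \<open>C\<close>.\<close>
  define c :: complex where "c = (1/2) ^ (k * i + j0)"
  let ?f = "\<lambda>y. c * h N y"
  have "small k ?f"
    unfolding small_def
  proof (intro allI impI)
    fix js :: "'n list" and y assume js: "length js \<le> k"
    have "norm (iter_pderiv js (h N) y) \<le> C * (2^i)^k"
      using C(2)[OF js N1, of y] by (simp add: rr_def N_def field_simps power_one_over)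
    then have "norm (iter_pderiv js ?f y) \<le> (1/2)^(k * i + j0) * (C * (2^i)^k)"
      by (simp add: iter_pderiv_linear[OF bounded_linear_mult_right smh] norm_mult c_def norm_power norm_divide)
    also have "\<dots> = C * (1/2)^j0"
      by (simp add: power_add power_mult power_one_over field_simps)
    finally show "norm (iter_pderiv js ?f y) \<le> (1/2)^k" using j0 by linarith
  qed
  moreover have "norm (L ?f (u x)) > real k"
  proof -
    have sme: "smooth (\<lambda>y. exp (\<phi> y))" by (intro smooth_exp phi)
    have "L ?f (u x) = L (\<lambda>y. c * exp (\<phi> y) ^ N) (u x)"
    proof (rule L_local)
      show "\<forall>\<^sub>F z in nhds x. c * h N z = c * exp (\<phi> z) ^ N"
        using bump_1_ev[of "rr N" x] rr[of N] N1
        by (auto elim!: eventually_mono simp: h_def rr_def exp_of_nat_mult[symmetric] mult.commute)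
    qed (intro smooth_mult smooth_const smh smooth_power sme)+
    also have "\<dots> = L (\<lambda>_. c) (u x) * L (\<lambda>y. exp (\<phi> y)) (u x) ^ N"
      using L_mult[OF smooth_const smooth_power[OF sme], of c N] L_power[OF sme] by (simp add: fun_eq_iff)
    also have "L (\<lambda>_. c) (u x) = L (\<lambda>_. 1/2) (u x) ^ (k * i + j0)"
      using L_power[OF smooth_const] by (simp add: c_def)
    finally show ?thesis using i(2) by (simp add: norm_mult norm_power \<mu>_def N_def)
  qed
  moreover have "\<forall>y. r \<le> dist x y \<longrightarrow> ?f y = 0" using bump_outside[of "rr N" x] rr[of N] N1 Nr by (auto simp: h_def)
  ultimately show "\<exists>f. smooth f \<and> (\<forall>y. r \<le> dist x y \<longrightarrow> f y = 0) \<and> small k f \<and> norm (L f (u x)) > real k"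
    by (intro exI[of _ ?f]) (auto intro!: smooth_mult smh)
qed

text \<open>The bound by 1 holds for \<open>\<phi>\<close> and for \<open>- \<phi>\<close>, and the
  two images are inverse to each other.\<close>

lemma norm_L_exp:
  assumes "x \<notin> bad_exp" "smooth \<phi>" "\<phi> x = 0"
  shows "norm (L (\<lambda>y. exp (\<phi> y)) (u x)) = 1"
proof -
  have 1: "norm (L (\<lambda>y. exp (\<phi> y)) (u x)) \<le> 1" using assms unfolding bad_exp_def by force
  have 2: "norm (L (\<lambda>y. exp (- \<phi> y)) (u x)) \<le> 1"
    using assms smooth_minus[OF assms(2)] unfolding bad_exp_def by (force simp: not_less)
  have "L (\<lambda>y. exp (\<phi> y) * exp (- \<phi> y)) (u x) = L (\<lambda>y. exp (\<phi> y)) (u x) * L (\<lambda>y. exp (- \<phi> y)) (u x)"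
    by (subst L_mult) (intro smooth_exp smooth_minus assms refl)+
  then have "norm (L (\<lambda>y. exp (\<phi> y)) (u x)) * norm (L (\<lambda>y. exp (- \<phi> y)) (u x)) = 1"
    by (simp add: exp_minus L_1 flip: norm_mult)
  with 1 2 show ?thesis
    by (smt (verit, best) mult_left_le mult_less_cancel_left2 norm_ge_zero)
qed

text \<open>Off this set, \<open>L (1 - a g) (u x)\<close> is the product over \<open>j \<le> K\<close> of the values at \<open>u x\<close> of \<open>L\<close> on
  \<open>exp (- (a g) ^ j / j)\<close>, with \<open>K\<close> independent of \<open>a\<close>.\<close>
definition bad_order :: "(real^'n) set" where
  "bad_order = {x. \<exists>g. smooth g \<and> g x = 0 \<and> (\<forall>K\<ge>1. \<exists>a. L (\<lambda>y. weierstrass_factor K (a * g y)) (u x) \<noteq> 1)}"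

lemma smooth_weierstrass: "smooth g \<Longrightarrow> smooth (\<lambda>y. weierstrass_factor K (a * g y))"
  unfolding weierstrass_factor_def
  by (intro smooth_mult smooth_diff smooth_const smooth_exp smooth_sum smooth_linear[OF bounded_linear_divide] smooth_power)

text \<open>The geometric sum telescopes and leaves a factor \<open>z ^ K\<close>: this flatness at
  0 is what Weierstrass factors are used for.\<close>

lemma DERIV_weierstrass:
  "(weierstrass_factor K has_field_derivative - (z ^ K) * exp (\<Sum>k=1..K. z ^ k / of_nat k)) (at z)"
proof -
  have 1: "((\<lambda>z::complex. \<Sum>k=1..K. z ^ k / of_nat k) has_field_derivative (\<Sum>k=1..K. z ^ (k - 1))) (at z)"
    by (rule DERIV_sum) (auto intro!: derivative_eq_intros)
  have geo: "(1 - z) * (\<Sum>k=1..K. z ^ (k - 1)) = 1 - z ^ K"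
    by (simp add: sum.atLeast1_atMost_eq one_diff_power_eq)
  have 2: "(- 1) * e + e * (\<Sum>k=1..K. z ^ (k - 1)) * (1 - z) = - (z ^ K) * e" for e
  proof -
    have "e * (\<Sum>k=1..K. z ^ (k - 1)) * (1 - z) = e * (1 - z ^ K)"
      unfolding geo[symmetric] by (simp only: mult_ac)
    then show ?thesis by (simp only:) (simp add: algebra_simps)
  qed
  show ?thesis
    unfolding weierstrass_factor_def[abs_def]
    by (rule derivative_eq_intros refl 1)+ (simp only: 2[symmetric], simp add: algebra_simps)
qed

text \<open>The power \<open>W ^ N\<close> whose image is far from 1 still differs from 1 by a
  function \<open>E\<close> whose partial derivatives contain \<open>g ^ k\<close>. Hence
  \<open>E\<close> is of order \<open>k + 1\<close> at \<open>x\<close>, and for fixed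
  \<open>N\<close> and \<open>a\<close> its cutoff at scale \<open>s\<close> has derivatives up to
  order \<open>k\<close> of size \<open>O(s)\<close>.\<close>

lemma discrete_bad_order: "discrete_set bad_order"
proof (rule discrete_far_from_1)
  fix x k0 and r :: real assume x: "x \<in> bad_order" and r: "0 < r" "r < 1"
  \<comment> \<open>Shifted by one because \<open>bad_order\<close> offers only factors with
    \<open>K\<close> at least 1.\<close>
  define k where "k = Suc k0"
  obtain g a where g: "smooth g" "g x = 0" and a: "L (\<lambda>y. weierstrass_factor k (a * g y)) (u x) \<noteq> 1"
    using x unfolding bad_order_def k_def by fastforce
  define W where "W y = weierstrass_factor k (a * g y)" for y
  have smW: "smooth W" unfolding W_def by (rule smooth_weierstrass[OF g(1)])
  obtain N where N: "norm (L W (u x) ^ N - 1) > 1/2" using pow_far a unfolding W_def by blast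
  define E where "E y = W y ^ N - 1" for y
  have smE: "smooth E" unfolding E_def by (intro smooth_diff smooth_power smW smooth_const)
  define S where "S y = exp (\<Sum>j=1..k. (a * g y) ^ j / of_nat j)" for y
  have smS: "smooth S" unfolding S_def
    by (intro smooth_exp smooth_sum smooth_linear[OF bounded_linear_divide] smooth_power smooth_mult smooth_const g)
  have pdE: "partial_deriv i E = (\<lambda>y. g y ^ k * (- of_nat N * W y ^ (N - 1) * a ^ k * S y * a * partial_deriv i g y))" for i
  proof -
    have "((\<lambda>w. weierstrass_factor k (a * w) ^ N - 1) has_field_derivative
        (of_nat N * (weierstrass_factor k (a * w) ^ (N - 1) * ((- ((a * w) ^ k) * exp (\<Sum>j=1..k. (a * w) ^ j / of_nat j)) * a)))) (at w)" for w
      by (rule derivative_eq_intros refl DERIV_chain2[OF DERIV_weierstrass] DERIV_power[THEN DERIV_cong] | simp)+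
    from has_pd_field_compose[OF this smooth_partial_deriv(1)[OF g(1)], of i]
    have "partial_deriv i E = (\<lambda>y. partial_deriv i g y * (of_nat N * (weierstrass_factor k (a * g y) ^ (N - 1) * ((- ((a * g y) ^ k) * exp (\<Sum>j=1..k. (a * g y) ^ j / of_nat j)) * a))))"
      unfolding E_def W_def by (rule has_pd_partial_deriv)
    then show ?thesis by (simp add: W_def S_def power_mult_distrib mult_ac)
  qed
  let ?I = "{0<..1::real}"
  have rr: "0 < s \<and> s \<le> 1" if "s \<in> ?I" for s :: real using that by simp
  have "fam ?I (\<lambda>s. s) x (k * 1) k (\<lambda>s y. g y ^ k)"
    by (rule fam_power[OF _ fam_vanishing[OF _ g]]) auto
  then have pdfam: "fam ?I (\<lambda>s. s) x (k + 0) k (\<lambda>s. partial_deriv i E)" for i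
    unfolding pdE
    by (intro fam_mult fam_const_smooth smooth_mult smooth_const smooth_power smW smS smooth_partial_deriv g smooth_minus) auto
  have E0: "E x = 0" by (simp add: E_def W_def g(2))
  have "fam ?I (\<lambda>s. s) x (k + 1) k (\<lambda>s. E)"
    by (rule fam_Suc_lower[OF fam_primitive[OF _ smE E0]]) (use pdfam in auto)
  then have fam: "fam ?I (\<lambda>s. s) x (0 + (k + 1)) k (\<lambda>s y. bump x s y * E y)"
    unfolding bump_def by (intro fam_mult fam_rescaled smooth_std_bump) auto
  have smh: "smooth (\<lambda>y. bump x s y * E y)" for s by (intro smooth_mult smooth_bump smE)
  obtain C where C: "C \<ge> 0" "\<And>js s y. length js \<le> k \<Longrightarrow> s \<in> ?I \<Longrightarrow> s ^ k * norm (iter_pderiv js (\<lambda>y. bump x s y * E y) y) \<le> C * s ^ (0 + (k + 1))"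
    using fam_support_bound[OF fam smh rr] bump_0 by force
  define s where "s = min r ((1/2)^k / (C + 1))"
  have s: "s > 0" "s \<le> r" "s \<le> (1/2)^k / (C + 1)" using r C(1) by (auto simp: s_def)
  let ?f = "\<lambda>y. bump x s y * E y"
  have "small k ?f"
    unfolding small_def
  proof (intro allI impI)
    fix js :: "'n list" and y assume js: "length js \<le> k"
    have "s ^ k * norm (iter_pderiv js ?f y) \<le> s ^ k * (C * s)"
      using C(2)[OF js, of s y] s r by (simp add: mult_ac)
    then have "norm (iter_pderiv js ?f y) \<le> C * s" using s(1) by simp
    also have "\<dots> \<le> C * ((1/2)^k / (C + 1))" by (rule mult_left_mono[OF s(3) C(1)])
    also have "\<dots> \<le> (1/2)^k" using eps_bound[of "(1/2)^k" C] C(1) by (simp add: mult.commute)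
    finally show "norm (iter_pderiv js ?f y) \<le> (1/2)^k" .
  qed
  then have "small k0 ?f" unfolding k_def by (rule small_Suc)
  moreover have "norm (L (\<lambda>y. 1 + ?f y) (u x) - 1) > 1/2"
  proof -
    have "L (\<lambda>y. 1 + ?f y) (u x) = L (\<lambda>y. W y ^ N) (u x)"
    proof (rule L_local)
      show "\<forall>\<^sub>F z in nhds x. 1 + bump x s z * E z = W z ^ N"
        using bump_1_ev[OF s(1), of x] by (auto elim!: eventually_mono simp: E_def)
    qed (intro smooth_add smooth_const smh smooth_power smW)+
    then show ?thesis using N by (simp add: L_power[OF smW])
  qed
  moreover have "\<forall>y. r \<le> dist x y \<longrightarrow> ?f y = 0" using bump_outside[OF s(1), of x] s order_trans by (metis mult_zero_left)
  ultimately show "\<exists>f. smooth f \<and> (\<forall>y. r \<le> dist x y \<longrightarrow> f y = 0) \<and> small k0 f \<and> norm (L (\<lambda>y. 1 + f y) (u x) - 1) > 1/2"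
    by (intro exI[of _ ?f]) (auto intro!: smh)
qed

end

lemma ln_norm_differentiable:
  fixes g :: "real^'n \<Rightarrow> complex"
  assumes "smooth g" "g y \<noteq> 0"
  shows "(\<lambda>z. ln (norm (g z))) differentiable (at y)"
proof -
  have "(\<lambda>z. norm (g z)) differentiable (at y)"
    using differentiable_compose[of norm g y UNIV] smooth_differentiable[OF assms(1)] differentiable_norm_at[OF assms(2)]
    by (simp add: differentiable_at_withinI)
  moreover have "ln differentiable (at (norm (g y)))"
    using assms(2) DERIV_ln[of "norm (g y)"] unfolding differentiable_def has_field_derivative_def by force
  ultimately show ?thesis
    using differentiable_compose[of ln "\<lambda>z. norm (g z)" y UNIV] by simp
qed

lemma differentiable_local_bound:
  fixes f :: "'a::real_normed_vector \<Rightarrow> 'b::real_normed_vector"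
  assumes "f differentiable (at x)"
  shows "\<exists>C>0. \<exists>d>0. \<forall>y. dist y x < d \<longrightarrow> norm (f y - f x) \<le> C * norm (y - x)"
proof -
  obtain f' where f': "(f has_derivative f') (at x)" using assms by (auto simp: differentiable_def)
  then obtain d where d: "d > 0" "\<And>y. norm (y - x) < d \<Longrightarrow> norm (f y - f x - f' (y - x)) \<le> 1 * norm (y - x)"
    unfolding has_derivative_within_alt by (metis UNIV_I zero_less_one)
  obtain K where K: "K > 0" "\<And>h. norm (f' h) \<le> norm h * K"
    using bounded_linear.pos_bounded[OF has_derivative_bounded_linear[OF f']] by blast
  have "norm (f y - f x) \<le> (1 + K) * norm (y - x)" if "dist y x < d" for y
  proof -
    have "norm (f y - f x) \<le> norm (f y - f x - f' (y - x)) + norm (f' (y - x))"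
      using norm_triangle_ineq[of "f y - f x - f' (y - x)" "f' (y - x)"] by simp
    then show ?thesis using d(2)[of y] K(2)[of "y - x"] that by (simp add: dist_norm algebra_simps)
  qed
  then show ?thesis using d(1) K(1) by (intro exI[of _ "1 + K"]) auto
qed

section \<open>The modulus of the image and differentiability of the point map\<close>

context mult_iso
begin

lemma discrete_vimage_u:
  assumes "discrete_set B"
  shows "discrete_set (u -` B)"
  unfolding discrete_set_def
proof (intro allI notI)
  fix x0 assume "x0 islimpt u -` B"
  then obtain X where X: "\<And>k. X k \<in> u -` B - {x0}" "X \<longlonglongrightarrow> x0" by (auto simp: islimpt_sequential)
  have "(\<lambda>k. u (X k)) \<longlonglongrightarrow> u x0"
    by (rule continuous_on_tendsto_compose[OF cont_u X(2)]) auto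
  moreover have "u (X k) \<in> B - {u x0}" for k using X(1)[of k] vu by (metis Diff_iff singletonD singletonI vimageE)
  ultimately have "u x0 islimpt B" unfolding islimpt_sequential by (intro exI[of _ "\<lambda>k. u (X k)"]) auto
  then show False using assms by (auto simp: discrete_set_def)
qed

text \<open>Normalize \<open>f\<close> to \<open>f x * (1 - \<phi>)\<close> with
  \<open>\<phi> x = 0\<close> and write \<open>1 - \<phi>\<close> as a Weierstrass factor divided by
  \<open>exp \<psi>\<close>. Both have images of modulus 1 at \<open>u x\<close>, which leaves the
  constant \<open>f x\<close>.\<close>

lemma norm_L_generic:
  assumes "x \<notin> bad_const \<union> bad_exp \<union> bad_order" "smooth f" "f x \<noteq> 0"
  shows "norm (L f (u x)) = norm (f x) powr pw x"
proof -
  define \<phi> where "\<phi> y = 1 - inverse (f x) * f y" for y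
  have phi: "smooth \<phi>" "\<phi> x = 0" unfolding \<phi>_def using assms by (auto intro!: smooth_diff smooth_mult)
  then obtain K where K: "K \<ge> 1" "L (\<lambda>y. weierstrass_factor K (1 * \<phi> y)) (u x) = 1"
    using assms(1) unfolding bad_order_def by blast
  define \<psi> where "\<psi> y = (\<Sum>k=1..K. \<phi> y ^ k / of_nat k)" for y
  have psi: "smooth \<psi>" "\<psi> x = 0"
    unfolding \<psi>_def using phi(2)
    by (auto intro!: smooth_sum smooth_linear[OF bounded_linear_divide] smooth_power phi(1) simp: power_0_left)
  have "norm (L (\<lambda>y. exp (\<psi> y)) (u x)) = 1" using assms(1) by (intro norm_L_exp psi) auto
  moreover have "L (\<lambda>y. weierstrass_factor K (1 * \<phi> y)) (u x) = L (\<lambda>y. 1 - \<phi> y) (u x) * L (\<lambda>y. exp (\<psi> y)) (u x)"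
    using L_mult[OF smooth_diff[OF smooth_const phi(1)] smooth_exp[OF psi(1)], of 1]
    by (simp add: weierstrass_factor_def \<psi>_def fun_eq_iff)
  ultimately have 1: "norm (L (\<lambda>y. 1 - \<phi> y) (u x)) = 1" using K(2) by (metis mult.right_neutral norm_mult norm_one)
  have "L f (u x) = L (\<lambda>y. f x * (1 - \<phi> y)) (u x)" using assms(3) by (simp add: \<phi>_def mult.assoc[symmetric])
  also have "\<dots> = L (\<lambda>_. f x) (u x) * L (\<lambda>y. 1 - \<phi> y) (u x)"
    by (subst L_mult) (auto intro!: smooth_diff phi)
  finally show ?thesis using 1 norm_L_const[of x "f x"] assms by (simp add: norm_mult)
qed

lemma cont_pw: "continuous_on UNIV pw"
  unfolding pw_def using L_nonzero[OF smooth_const]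
  by (intro continuous_intros cont_Lu smooth_const) (auto simp: log_def)

lemma pw_nonneg_generic:
  assumes "x \<notin> bad_const" shows "pw x \<ge> 0"
proof (rule ccontr)
  assume "\<not> 0 \<le> pw x"
  then have p: "pw x < 0" by simp
  obtain \<epsilon> K where eK: "\<epsilon> > 0" "\<And>c. c \<noteq> 0 \<Longrightarrow> norm c \<le> \<epsilon> \<Longrightarrow> norm (L (\<lambda>_. c) (u x)) \<le> K"
    using assms(1) unfolding bad_const_def by (force simp: not_less)
  \<comment> \<open>For negative \<open>pw x\<close> the second bound forces
    \<open>t powr pw x\<close> to be at least \<open>|K| + 1\<close>, above the bound valid near
    0.\<close>
  define t where "t = min \<epsilon> ((\<bar>K\<bar> + 1) powr (1 / pw x))"
  have t: "t > 0" "t \<le> \<epsilon>" "t \<le> (\<bar>K\<bar> + 1) powr (1 / pw x)" using eK by (auto simp: t_def)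
  have "((\<bar>K\<bar> + 1) powr (1 / pw x)) powr pw x \<le> t powr pw x"
    using p t by (intro powr_mono2') auto
  then have "\<bar>K\<bar> + 1 \<le> t powr pw x" using p by (simp add: powr_powr)
  moreover have "norm (L (\<lambda>_. of_real t) (u x)) = t powr pw x"
    using norm_L_const[OF assms, of "of_real t"] t by simp
  moreover have "norm (L (\<lambda>_. of_real t) (u x)) \<le> K" using t by (intro eK(2)) auto
  ultimately show False by simp
qed

lemma pw_nonneg: "pw x \<ge> 0"
proof -
  obtain X where X: "\<And>k. X k \<notin> bad_const" "X \<longlonglongrightarrow> x" using discrete_set_seq[OF discrete_bad_const] by blast
  have "(\<lambda>k. pw (X k)) \<longlonglongrightarrow> pw x" by (rule continuous_on_tendsto_compose[OF cont_pw X(2)]) auto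
  then show ?thesis using pw_nonneg_generic[OF X(1)] by (intro LIMSEQ_le_const) auto
qed

text \<open>Follow the modulus of the constant 1/2 through \<open>L\<close> and then
  \<open>M\<close> at points good for both maps; continuity covers the remaining discrete
  set.\<close>

lemma pw_inverse: "pw x * mult_iso.pw M v (u x) = 1"
proof -
  interpret inv: mult_iso M L v u by (rule swap)
  let ?B = "(bad_const \<union> bad_exp \<union> bad_order) \<union> u -` (inv.bad_const \<union> inv.bad_exp \<union> inv.bad_order)"
  show ?thesis
  proof (rule discrete_set_eqI[where f = "\<lambda>x. pw x * inv.pw (u x)" and g = "\<lambda>x. 1" and B = ?B])
    show "discrete_set ?B"
      by (intro discrete_set_Un discrete_vimage_u discrete_bad_const discrete_bad_exp discrete_bad_order
        inv.discrete_bad_const inv.discrete_bad_exp inv.discrete_bad_order)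
    show "continuous_on UNIV (\<lambda>x. pw x * inv.pw (u x))"
      by (intro continuous_intros cont_pw continuous_on_compose2[OF inv.cont_pw cont_u]) auto
    fix x assume x: "x \<notin> ?B"
    have "norm (M (L (\<lambda>_. 1/2)) (v (u x))) = norm (L (\<lambda>_. 1/2) (u x)) powr inv.pw (u x)"
      using x L_nonzero[OF smooth_const] by (intro inv.norm_L_generic L_smooth smooth_const) auto
    moreover have "norm (L (\<lambda>_. 1/2) (u x)) = (1/2) powr pw x"
      using x by (subst norm_L_generic) auto
    ultimately have "1/2 = (1/2::real) powr (pw x * inv.pw (u x))"
      by (simp add: M_L powr_powr norm_divide)
    then have "ln (1/2) = pw x * inv.pw (u x) * ln (1/2::real)" by (metis ln_powr)
    then show "pw x * inv.pw (u x) = 1" by simp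
  qed simp
qed

lemma pw_pos: "pw x > 0"
  using pw_nonneg[of x] pw_inverse[of x] by (cases "pw x = 0") auto

text \<open>Both sides are continuous, so the discrete exceptional set disappears; at zeros of
  \<open>f\<close> continuity of the right side rests on \<open>pw_pos\<close>.\<close>

lemma norm_L_pw: assumes "smooth f" shows "norm (L f (u x)) = norm (f x) powr pw x"
proof (rule discrete_set_eqI[where f = "\<lambda>x. norm (L f (u x))" and g = "\<lambda>x. norm (f x) powr pw x" and B = "bad_const \<union> bad_exp \<union> bad_order"])
  show "continuous_on UNIV (\<lambda>x. norm (f x) powr pw x)"
    using pw_pos by (intro continuous_on_powr' continuous_intros cont_pw smooth_continuous assms) auto
  show "norm (L f (u x)) = norm (f x) powr pw x" if "x \<notin> bad_const \<union> bad_exp \<union> bad_order" for x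
    using norm_L_generic[OF that assms] L_zero[OF assms, of x] by (cases "f x = 0") auto
qed (intro discrete_set_Un discrete_bad_const discrete_bad_exp discrete_bad_order continuous_intros cont_Lu assms)+

lemma smooth_coord: "smooth (\<lambda>z::real^'n. complex_of_real (z $ i))"
  by (intro smooth_of_real smooth_nth)

text \<open>The modulus of \<open>L f\<close> is \<open>v z $ i - x0 $ i + 1\<close> to the power
  \<open>pw (v z)\<close>, and this exponent is a logarithm of the modulus of the image of 1/2.
  Solving for \<open>v z $ i\<close> expresses it through differentiable functions of
  \<open>z\<close>. The shift by 1 keeps \<open>f\<close> away from 0 near
  \<open>x0\<close>.\<close>

lemma v_nth_differentiable: "(\<lambda>z. v z $ i) differentiable (at y)"
proof -
  define x0 where "x0 = v y"
  define f :: "real^'n \<Rightarrow> complex" where "f z = of_real (z $ i) - of_real (x0 $ i - 1)" for z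
  have f: "smooth f" unfolding f_def by (intro smooth_diff smooth_const smooth_coord)
  have nf: "norm (L f z) = norm (f (v z)) powr pw (v z)" for z
    using norm_L_pw[OF f, of "v z"] by (simp add: uv)
  have fv: "f (v z) = of_real (v z $ i - x0 $ i + 1)" for z by (simp add: f_def)
  have "L f y \<noteq> 0" using L_nonzero[OF f, of x0] by (simp add: x0_def uv f_def)
  have h: "L (\<lambda>_. 1/2) y \<noteq> 0" using L_nonzero[OF smooth_const, of "1/2" "v y"] by (simp add: uv)
  define A where "A z = ln (norm (L f z))" for z
  define B where "B z = ln (norm (L (\<lambda>_. 1/2) z))" for z
  have AB: "A differentiable (at y)" "B differentiable (at y)"
    unfolding A_def B_def by (intro ln_norm_differentiable L_smooth f smooth_const \<open>L f y \<noteq> 0\<close> h)+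
  have pwB: "pw (v z) = - B z / ln 2" for z by (simp add: pw_def B_def log_def uv)
  have "B y \<noteq> 0" using pw_pos[of "v y"] pwB[of y] by auto
  have "open {z. v z $ i - x0 $ i + 1 > 0}"
    by (intro open_Collect_less continuous_intros cont_v)
  then have "\<forall>\<^sub>F z in nhds y. z \<in> {z. v z $ i - x0 $ i + 1 > 0}"
    by (rule eventually_nhds_in_open) (simp add: x0_def)
  then have ev: "\<forall>\<^sub>F z in nhds y. v z $ i = x0 $ i - 1 + exp (A z / (- B z / ln 2))"
  proof eventually_elim
    case (elim z)
    then have pos: "v z $ i - x0 $ i + 1 > 0" by simp
    have "A z = pw (v z) * ln (v z $ i - x0 $ i + 1)"
      using pos unfolding A_def nf fv norm_of_real by (simp add: ln_powr)
    then have "A z / pw (v z) = ln (v z $ i - x0 $ i + 1)" using pw_pos[of "v z"] by simp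
    then show ?case using pos unfolding pwB[symmetric] by simp
  qed
  have "(\<lambda>z. A z / (- B z / ln 2)) differentiable (at y)"
    using AB \<open>B y \<noteq> 0\<close> by (intro differentiable_divide differentiable_minus differentiable_const) auto
  then obtain E where E: "((\<lambda>z. A z / (- B z / ln 2)) has_derivative E) (at y)"
    unfolding differentiable_def by blast
  have "((\<lambda>z. exp (A z / (- B z / ln 2))) has_derivative (\<lambda>h. E h * exp (A y / (- B y / ln 2)))) (at y)"
    by (rule has_derivative_exp[OF E, THEN has_derivative_eq_rhs]) (simp add: fun_eq_iff)
  from has_derivative_add[OF has_derivative_const this]
  obtain D where "((\<lambda>z. x0 $ i - 1 + exp (A z / (- B z / ln 2))) has_derivative D) (at y)"
    by blast
  then have "((\<lambda>z. v z $ i) has_derivative D) (at y)"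
  proof (rule has_derivative_transform_eventually)
    show "\<forall>\<^sub>F z in at y. x0 $ i - 1 + exp (A z / (- B z / ln 2)) = v z $ i"
      unfolding eventually_at_filter using ev by (rule eventually_mono) simp
    show "x0 $ i - 1 + exp (A y / (- B y / ln 2)) = v y $ i"
      using eventually_nhds_x_imp_x[OF ev] by simp
  qed simp
  then show ?thesis by (auto simp: differentiable_def)
qed

lemma v_differentiable: "v differentiable (at y)"
proof -
  have "\<exists>D. ((\<lambda>z. v z $ i) has_derivative D) (at y)" for i
    using v_nth_differentiable by (simp add: differentiable_def)
  then obtain D where D: "\<And>i. ((\<lambda>z. v z $ i) has_derivative D i) (at y)" by metis
  have 1: "((\<lambda>z. \<Sum>i\<in>UNIV. v z $ i *\<^sub>R (axis i 1 :: real^'n)) has_derivative (\<lambda>h. \<Sum>i\<in>UNIV. D i h *\<^sub>R axis i 1)) (at y)"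
    by (intro has_derivative_sum has_derivative_scaleR_left D)
  have "(\<Sum>i\<in>UNIV. v z $ i *\<^sub>R axis i 1) = v z" for z
    using basis_expansion[of "v z"] by (simp add: scalar_mult_eq_scaleR)
  with 1 have "((\<lambda>z. v z) has_derivative (\<lambda>h. \<Sum>i\<in>UNIV. D i h *\<^sub>R axis i 1)) (at y)" by simp
  then show ?thesis unfolding differentiable_def by blast
qed

lemma u_differentiable: "u differentiable (at x)"
  using mult_iso.v_differentiable[OF swap] .

text \<open>A coordinate vanishing at \<open>x\<close> equals \<open>t\<close> along its axis, so
  its image has modulus \<open>t powr pw\<close>; since \<open>L f\<close> and \<open>u\<close> are
  differentiable, that modulus is also \<open>O(t)\<close>. In the limit the exponent cannot stay
  below 1.\<close>

lemma pw_ge_1: "pw x \<ge> 1"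
proof -
  fix i :: 'n
  define f :: "real^'n \<Rightarrow> complex" where "f z = of_real (z $ i) - of_real (x $ i)" for z
  have f: "smooth f" unfolding f_def by (intro smooth_diff smooth_const smooth_coord)
  obtain C1 d1 where 1: "C1 > 0" "d1 > 0" "\<And>y. dist y (u x) < d1 \<Longrightarrow> norm (L f y - L f (u x)) \<le> C1 * norm (y - u x)"
    using differentiable_local_bound[OF smooth_differentiable[OF L_smooth[OF f]], of "u x"] by blast
  obtain C2 d2 where 2: "C2 > 0" "d2 > 0" "\<And>z. dist z x < d2 \<Longrightarrow> norm (u z - u x) \<le> C2 * norm (z - x)"
    using differentiable_local_bound[OF u_differentiable, of x] by blast
  have "isCont u x" using cont_u by (simp add: continuous_on_eq_continuous_at)
  then obtain d3 where 3: "d3 > 0" "\<And>z. dist z x < d3 \<Longrightarrow> dist (u z) (u x) < d1"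
    using 1(2) unfolding continuous_at_eps_delta by blast
  let ?z = "\<lambda>t. x + t *\<^sub>R axis i 1"
  have ev: "\<forall>\<^sub>F t in at_right 0. pw (?z t) \<ge> 1 + ln (C1 * C2) / ln t"
    unfolding eventually_at_right_field
  proof (intro exI[of _ "min 1 (min d2 d3)"] conjI allI impI)
    fix t :: real assume t: "0 < t" "t < min 1 (min d2 d3)"
    have d: "dist (?z t) x = t" using t by (simp add: dist_norm)
    have "f (?z t) = of_real t" by (simp add: f_def)
    then have "t powr pw (?z t) = norm (L f (u (?z t)))" using norm_L_pw[OF f, of "?z t"] t by simp
    also have "\<dots> = norm (L f (u (?z t)) - L f (u x))" using L_zero[OF f, of x] by (simp add: f_def)
    also have "\<dots> \<le> C1 * norm (u (?z t) - u x)" using 3(2)[of "?z t"] d t by (intro 1(3)) auto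
    also have "\<dots> \<le> C1 * (C2 * norm (?z t - x))" using 2(3)[of "?z t"] d t 1(1) by (intro mult_left_mono) auto
    also have "norm (?z t - x) = t" using d by (simp add: dist_norm)
    finally have "t powr pw (?z t) \<le> C1 * C2 * t" by (simp add: mult.assoc)
    then have "ln (t powr pw (?z t)) \<le> ln (C1 * C2 * t)" using t 1(1) 2(1) by (intro ln_mono) auto
    then have "pw (?z t) * ln t \<le> ln (C1 * C2) + ln t" using t 1(1) 2(1) by (simp add: ln_powr ln_mult)
    moreover have "ln t < 0" using t by simp
    ultimately show "1 + ln (C1 * C2) / ln t \<le> pw (?z t)" by (simp add: field_simps)
  qed (use 2 3 in auto)
  have "(?z \<longlongrightarrow> ?z 0) (at_right 0)" by (intro tendsto_intros)
  then have "((\<lambda>t. pw (?z t)) \<longlongrightarrow> pw (?z 0)) (at_right 0)"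
    by (rule continuous_on_tendsto_compose[OF cont_pw]) auto
  moreover have "((\<lambda>t. 1 + ln (C1 * C2) / ln t) \<longlongrightarrow> 1) (at_right 0)" by real_asymp
  ultimately show ?thesis using tendsto_le[OF trivial_limit_at_right_real _ _ ev] by simp
qed

lemma pw_eq_1: "pw x = 1"
proof -
  have "pw x \<ge> 1" by (rule pw_ge_1)
  moreover have "mult_iso.pw M v (u x) \<ge> 1" by (rule mult_iso.pw_ge_1[OF swap])
  moreover have "pw x * mult_iso.pw M v (u x) = 1" by (rule pw_inverse)
  ultimately show ?thesis
    by (metis mult_le_cancel_left1 mult.right_neutral dual_order.antisym mult_left_mono order_trans zero_le_one)
qed

theorem norm_L: "smooth f \<Longrightarrow> norm (L f (u x)) = norm (f x)"
  using norm_L_pw[of f x] by (simp add: pw_eq_1)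

section \<open>Regularity of \<open>L\<close> in a parameter\<close>

text \<open>Continuity in the parameter \<open>s\<close> at a fixed point, which smoothness of each
  single image does not give.\<close>

definition bad_cont :: "(real^'n) set" where
  "bad_cont = {x. \<exists>\<psi>. smooth \<psi> \<and> \<not> ((\<lambda>s. L (\<lambda>y. 1 + of_real s * \<psi> y) (u x)) \<longlongrightarrow> 1) (at_right 0)}"

text \<open>By \<open>pow2_close\<close> a deviation \<open>\<eta>\<close> becomes visible after at
  most \<open>I\<close> squarings, with \<open>I\<close> depending on \<open>\<eta>\<close> only. So
  just finitely many functions \<open>h i\<close> occur in \<open>w ^ (2 ^ i) - 1 = s * h i\<close>;
  their derivatives are bounded uniformly in \<open>s\<close>, and a small \<open>s\<close> makes
  the piece small.\<close>

lemma discrete_bad_cont: "discrete_set bad_cont"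
proof (rule discrete_far_from_1)
  fix x k and r :: real assume x: "x \<in> bad_cont" and r: "0 < r" "r < 1"
  obtain \<psi> where psi: "smooth \<psi>" "\<not> ((\<lambda>s. L (\<lambda>y. 1 + of_real s * \<psi> y) (u x)) \<longlongrightarrow> 1) (at_right 0)"
    using x unfolding bad_cont_def by blast
  define w where "w s y = 1 + of_real s * \<psi> y" for s :: real and y
  have smw: "smooth (w s)" for s unfolding w_def by (intro smooth_add smooth_const smooth_mult psi)
  obtain \<eta> where eta: "\<eta> > 0" "\<not> (\<forall>\<^sub>F s in at_right 0. dist (L (w s) (u x)) 1 < \<eta>)"
  proof -
    have "\<not> ((\<lambda>s. L (w s) (u x)) \<longlongrightarrow> 1) (at_right 0)" using psi(2) unfolding w_def[abs_def] .
    then show ?thesis using that unfolding tendsto_iff by blast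
  qed
  obtain I where I: "(2/3)^I / 2 < \<eta>"
  proof -
    have "(\<lambda>I. (2/3::real)^I / 2) \<longlonglongrightarrow> 0 / 2" by (intro tendsto_intros LIMSEQ_realpow_zero) auto
    then have "\<forall>\<^sub>F I in sequentially. (2/3)^I / 2 < \<eta>" by (rule order_tendstoD) (use eta in simp)
    then show ?thesis using that by (auto simp: eventually_sequentially)
  qed
  define h where "h i s y = bump x r y * (\<psi> y * (\<Sum>j<2^i. w s y ^ j))" for i :: nat and s :: real and y
  have smh: "smooth (h i s)" for i s
    unfolding h_def by (intro smooth_mult smooth_bump psi smooth_sum smooth_power smw)
  let ?I = "{0<..<1::real}"
  have famw: "fam ?I (\<lambda>_. r) x 0 k w"
  proof -
    have "fam ?I (\<lambda>_. r) x (0 + 0) k (\<lambda>s y. s *\<^sub>R \<psi> y)"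
      by (rule fam_scaleR[where D = 1], simp, use r in simp, rule fam_const_smooth) (use r psi in auto)
    then have "fam ?I (\<lambda>_. r) x 0 k (\<lambda>s y. 1 + s *\<^sub>R \<psi> y)"
      by (intro fam_add fam_const_smooth smooth_const) (use r in auto)
    then show ?thesis by (simp add: w_def[abs_def] scaleR_conv_of_real)
  qed
  have fams: "fam ?I (\<lambda>_. r) x 0 k (\<lambda>s y. \<Sum>j<n. w s y ^ j)" for n
  proof (induction n)
    case 0
    show ?case using fam_const_smooth[of ?I "\<lambda>_. r" "\<lambda>_. 0::complex" x k] r by simp
  next
    case (Suc n)
    have "fam ?I (\<lambda>_. r) x (n * 0) k (\<lambda>s y. w s y ^ n)" by (rule fam_power[OF _ famw]) (use r in auto)
    then show ?case using fam_add[OF Suc] by simp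
  qed
  have "fam ?I (\<lambda>_. r) x (0 + (0 + 0)) k (h i)" for i
    unfolding h_def by (intro fam_mult fam_const_smooth smooth_bump psi fams) (use r in auto)
  from fam_support_bound[OF this smh] have "\<exists>C\<ge>0. \<forall>js::'n list. length js \<le> k \<longrightarrow> (\<forall>s\<in>?I. \<forall>y. r ^ k * norm (iter_pderiv js (h i s) y) \<le> C * r ^ (0 + (0 + 0)))" for i
    using r bump_0[OF r(1), of x] by (auto simp: h_def)
  then obtain C where C: "\<And>i. C i \<ge> 0" "\<And>i js s y. length (js::'n list) \<le> k \<Longrightarrow> s \<in> ?I \<Longrightarrow> r ^ k * norm (iter_pderiv js (h i s) y) \<le> C i"
    by (simp only: power_0 add_0 mult_1_right) metis
  define D where "D = (\<Sum>i\<le>I. C i) / r ^ k"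
  have D0: "D \<ge> 0" unfolding D_def using r C(1) by (intro divide_nonneg_nonneg sum_nonneg) auto
  have D: "norm (iter_pderiv js (h i s) y) \<le> D" if "length js \<le> k" "s \<in> ?I" "i \<le> I" for js i s y
  proof -
    have "C i \<le> (\<Sum>i\<le>I. C i)" using member_le_sum[of i "{..I}" C] C(1) that by auto
    then show ?thesis using C(2)[OF that(1,2), of i y] r by (simp add: D_def field_simps)
  qed
  define \<delta> where "\<delta> = min 1 ((1/2)^k / (D + 1))"
  have "\<delta> > 0" using D0 by (simp add: \<delta>_def)
  then obtain s where s: "0 < s" "s < \<delta>" "dist (L (w s) (u x)) 1 \<ge> \<eta>"
    using eta(2) unfolding eventually_at_right_field by (metis not_less)
  have "\<exists>i\<le>I. norm (L (w s) (u x) ^ (2 ^ i) - 1) > 1/2"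
  proof (rule ccontr)
    assume "\<not> ?thesis"
    then have "norm (L (w s) (u x) - 1) \<le> (2/3)^I / 2" by (intro pow2_close) (auto simp: not_less)
    then show False using s(3) I by (simp add: dist_norm)
  qed
  then obtain i where i: "i \<le> I" "norm (L (w s) (u x) ^ (2 ^ i) - 1) > 1/2" by blast
  let ?f = "\<lambda>y. of_real s * h i s y"
  have s1: "s \<in> ?I" using s by (auto simp: \<delta>_def)
  have "small k ?f"
    unfolding small_def
  proof (intro allI impI)
    fix js :: "'n list" and y assume js: "length js \<le> k"
    have "norm (iter_pderiv js ?f y) = s * norm (iter_pderiv js (h i s) y)"
      using s(1) by (simp add: iter_pderiv_linear[OF bounded_linear_mult_right smh] norm_mult)
    also have "\<dots> \<le> (1/2)^k / (D + 1) * D"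
      using D[OF js s1 i(1)] s D0 by (intro mult_mono) (auto simp: \<delta>_def)
    also have "\<dots> \<le> (1/2)^k" using D0 by (intro eps_bound) auto
    finally show "norm (iter_pderiv js ?f y) \<le> (1/2)^k" .
  qed
  moreover have "norm (L (\<lambda>y. 1 + ?f y) (u x) - 1) > 1/2"
  proof -
    have *: "1 + of_real s * h i s z = w s z ^ (2 ^ i)" if "bump x r z = 1" for z
    proof -
      have "w s z ^ (2 ^ i) - 1 = (w s z - 1) * (\<Sum>j<2^i. w s z ^ j)" by (rule power_diff_1_eq)
      then show ?thesis using that by (simp add: h_def w_def algebra_simps)
    qed
    have "L (\<lambda>y. 1 + ?f y) (u x) = L (\<lambda>y. w s y ^ (2 ^ i)) (u x)"
      by (rule L_local) (use bump_1_ev[OF r(1), of x] * in \<open>auto intro!: smooth_add smooth_mult smh smooth_power smw elim!: eventually_mono\<close>)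
    then show ?thesis using i(2) by (simp add: L_power[OF smw])
  qed
  moreover have "\<forall>y. r \<le> dist x y \<longrightarrow> ?f y = 0" using bump_outside[OF r(1), of x] by (auto simp: h_def)
  ultimately show "\<exists>f. smooth f \<and> (\<forall>y. r \<le> dist x y \<longrightarrow> f y = 0) \<and> small k f \<and> norm (L (\<lambda>y. 1 + f y) (u x) - 1) > 1/2"
    by (intro exI[of _ ?f]) (auto intro!: smooth_mult smh)
qed

text \<open>Failure of a second-order bound at \<open>u x\<close> that is uniform in small
  \<open>s\<close>. The scale \<open>c\<close> is quantified because \<open>g\<close> has to be
  shrunk before its cutoff is small of order \<open>k\<close>; a good point accordingly offers some
  \<open>c > 0\<close>.\<close>

definition bad_taylor :: "(real^'n) set" where
  "bad_taylor = {x. \<exists>g \<omega> i. smooth g \<and> (\<forall>c>0. \<forall>K. \<forall>\<delta>>0. \<exists>s t. 0 < s \<and> s < \<delta> \<and> \<bar>t\<bar> < \<delta> \<and>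
     norm (L (\<lambda>y. of_real c * g y + of_real s * \<omega>) (u x + t *\<^sub>R axis i 1) - L (\<lambda>y. of_real c * g y + of_real s * \<omega>) (u x)
       - t *\<^sub>R partial_deriv i (L (\<lambda>y. of_real c * g y + of_real s * \<omega>)) (u x)) > K * t\<^sup>2)}"

lemma discrete_bad_taylor: "discrete_set bad_taylor"
  unfolding discrete_set_def
proof (intro allI notI)
  fix x0 assume lim: "x0 islimpt bad_taylor"
  \<comment> \<open>The displaced point has to come from the region where the glued function agrees
    with the piece, so that its value transfers as well.\<close>
  define Q where "Q k x r f \<longleftrightarrow> (\<exists>i t. \<bar>t\<bar> < 1 \<and> v (u x + t *\<^sub>R axis i 1) \<in> ball x r \<and>
     norm (L f (u x + t *\<^sub>R axis i 1) - L f (u x) - t *\<^sub>R partial_deriv i (L f) (u x)) > real k * t\<^sup>2)" for k :: nat and x r f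
  have "\<exists>f. smooth f \<and> (\<forall>y. r \<le> dist x y \<longrightarrow> f y = 0) \<and> small k f \<and> Q k x (r/2) f"
    if x: "x \<in> bad_taylor" and r: "0 < r" "r < 1" for x k r
  proof -
    obtain g \<omega> i where g: "smooth g" and bad: "\<And>c K \<delta>. c > 0 \<Longrightarrow> \<delta> > 0 \<Longrightarrow> \<exists>s t. 0 < s \<and> s < \<delta> \<and> \<bar>t\<bar> < \<delta> \<and>
     norm (L (\<lambda>y. of_real c * g y + of_real s * \<omega>) (u x + t *\<^sub>R axis i 1) - L (\<lambda>y. of_real c * g y + of_real s * \<omega>) (u x)
       - t *\<^sub>R partial_deriv i (L (\<lambda>y. of_real c * g y + of_real s * \<omega>)) (u x)) > K * t\<^sup>2"
      using x unfolding bad_taylor_def by blast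
    define h1 where "h1 y = bump x r y * g y" for y
    define h2 where "h2 y = bump x r y * \<omega>" for y
    have smh: "smooth h1" "smooth h2" unfolding h1_def h2_def by (intro smooth_mult smooth_bump g smooth_const)+
    obtain C1 where C1: "C1 \<ge> 0" "\<And>js y. length js \<le> k \<Longrightarrow> norm (iter_pderiv js h1 y) \<le> C1"
    proof -
      have "\<And>y. r \<le> dist x y \<Longrightarrow> h1 y = 0" using bump_outside[OF r(1)] by (auto simp: h1_def)
      from compact_support_bound[OF smh(1) this, where k = k] show ?thesis using that by blast
    qed
    obtain C2 where C2: "C2 \<ge> 0" "\<And>js y. length js \<le> k \<Longrightarrow> norm (iter_pderiv js h2 y) \<le> C2"
    proof -
      have "\<And>y. r \<le> dist x y \<Longrightarrow> h2 y = 0" using bump_outside[OF r(1)] by (auto simp: h2_def)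
      from compact_support_bound[OF smh(2) this, where k = k] show ?thesis using that by blast
    qed
    define c where "c = (1/2)^k / 2 / (C1 + 1)"
    have c: "c > 0" "c * C1 \<le> (1/2)^k / 2" unfolding c_def using C1(1) by (simp, intro eps_bound) auto
    have "isCont (\<lambda>y. v y) (u x)" using cont_v by (simp add: continuous_on_eq_continuous_at)
    then obtain \<delta>1 where d1: "\<delta>1 > 0" "\<And>y. dist y (u x) < \<delta>1 \<Longrightarrow> dist (v y) (v (u x)) < r/2"
      using r unfolding continuous_at_eps_delta by (meson half_gt_zero)
    define \<delta> where "\<delta> = min 1 (min \<delta>1 ((1/2)^k / 2 / (C2 + 1)))"
    have "\<delta> > 0" using d1 C2(1) by (simp add: \<delta>_def)
    from bad[OF c(1) this] obtain s t where st: "0 < s" "s < \<delta>" "\<bar>t\<bar> < \<delta>" and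
      far: "norm (L (\<lambda>y. of_real c * g y + of_real s * \<omega>) (u x + t *\<^sub>R axis i 1) - L (\<lambda>y. of_real c * g y + of_real s * \<omega>) (u x)
       - t *\<^sub>R partial_deriv i (L (\<lambda>y. of_real c * g y + of_real s * \<omega>)) (u x)) > real k * t\<^sup>2" by blast
    define G where "G y = of_real c * g y + of_real s * \<omega>" for y
    have smG: "smooth G" unfolding G_def by (intro smooth_add smooth_mult smooth_const g)
    define f where "f y = of_real c * h1 y + of_real s * h2 y" for y
    have smf: "smooth f" unfolding f_def by (intro smooth_add smooth_mult smooth_const smh)
    have "small k f"
      unfolding small_def
    proof (intro allI impI)
      fix js :: "'n list" and y assume js: "length js \<le> k"
      have "iter_pderiv js f y = of_real c * iter_pderiv js h1 y + of_real s * iter_pderiv js h2 y"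
        unfolding f_def
        by (subst iter_pderiv_add) (auto intro!: smooth_mult smh simp: iter_pderiv_linear[OF bounded_linear_mult_right smh(1)] iter_pderiv_linear[OF bounded_linear_mult_right smh(2)])
      then have "norm (iter_pderiv js f y) \<le> c * norm (iter_pderiv js h1 y) + s * norm (iter_pderiv js h2 y)"
        using norm_triangle_ineq[of "of_real c * iter_pderiv js h1 y" "of_real s * iter_pderiv js h2 y"] c(1) st(1)
        by (simp add: norm_mult)
      also have "\<dots> \<le> c * C1 + (1/2)^k / 2 / (C2 + 1) * C2"
        using C1(2)[OF js, of y] C2 C2(2)[OF js, of y] c(1) st by (intro add_mono mult_mono) (auto simp: \<delta>_def)
      also have "(1/2)^k / 2 / (C2 + 1) * C2 \<le> (1/2)^k / 2" by (rule eps_bound) (use C2(1) in auto)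
      finally show "norm (iter_pderiv js f y) \<le> (1/2)^k" using c(2) by simp
    qed
    moreover have "L f z = L G z" if "v z \<in> ball x (r/2)" for z
    proof -
      have "L f (u (v z)) = L G (u (v z))"
        by (rule L_local[OF smf smG], rule eventually_mono[OF eventually_nhds_in_open[OF open_ball that]])
          (auto simp: f_def G_def h1_def h2_def bump_1[OF r(1)])
      then show ?thesis by (simp add: uv)
    qed note LfG = this
    have vb: "v (u x + t *\<^sub>R axis i 1) \<in> ball x (r/2)"
      using d1(2)[of "u x + t *\<^sub>R axis i 1"] st(3) by (simp add: dist_norm \<delta>_def vu norm_minus_commute)
    have "\<forall>\<^sub>F z in nhds (u x). L f z = L G z"
    proof -
      have "open (v -` ball x (r/2))" by (rule open_vimage[OF open_ball cont_v])
      from eventually_nhds_in_open[OF this, of "u x"] have "\<forall>\<^sub>F z in nhds (u x). z \<in> v -` ball x (r/2)"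
        using r by (simp add: vu)
      then show ?thesis by (rule eventually_mono) (use LfG in auto)
    qed
    then have "partial_deriv i (L f) (u x) = partial_deriv i (L G) (u x)" by (rule partial_deriv_cong_ev)
    then have "Q k x (r/2) f"
      unfolding Q_def using far vb LfG[OF vb] LfG[of "u x"] st(3) r
      by (intro exI[of _ i] exI[of _ t]) (simp add: vu G_def[abs_def] \<delta>_def)
    moreover have "\<forall>y. r \<le> dist x y \<longrightarrow> f y = 0" using bump_outside[OF r(1), of x] by (auto simp: f_def h1_def h2_def)
    ultimately show ?thesis using smf by blast
  qed
  then have "\<And>x k r. x \<in> bad_taylor \<Longrightarrow> 0 < r \<Longrightarrow> r < 1 \<Longrightarrow> \<exists>f. smooth f \<and> (\<forall>y. r \<le> dist x y \<longrightarrow> f y = 0) \<and> small k f \<and> Q k x (r/2) f" .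
  from glue_bumps[OF lim, where Q = "\<lambda>k x r. Q k x (r/2)", OF this]
  obtain F X where F: "smooth F" "X \<longlonglongrightarrow> x0"
    and ex: "\<And>k. \<exists>f r. r > 0 \<and> smooth f \<and> (\<forall>y\<in>ball (X k) r. F y = f y) \<and> Q k (X k) (r/2) f"
    by blast
  obtain C where C: "C \<ge> 0" "\<And>y t i. y \<in> ball (u x0) 1 \<Longrightarrow> \<bar>t\<bar> < 1 \<Longrightarrow>
    norm (L F (y + t *\<^sub>R axis i 1) - L F y - t *\<^sub>R partial_deriv i (L F) y) \<le> C * t\<^sup>2"
    using smooth_taylor2[OF L_smooth[OF F(1)], of "u x0"] by blast
  have "(\<lambda>k. u (X k)) \<longlonglongrightarrow> u x0" by (rule continuous_on_tendsto_compose[OF cont_u F(2)]) auto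
  then have "\<forall>\<^sub>F k in sequentially. u (X k) \<in> ball (u x0) 1" by (rule topological_tendstoD) auto
  then obtain k0 where k0: "\<And>k. k \<ge> k0 \<Longrightarrow> u (X k) \<in> ball (u x0) 1" by (auto simp: eventually_sequentially)
  obtain k1 :: nat where k1: "C < real k1" using reals_Archimedean2 by blast
  define k where "k = max k0 k1"
  obtain f r where f: "r > 0" "smooth f" "\<forall>y\<in>ball (X k) r. F y = f y" "Q k (X k) (r/2) f" using ex[of k] by blast
  obtain i t where it: "\<bar>t\<bar> < 1" "v (u (X k) + t *\<^sub>R axis i 1) \<in> ball (X k) (r/2)"
     "norm (L f (u (X k) + t *\<^sub>R axis i 1) - L f (u (X k)) - t *\<^sub>R partial_deriv i (L f) (u (X k))) > real k * t\<^sup>2"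
    using f(4) unfolding Q_def by blast
  have LfF: "L F z = L f z" if "v z \<in> ball (X k) r" for z
  proof -
    have "L F (u (v z)) = L f (u (v z))"
      by (rule L_local[OF F(1) f(2)], rule eventually_mono[OF eventually_nhds_in_open[OF open_ball that]]) (use f in auto)
    then show ?thesis by (simp add: uv)
  qed
  have "\<forall>\<^sub>F z in nhds (u (X k)). L F z = L f z"
  proof -
    have "open (v -` ball (X k) r)" by (rule open_vimage[OF open_ball cont_v])
    from eventually_nhds_in_open[OF this, of "u (X k)"] have "\<forall>\<^sub>F z in nhds (u (X k)). z \<in> v -` ball (X k) r"
      using f(1) by (simp add: vu)
    then show ?thesis by (rule eventually_mono) (use LfF in auto)
  qed
  then have "partial_deriv i (L F) (u (X k)) = partial_deriv i (L f) (u (X k))" by (rule partial_deriv_cong_ev)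
  moreover have "L F (u (X k) + t *\<^sub>R axis i 1) = L f (u (X k) + t *\<^sub>R axis i 1)" using it(2) f(1) by (intro LfF) auto
  moreover have "L F (u (X k)) = L f (u (X k))" using f(1) by (intro LfF) (auto simp: vu)
  ultimately have "real k * t\<^sup>2 < C * t\<^sup>2" using it C(2)[OF k0[of k] it(1), of i] by (simp add: k_def)
  moreover have "C * t\<^sup>2 \<le> real k * t\<^sup>2" using k1 by (intro mult_right_mono) (auto simp: k_def)
  ultimately show False by simp
qed

end

section \<open>Recovering phases from limits\<close>

text \<open>If \<open>H t\<close> is the product, then in \<open>H (2 * t) / H t ^ (2 ^ K)\<close> the top character cancels; this drives the induction.\<close>
lemma hom_elimination:
  fixes h :: "nat \<Rightarrow> real \<Rightarrow> complex"
  assumes "K \<ge> 1" "\<And>j s t. h j (s + t) = h j s * h j t" "\<And>j s. norm (h j s) = 1"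
    and "((\<lambda>t. \<Prod>j=1..K. h j (t ^ j)) \<longlongrightarrow> c) at_top" "c \<noteq> 0"
  shows "h 1 s = 1"
  using assms
proof (induction K arbitrary: h c s rule: nat_induct_at_least)
  case base
  \<comment> \<open>A character with a nonzero limit at infinity is trivial: shifting by
    \<open>s\<close> multiplies the limit by \<open>h 1 s\<close>.\<close>
  have lim: "((\<lambda>t. h 1 t) \<longlongrightarrow> c) at_top" using base(3) by simp
  have "((\<lambda>t. h 1 (t + s)) \<longlongrightarrow> c) at_top"
  proof (rule filterlim_compose[OF lim])
    show "filterlim (\<lambda>t. t + s) at_top at_top"
      using filterlim_tendsto_add_at_top[OF tendsto_const[of s] filterlim_ident] by (simp add: add.commute)
  qed
  moreover have "((\<lambda>t. h 1 (t + s)) \<longlongrightarrow> c * h 1 s) at_top"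
    unfolding base(1) by (intro tendsto_intros lim)
  ultimately have "c = c * h 1 s" using tendsto_unique by (metis trivial_limit_at_top_linorder)
  then show ?case using base(4) by simp
next
  case (Suc K)
  have h0: "h j 0 = 1" for j using Suc.prems(1)[of j 0 0] Suc.prems(2)[of j 0] by (metis add_0 mult_cancel_left1 norm_zero zero_neq_one)
  have hnz: "h j t \<noteq> 0" for j t using Suc.prems(2)[of j t] by auto
  have hn: "h j (of_nat n * t) = h j t ^ n" for j n t
    by (induction n) (auto simp: h0 distrib_right Suc.prems(1))
  \<comment> \<open>Doubling \<open>t\<close> scales the j-th argument by \<open>2 ^ j\<close>, and
    dividing by the power subtracts \<open>2 ^ Suc K\<close>. The difference is nonzero at
    \<open>j = 1\<close>, so the first character survives.\<close>
  define q :: "nat \<Rightarrow> real" where "q j = 2 ^ j - 2 ^ (Suc K)" for j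
  define h' where "h' j t = h j (q j * t)" for j t
  have h'1: "h' j (s + t) = h' j s * h' j t" "norm (h' j s) = 1" for j s t
    by (simp_all add: h'_def distrib_left Suc.prems)
  have key: "h j ((2 * t) ^ j) = h' j (t ^ j) * h j (t ^ j) ^ (2 ^ Suc K)" for j t
  proof -
    have "(2 * t) ^ j = q j * t ^ j + of_nat (2 ^ Suc K) * t ^ j" by (simp add: q_def power_mult_distrib algebra_simps)
    then show ?thesis by (simp only: Suc.prems(1) hn h'_def)
  qed
  have lim2: "((\<lambda>t. \<Prod>j=1..Suc K. h j ((2 * t) ^ j)) \<longlongrightarrow> c) at_top"
    by (rule filterlim_compose[OF Suc.prems(3)]) (rule filterlim_tendsto_pos_mult_at_top[OF tendsto_const _ filterlim_ident], simp)
  have "((\<lambda>t. (\<Prod>j=1..Suc K. h j ((2 * t) ^ j)) / (\<Prod>j=1..Suc K. h j (t ^ j)) ^ (2 ^ Suc K)) \<longlongrightarrow> c / c ^ (2 ^ Suc K)) at_top"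
    by (intro tendsto_intros lim2 Suc.prems(3)) (use Suc.prems(4) in auto)
  moreover have "(\<Prod>j=1..Suc K. h j ((2 * t) ^ j)) / (\<Prod>j=1..Suc K. h j (t ^ j)) ^ (2 ^ Suc K) = (\<Prod>j=1..K. h' j (t ^ j))" for t
  proof -
    have "(\<Prod>j=1..Suc K. h j ((2 * t) ^ j)) = (\<Prod>j=1..Suc K. h' j (t ^ j)) * (\<Prod>j=1..Suc K. h j (t ^ j)) ^ (2 ^ Suc K)"
      unfolding key prod.distrib prod_power_distrib ..
    moreover have "(\<Prod>j=1..Suc K. h j (t ^ j)) \<noteq> 0" using hnz by simp
    moreover have "h' (Suc K) r = 1" for r by (simp add: h'_def q_def h0)
    ultimately show ?thesis by simp
  qed
  ultimately have "((\<lambda>t. \<Prod>j=1..K. h' j (t ^ j)) \<longlongrightarrow> c / c ^ (2 ^ Suc K)) at_top" by simp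
  then have "h' 1 t = 1" for t
    using Suc.IH[of h' "c / c ^ (2 ^ Suc K)" t] h'1 Suc.prems(4) by simp
  moreover have "q 1 \<noteq> 0"
  proof -
    have "(2::real) ^ 1 < 2 ^ Suc K" using Suc.hyps by (intro power_strict_increasing) auto
    then show ?thesis by (simp add: q_def)
  qed
  ultimately show ?case using h'_def[of 1 "s / q 1"] by simp
qed

text \<open>On the unit circle the real part determines the imaginary part up to sign, and squaring
  hides the sign once \<open>Re \<omega> * Im \<omega> = 0\<close>; hence the two values allowed for
  \<open>\<omega>\<close>.\<close>

lemma square_limit:
  fixes a :: "'a \<Rightarrow> complex"
  assumes "\<And>s. s \<in> S \<Longrightarrow> norm (a s) = 1" "\<forall>\<^sub>F s in F. s \<in> S" "((\<lambda>s. Re (a s)) \<longlongrightarrow> Re \<omega>) F" "\<omega> = 1 \<or> \<omega> = \<i>"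
  shows "((\<lambda>s. (a s)\<^sup>2) \<longlongrightarrow> \<omega>\<^sup>2) F"
proof -
  have sq: "(Im (a s))\<^sup>2 = 1 - (Re (a s))\<^sup>2" if "s \<in> S" for s
    using assms(1)[OF that] by (simp add: cmod_def)
  have "((\<lambda>s. 1 - (Re (a s))\<^sup>2) \<longlongrightarrow> 1 - (Re \<omega>)\<^sup>2) F" by (intro tendsto_intros assms)
  then have im2: "((\<lambda>s. (Im (a s))\<^sup>2) \<longlongrightarrow> 1 - (Re \<omega>)\<^sup>2) F"
    by (rule Lim_transform_eventually) (use assms(2) sq in \<open>auto elim: eventually_mono\<close>)
  have "((\<lambda>s. (Re (a s))\<^sup>2 * (Im (a s))\<^sup>2) \<longlongrightarrow> (Re \<omega>)\<^sup>2 * (1 - (Re \<omega>)\<^sup>2)) F" by (intro tendsto_intros assms im2)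
  then have "((\<lambda>s. (Re (a s) * Im (a s))\<^sup>2) \<longlongrightarrow> 0) F" using assms(4) by (auto simp: power_mult_distrib)
  then have "((\<lambda>s. sqrt ((Re (a s) * Im (a s))\<^sup>2)) \<longlongrightarrow> sqrt 0) F" by (rule tendsto_real_sqrt)
  then have ri: "((\<lambda>s. Re (a s) * Im (a s)) \<longlongrightarrow> 0) F" by (simp add: tendsto_rabs_zero_iff)
  have "((\<lambda>s. Complex ((Re (a s))\<^sup>2 - (Im (a s))\<^sup>2) (2 * (Re (a s) * Im (a s)))) \<longlongrightarrow>
      Complex ((Re \<omega>)\<^sup>2 - (1 - (Re \<omega>)\<^sup>2)) (2 * 0)) F"
    by (intro tendsto_Complex tendsto_intros assms im2 ri)
  moreover have "Complex ((Re (a s))\<^sup>2 - (Im (a s))\<^sup>2) (2 * (Re (a s) * Im (a s))) = (a s)\<^sup>2" for s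
    by (simp add: complex_eq_iff power2_eq_square)
  moreover have "Complex ((Re \<omega>)\<^sup>2 - (1 - (Re \<omega>)\<^sup>2)) (2 * 0) = \<omega>\<^sup>2"
    using assms(4) by (elim disjE) (simp_all add: complex_eq_iff power2_eq_square del: power2_i)
  ultimately show ?thesis by simp
qed

lemma parallelogram_Re: "4 * Re (a * cnj b) = (norm (a + b))\<^sup>2 - (norm (a - b))\<^sup>2" for a b :: complex
  unfolding cmod_power2 by (simp add: power2_eq_square algebra_simps)

section \<open>Slopes along coordinate lines\<close>

context mult_iso
begin

text \<open>\<open>u\<close> and \<open>v\<close> are inverse to each other and differentiable, so
  composing with \<open>v\<close> cannot annihilate a nonzero differential; some axis at
  \<open>u x\<close> detects it.\<close>

lemma coord_direction:
  assumes "smooth g" "\<And>z. Im (g z) = 0" "partial_deriv j g x \<noteq> 0"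
  shows "\<exists>i \<gamma>. \<gamma> \<noteq> 0 \<and> ((\<lambda>t. Re (g (v (u x + t *\<^sub>R axis i 1)))) has_real_derivative \<gamma>) (at 0)"
proof -
  obtain Dv where Dv: "(v has_derivative Dv) (at (u x))" using v_differentiable by (auto simp: differentiable_def)
  obtain Du where Du: "(u has_derivative Du) (at x)" using u_differentiable by (auto simp: differentiable_def)
  define Dg where "Dg h = (\<Sum>i\<in>UNIV. h $ i *\<^sub>R partial_deriv i g x)" for h
  have Dg: "(g has_derivative Dg) (at (v (u x)))" using smooth_has_derivative[OF assms(1)] by (simp add: Dg_def[abs_def] vu)
  have gv: "((\<lambda>y. g (v y)) has_derivative (\<lambda>h. Dg (Dv h))) (at (u x))"
    using diff_chain_at[OF Dv Dg] by (simp add: o_def)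
  then have line: "((\<lambda>t. g (v (u x + t *\<^sub>R axis i 1))) has_vector_derivative Dg (Dv (axis i 1))) (at 0)" for i
  proof -
    have "((\<lambda>t::real. u x + t *\<^sub>R axis i 1) has_derivative (\<lambda>t. t *\<^sub>R axis i 1)) (at 0)"
      by (auto intro!: derivative_eq_intros)
    from diff_chain_at[OF this, of "\<lambda>y. g (v y)" "\<lambda>h. Dg (Dv h)"] gv
    have "((\<lambda>t. g (v (u x + t *\<^sub>R axis i 1))) has_derivative (\<lambda>t. Dg (Dv (t *\<^sub>R axis i 1)))) (at 0)"
      by (simp add: o_def)
    moreover have "Dg (Dv (t *\<^sub>R axis i 1)) = t *\<^sub>R Dg (Dv (axis i 1))" for t :: real
      using linear_scale[OF has_derivative_linear[OF gv]] by blast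
    ultimately show ?thesis by (simp add: has_vector_derivative_def)
  qed
  have rl: "((\<lambda>t. Re (g (v (u x + t *\<^sub>R axis i 1)))) has_real_derivative Re (Dg (Dv (axis i 1)))) (at 0)" for i
    using bounded_linear.has_vector_derivative[OF bounded_linear_Re line] by (simp add: has_real_derivative_iff_has_vector_derivative)
  have "\<exists>i. Dg (Dv (axis i 1)) \<noteq> 0"
  proof (rule ccontr)
    assume "\<not> ?thesis"
    then have z: "Dg (Dv (axis i 1)) = 0" for i by blast
    have lin: "linear (\<lambda>h. Dg (Dv h))" by (rule has_derivative_linear[OF gv])
    have "Dg (Dv h) = 0" for h
    proof -
      have "Dg (Dv (\<Sum>i\<in>UNIV. h $ i *\<^sub>R axis i 1)) = (\<Sum>i\<in>UNIV. h $ i *\<^sub>R Dg (Dv (axis i 1)))"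
        using linear_sum[OF lin, of "\<lambda>i. h $ i *\<^sub>R axis i 1" UNIV] linear_scale[OF lin] by simp
      moreover have "(\<Sum>i\<in>UNIV. h $ i *\<^sub>R axis i 1) = h" using basis_expansion[of h] by (simp add: scalar_mult_eq_scaleR)
      ultimately show ?thesis using z by simp
    qed
    moreover have "((\<lambda>y. g (v (u y))) has_derivative (\<lambda>h. Dg (Dv (Du h)))) (at x)"
      using diff_chain_at[OF Du gv] by (simp add: o_def)
    ultimately have "(g has_derivative (\<lambda>h. 0)) (at x)" by (simp add: vu)
    then have "Dg = (\<lambda>h. 0)" using Dg has_derivative_unique by (simp add: vu) blast
    then have "Dg (axis j 1) = 0" by simp
    moreover have "Dg (axis j 1) = partial_deriv j g x"
    proof -
      have "(\<Sum>i\<in>UNIV. (axis j 1 :: real^'n) $ i *\<^sub>R partial_deriv i g x) = (\<Sum>i\<in>UNIV. if i = j then partial_deriv i g x else 0)"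
        by (intro sum.cong) (auto simp: axis_def)
      then show ?thesis by (simp add: Dg_def)
    qed
    ultimately show False using assms(3) by simp
  qed
  then obtain i where i: "Dg (Dv (axis i 1)) \<noteq> 0" by blast
  have "Im (Dg (Dv (axis i 1))) = 0"
  proof -
    have "((\<lambda>t. Im (g (v (u x + t *\<^sub>R axis i 1)))) has_vector_derivative Im (Dg (Dv (axis i 1)))) (at 0)"
      by (rule bounded_linear.has_vector_derivative[OF bounded_linear_Im line])
    then have "((\<lambda>t::real. 0::real) has_vector_derivative Im (Dg (Dv (axis i 1)))) (at 0)" using assms(2) by simp
    then show ?thesis using vector_derivative_at by fastforce
  qed
  then have "Re (Dg (Dv (axis i 1))) \<noteq> 0" using i complex_eq_iff by auto
  then show ?thesis using rl by blast
qed

text \<open>Since \<open>L\<close> preserves moduli, \<open>F s\<close> on the line through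
  \<open>u x\<close> has modulus \<open>|q t + s \<omega>|\<close>. The uniform Taylor bound
  linearizes \<open>F s\<close> at parameter \<open>s\<close> and \<open>- s\<close>, where
  \<open>F s / s\<close> is close to \<open>a s + B0\<close> and \<open>a s - B0\<close>. Comparing
  the two moduli by polarization determines \<open>Re (a s * cnj \<beta>)\<close>, the phase of
  \<open>a s\<close> relative to the slope up to conjugation.\<close>

lemma slope_limit:
  assumes cont: "\<forall>\<^sub>F z in at x. z \<notin> bad_cont"
    and g: "smooth g" "\<And>z. Im (g z) = 0" "g x = 0"
    and \<gamma>: "\<gamma> \<noteq> 0" "((\<lambda>t. Re (g (v (u x + t *\<^sub>R axis i 1)))) has_real_derivative \<gamma>) (at 0)"
    and taylor: "\<delta> > 0" "\<And>s t. 0 < s \<Longrightarrow> s < \<delta> \<Longrightarrow> \<bar>t\<bar> < \<delta> \<Longrightarrow>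
     norm (L (\<lambda>y. g y + of_real s * \<omega>) (u x + t *\<^sub>R axis i 1) - L (\<lambda>y. g y + of_real s * \<omega>) (u x)
       - t *\<^sub>R partial_deriv i (L (\<lambda>y. g y + of_real s * \<omega>)) (u x)) \<le> K * t\<^sup>2"
    and \<omega>: "norm \<omega> = 1"
  defines "\<beta> \<equiv> partial_deriv i (L g) (u x) / of_real \<gamma>"
  shows "norm \<beta> = 1" "((\<lambda>s. Re (L (\<lambda>y. g y + of_real s * \<omega>) (u x) / of_real s * cnj \<beta>)) \<longlongrightarrow> Re \<omega>) (at_right 0)"
proof -
  define F where "F s = L (\<lambda>y. g y + of_real s * \<omega>)" for s :: real
  define Y where "Y t = u x + t *\<^sub>R axis i 1" for t :: real
  define q where "q t = Re (g (v (Y t)))" for t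
  define B where "B s = partial_deriv i (F s) (u x)" for s
  define B0 where "B0 = partial_deriv i (L g) (u x)"
  have gq: "g (v (Y t)) = of_real (q t)" for t using g(2) by (simp add: q_def complex_eq_iff)
  have q0: "q 0 = 0" using g(3) by (simp add: q_def Y_def vu)
  have q': "((\<lambda>t. q t / t) \<longlongrightarrow> \<gamma>) (at 0)"
    using \<gamma>(2) q0 unfolding q_def Y_def by (simp add: has_field_derivative_iff)
  have smF: "smooth (\<lambda>y. g y + of_real s * \<omega>)" for s by (intro smooth_add g smooth_const)
  have nF: "norm (F s (Y t)) = norm (of_real (q t) + of_real s * \<omega>)" for s t
    using norm_L[OF smF, of s "v (Y t)"] by (simp add: F_def uv gq)
  have Y0: "Y 0 = u x" by (simp add: Y_def)
  have tay: "norm (F s (Y t) - F s (u x) - t *\<^sub>R B s) \<le> K * t\<^sup>2" if "0 < s" "s < \<delta>" "\<bar>t\<bar> < \<delta>" for s t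
    using taylor(2)[OF that] by (simp add: F_def B_def Y_def)
  have nF0: "norm (F s (u x)) = \<bar>s\<bar>" for s using nF[of s 0] \<omega> by (simp add: Y0 q0 norm_mult)
  have Lg0: "L g (u x) = 0" by (rule L_zero[OF g(1,3)])
  have dL0: "((\<lambda>t. L g (Y t) / of_real t) \<longlongrightarrow> B0) (at 0)"
  proof -
    have "((\<lambda>t. L g (Y t)) has_vector_derivative B0) (at 0)"
      unfolding Y_def B0_def by (rule has_pdD[OF smooth_partial_deriv(1)[OF L_smooth[OF g(1)]]])
    then have "((\<lambda>t. norm (L g (Y t) - t *\<^sub>R B0) / norm t) \<longlongrightarrow> 0) (at 0)"
      unfolding has_vector_derivative_def has_derivative_at by (simp add: Y0 Lg0)
    moreover have "\<forall>\<^sub>F t in at 0. norm (L g (Y t) - t *\<^sub>R B0) / norm t = norm (L g (Y t) / of_real t - B0)"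
      using eventually_neq_at_within[of "0::real" 0 UNIV]
    proof eventually_elim
      case (elim t)
      have "L g (Y t) / of_real t - B0 = (L g (Y t) - t *\<^sub>R B0) / of_real t"
        using elim by (simp add: scaleR_conv_of_real diff_divide_distrib)
      then show ?case by (simp add: norm_divide)
    qed
    ultimately have "((\<lambda>t. norm (L g (Y t) / of_real t - B0)) \<longlongrightarrow> 0) (at 0)" by (rule Lim_transform_eventually)
    then have "((\<lambda>t. L g (Y t) / of_real t - B0) \<longlongrightarrow> 0) (at 0)" by (rule tendsto_norm_zero_cancel)
    then show ?thesis by (simp only: LIM_zero_iff)
  qed
  have nB0: "norm B0 = \<bar>\<gamma>\<bar>"
  proof -
    have "((\<lambda>t. norm (L g (Y t) / of_real t)) \<longlongrightarrow> norm B0) (at 0)" by (intro tendsto_intros dL0)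
    moreover have "norm (L g (Y t) / of_real t) = \<bar>q t / t\<bar>" for t
      using norm_L[OF g(1), of "v (Y t)"] by (simp add: uv gq norm_divide)
    ultimately have "((\<lambda>t. \<bar>q t / t\<bar>) \<longlongrightarrow> norm B0) (at 0)" by simp
    moreover have "((\<lambda>t. \<bar>q t / t\<bar>) \<longlongrightarrow> \<bar>\<gamma>\<bar>) (at 0)" by (intro tendsto_intros q')
    ultimately show ?thesis using tendsto_unique at_neq_bot by blast
  qed
  then show nb: "norm \<beta> = 1" using \<gamma>(1) by (simp add: \<beta>_def norm_divide flip: B0_def)
  \<comment> \<open>Where \<open>g\<close> is nonzero, \<open>g + s \<omega>\<close> is
    \<open>g\<close> times \<open>1 + s \<omega> / g\<close>, to which continuity in
    \<open>s\<close> applies.\<close>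
  have conv: "((\<lambda>s. F s (Y t)) \<longlongrightarrow> L g (Y t)) (at_right 0)" if t: "q t \<noteq> 0" "v (Y t) \<notin> bad_cont" for t
  proof -
    define z where "z = v (Y t)"
    have "g z \<noteq> 0" using t(1) gq[of t] by (simp add: z_def)
    then obtain h where h: "smooth h" "\<forall>\<^sub>F y in nhds z. g y * h y = 1" using local_inverse[OF g(1)] by blast
    have smh: "smooth (\<lambda>y. \<omega> * h y)" by (intro smooth_mult smooth_const h)
    have smh1: "smooth (\<lambda>y. 1 + of_real s * (\<omega> * h y))" for s :: real by (intro smooth_add smooth_mult smooth_const h)
    have "F s (u z) = L g (u z) * L (\<lambda>y. 1 + of_real s * (\<omega> * h y)) (u z)" for s
    proof -
      have "F s (u z) = L (\<lambda>y. g y * (1 + of_real s * (\<omega> * h y))) (u z)"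
        unfolding F_def
      proof (rule L_local[OF smF smooth_mult[OF g(1) smh1]])
        show "\<forall>\<^sub>F y in nhds z. g y + of_real s * \<omega> = g y * (1 + of_real s * (\<omega> * h y))"
          using h(2)
        proof eventually_elim
          case (elim y)
          have "g y * (1 + of_real s * (\<omega> * h y)) = g y + of_real s * \<omega> * (g y * h y)" by (simp add: algebra_simps)
          then show ?case using elim by simp
        qed
      qed
      then show ?thesis using L_mult[OF g(1) smh1] by (simp add: fun_eq_iff)
    qed
    moreover have "((\<lambda>s. L g (u z) * L (\<lambda>y. 1 + of_real s * (\<omega> * h y)) (u z)) \<longlongrightarrow> L g (u z) * 1) (at_right 0)"
      using t(2) smh unfolding bad_cont_def z_def[symmetric] by (intro tendsto_intros) blast
    ultimately show ?thesis by (simp add: z_def uv)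
  qed
  have good: "\<forall>\<^sub>F t in at 0. q t \<noteq> 0 \<and> v (Y t) \<notin> bad_cont"
  proof -
    have "((\<lambda>t. q t / t) \<longlongrightarrow> \<gamma>) (at 0)" by (rule q')
    then have "\<forall>\<^sub>F t in at 0. q t / t \<noteq> 0" using \<gamma>(1) by (rule tendsto_imp_eventually_ne)
    then have qn: "\<forall>\<^sub>F t in at 0. q t \<noteq> 0" by (rule eventually_mono) auto
    have "(Y \<longlongrightarrow> Y 0) (at 0)" unfolding Y_def by (intro tendsto_intros)
    then have "((\<lambda>t. v (Y t)) \<longlongrightarrow> v (Y 0)) (at 0)" by (rule continuous_on_tendsto_compose[OF cont_v]) auto
    then have "((\<lambda>t. v (Y t)) \<longlongrightarrow> x) (at 0)" by (simp add: Y0 vu)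
    \<comment> \<open>As \<open>q t\<close> is nonzero, \<open>v (Y t)\<close> differs from
      \<open>x\<close>, so the punctured neighbourhood in \<open>cont\<close> suffices.\<close>
    moreover have "\<forall>\<^sub>F t in at 0. v (Y t) \<noteq> x"
      using qn by (rule eventually_mono) (use g(3) gq in fastforce)
    ultimately have "filterlim (\<lambda>t. v (Y t)) (at x) (at 0)" by (simp add: filterlim_at)
    then have "\<forall>\<^sub>F t in at 0. v (Y t) \<notin> bad_cont" by (rule eventually_compose_filterlim[OF cont])
    with qn show ?thesis by eventually_elim auto
  qed
  \<comment> \<open>First fix a small \<open>t\<close>, then let \<open>s\<close> tend to 0. The
    linearization errors of \<open>F s\<close> and \<open>L g\<close> are small relative to
    \<open>t\<close>, and \<open>F s\<close> converges at both ends of the segment, so the slopes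
    differ by less than \<open>e\<close>.\<close>
  have BB0: "(B \<longlongrightarrow> B0) (at_right 0)"
  proof (rule tendstoI)
    fix e :: real assume e: "e > 0"
    have "\<forall>\<^sub>F t in at 0. norm (L g (Y t) / of_real t - B0) < e/4"
      using dL0 e unfolding tendsto_iff dist_norm by (metis zero_less_divide_iff zero_less_numeral)
    moreover have "\<forall>\<^sub>F t in at (0::real). \<bar>t\<bar> < min \<delta> (e / (4 * (\<bar>K\<bar> + 1)))"
    proof -
      have "0 < min \<delta> (e / (4 * (\<bar>K\<bar> + 1)))" using taylor(1) e by simp
      then show ?thesis unfolding eventually_at by (intro exI[of _ "min \<delta> (e / (4 * (\<bar>K\<bar> + 1)))"]) (simp add: dist_norm)
    qed
    ultimately have "\<forall>\<^sub>F t in at (0::real). t \<noteq> 0 \<and> norm (L g (Y t) / of_real t - B0) < e/4 \<and> \<bar>t\<bar> < min \<delta> (e / (4 * (\<bar>K\<bar> + 1))) \<and> q t \<noteq> 0 \<and> v (Y t) \<notin> bad_cont"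
      using good eventually_neq_at_within[of "0::real" 0 UNIV]
      by eventually_elim (intro conjI, simp_all)
    from eventually_happens'[OF at_neq_bot this]
    obtain t where t: "t \<noteq> 0" "norm (L g (Y t) / of_real t - B0) < e/4" "\<bar>t\<bar> < \<delta>" "\<bar>t\<bar> < e / (4 * (\<bar>K\<bar> + 1))" "q t \<noteq> 0" "v (Y t) \<notin> bad_cont"
      by auto
    have et: "e * \<bar>t\<bar> / 4 > 0" using e t(1) by simp
    have "\<forall>\<^sub>F s in at_right 0. dist (F s (Y t)) (L g (Y t)) < e * \<bar>t\<bar> / 4"
      by (rule tendstoD[OF conv[OF t(5,6)] et])
    moreover have "\<forall>\<^sub>F s in at_right (0::real). 0 < s \<and> s < min \<delta> (e * \<bar>t\<bar> / 4)"
      using taylor(1) et unfolding eventually_at_right_field by (intro exI[of _ "min \<delta> (e * \<bar>t\<bar> / 4)"]) auto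
    ultimately show "\<forall>\<^sub>F s in at_right 0. dist (B s) B0 < e"
    proof eventually_elim
      case (elim s)
      have 1: "norm (F s (Y t) - F s (u x) - t *\<^sub>R B s) \<le> K * t\<^sup>2" using elim t by (intro tay) auto
      have 2: "norm (F s (u x)) < e * \<bar>t\<bar> / 4" using nF0[of s] elim by simp
      have 3: "norm (L g (Y t) - t *\<^sub>R B0) \<le> e * \<bar>t\<bar> / 4"
      proof -
        have "L g (Y t) - t *\<^sub>R B0 = of_real t * (L g (Y t) / of_real t - B0)" using t(1) by (simp add: scaleR_conv_of_real algebra_simps)
        then have "norm (L g (Y t) - t *\<^sub>R B0) = \<bar>t\<bar> * norm (L g (Y t) / of_real t - B0)" by (simp add: norm_mult)
        also have "\<dots> \<le> \<bar>t\<bar> * (e/4)" using t(2) by (intro mult_left_mono) auto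
        finally show ?thesis by (simp add: mult.commute)
      qed
      have 4: "K * t\<^sup>2 \<le> e * \<bar>t\<bar> / 4"
      proof -
        have "K * t\<^sup>2 \<le> (\<bar>K\<bar> + 1) * \<bar>t\<bar> * \<bar>t\<bar>" using mult_right_mono[of K "\<bar>K\<bar> + 1" "t\<^sup>2"] by (simp add: power2_eq_square abs_mult_self_eq mult.assoc)
        also have "(\<bar>K\<bar> + 1) * \<bar>t\<bar> \<le> e / 4" using t(4) by (simp add: field_simps)
        then have "(\<bar>K\<bar> + 1) * \<bar>t\<bar> * \<bar>t\<bar> \<le> e / 4 * \<bar>t\<bar>" by (rule mult_right_mono) auto
        finally show ?thesis by simp
      qed
      have "t *\<^sub>R (B s - B0) = - (F s (Y t) - F s (u x) - t *\<^sub>R B s) + (F s (Y t) - L g (Y t)) - F s (u x) + (L g (Y t) - t *\<^sub>R B0)"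
        by (simp add: algebra_simps)
      also have "norm \<dots> \<le> norm (F s (Y t) - F s (u x) - t *\<^sub>R B s) + norm (F s (Y t) - L g (Y t)) + norm (F s (u x)) + norm (L g (Y t) - t *\<^sub>R B0)"
        by (smt (verit) norm_triangle_ineq norm_triangle_ineq4 norm_minus_cancel)
      also have "\<dots> < e * \<bar>t\<bar> / 4 + e * \<bar>t\<bar> / 4 + e * \<bar>t\<bar> / 4 + e * \<bar>t\<bar> / 4"
        using 1 2 3 4 elim(1) by (simp add: dist_norm)
      finally have "\<bar>t\<bar> * norm (B s - B0) < e * \<bar>t\<bar>" by simp
      then show ?case using t(1) by (simp add: dist_norm mult.commute)
    qed
  qed
  define a where "a s = F s (u x) / of_real s" for s
  \<comment> \<open>The points \<open>Y s\<close> and \<open>Y (- s)\<close>: there the Taylor error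
    divided by \<open>s\<close> is \<open>O(s)\<close>.\<close>
  have side: "((\<lambda>s. norm (a s + of_real \<xi> * B0)) \<longlongrightarrow> norm (of_real (\<xi> * \<gamma>) + \<omega>)) (at_right 0)" if xi: "\<xi> = 1 \<or> \<xi> = -1" for \<xi> :: real
  proof -
    have "filterlim (\<lambda>s. \<xi> * s) (at 0) (at_right 0)"
    proof -
      have "((\<lambda>s. \<xi> * s) \<longlongrightarrow> \<xi> * 0) (at_right 0)" by (intro tendsto_intros)
      moreover have "\<forall>\<^sub>F s in at_right 0. \<xi> * s \<noteq> 0"
        unfolding eventually_at_right_field using xi by (intro exI[of _ 1]) auto
      ultimately show ?thesis by (simp add: filterlim_at)
    qed
    from filterlim_compose[OF q' this] have qq: "((\<lambda>s. q (\<xi> * s) / (\<xi> * s)) \<longlongrightarrow> \<gamma>) (at_right 0)" .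
    have pos: "\<forall>\<^sub>F s in at_right (0::real). 0 < s \<and> s < \<delta>"
      using taylor(1) unfolding eventually_at_right_field by (intro exI[of _ \<delta>]) auto
    have "((\<lambda>s. norm (of_real (\<xi> * (q (\<xi> * s) / (\<xi> * s))) + \<omega>)) \<longlongrightarrow> norm (of_real (\<xi> * \<gamma>) + \<omega>)) (at_right 0)"
      by (intro tendsto_intros qq)
    moreover have "\<forall>\<^sub>F s in at_right 0. norm (of_real (\<xi> * (q (\<xi> * s) / (\<xi> * s))) + \<omega>) = norm (F s (Y (\<xi> * s)) / of_real s)"
      using pos
    proof eventually_elim
      case (elim s)
      have "of_real (\<xi> * (q (\<xi> * s) / (\<xi> * s))) + \<omega> = (of_real (q (\<xi> * s)) + of_real s * \<omega>) / of_real s"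
        using elim xi by (auto simp: field_simps)
      then show ?case using nF[of s "\<xi> * s"] by (simp add: norm_divide)
    qed
    ultimately have P: "((\<lambda>s. norm (F s (Y (\<xi> * s)) / of_real s)) \<longlongrightarrow> norm (of_real (\<xi> * \<gamma>) + \<omega>)) (at_right 0)"
      by (rule Lim_transform_eventually)
    have "((\<lambda>s. F s (Y (\<xi> * s)) / of_real s - (a s + of_real \<xi> * B0)) \<longlongrightarrow> 0) (at_right 0)"
    proof (rule Lim_null_comparison)
      show "((\<lambda>s. \<bar>K\<bar> * s + norm (B s - B0)) \<longlongrightarrow> 0) (at_right 0)"
      proof -
        have "((\<lambda>s. \<bar>K\<bar> * s + norm (B s - B0)) \<longlongrightarrow> \<bar>K\<bar> * 0 + norm (B0 - B0)) (at_right 0)"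
          by (intro tendsto_intros BB0)
        then show ?thesis by simp
      qed
      show "\<forall>\<^sub>F s in at_right 0. norm (F s (Y (\<xi> * s)) / of_real s - (a s + of_real \<xi> * B0)) \<le> \<bar>K\<bar> * s + norm (B s - B0)"
        using pos
      proof eventually_elim
        case (elim s)
        have "\<bar>\<xi> * s\<bar> < \<delta>" using elim xi by auto
        from tay[OF _ _ this, of s] elim
        have 1: "norm (F s (Y (\<xi> * s)) - F s (u x) - (\<xi> * s) *\<^sub>R B s) \<le> K * s\<^sup>2" using xi by (auto simp: power_mult_distrib)
        have "F s (Y (\<xi> * s)) / of_real s - (a s + of_real \<xi> * B0)
          = (F s (Y (\<xi> * s)) - F s (u x) - (\<xi> * s) *\<^sub>R B s) / of_real s + of_real \<xi> * (B s - B0)"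
          using elim by (simp add: a_def scaleR_conv_of_real field_simps)
        also have "norm \<dots> \<le> norm ((F s (Y (\<xi> * s)) - F s (u x) - (\<xi> * s) *\<^sub>R B s) / of_real s) + norm (of_real \<xi> * (B s - B0))"
          by (rule norm_triangle_ineq)
        also have "norm (of_real \<xi> * (B s - B0)) = norm (B s - B0)" using xi by (auto simp: norm_mult)
        also have "norm ((F s (Y (\<xi> * s)) - F s (u x) - (\<xi> * s) *\<^sub>R B s) / of_real s) \<le> \<bar>K\<bar> * s"
        proof -
          have "norm (F s (Y (\<xi> * s)) - F s (u x) - (\<xi> * s) *\<^sub>R B s) / s \<le> K * s\<^sup>2 / s" using 1 elim by (intro divide_right_mono) auto
          also have "\<dots> \<le> \<bar>K\<bar> * s" using elim by (simp add: power2_eq_square)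
          finally show ?thesis using elim by (simp add: norm_divide)
        qed
        finally show ?case by simp
      qed
    qed
    from tendsto_norm_zero[OF this]
    have "((\<lambda>s. norm (a s + of_real \<xi> * B0) - norm (F s (Y (\<xi> * s)) / of_real s)) \<longlongrightarrow> 0) (at_right 0)"
      by (rule Lim_null_comparison[rotated]) (auto intro!: always_eventually simp: norm_minus_commute norm_triangle_ineq3)
    from tendsto_add[OF this P] show ?thesis by simp
  qed
  have "((\<lambda>s. ((norm (a s + of_real 1 * B0))\<^sup>2 - (norm (a s + of_real (-1) * B0))\<^sup>2) / (4 * \<gamma>)) \<longlongrightarrow>
     ((norm (of_real (1 * \<gamma>) + \<omega>))\<^sup>2 - (norm (of_real (- 1 * \<gamma>) + \<omega>))\<^sup>2) / (4 * \<gamma>)) (at_right 0)"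
    by (intro tendsto_intros side) (use \<gamma>(1) in auto)
  moreover have "((norm (a s + of_real 1 * B0))\<^sup>2 - (norm (a s + of_real (-1) * B0))\<^sup>2) / (4 * \<gamma>) = Re (a s * cnj \<beta>)" for s
  proof -
    have e1: "(norm (a s + of_real 1 * B0))\<^sup>2 - (norm (a s + of_real (-1) * B0))\<^sup>2 = 4 * Re (a s * cnj B0)"
      using parallelogram_Re[of "a s" B0] by simp
    have e2: "Re (a s * cnj \<beta>) = Re (a s * cnj B0) / \<gamma>"
      by (simp add: \<beta>_def B0_def[symmetric] add_divide_distrib)
    show ?thesis unfolding e1 e2 by (rule mult_divide_mult_cancel_left) simp
  qed
  moreover have "((norm (of_real (1 * \<gamma>) + \<omega>))\<^sup>2 - (norm (of_real (- 1 * \<gamma>) + \<omega>))\<^sup>2) / (4 * \<gamma>) = Re \<omega>"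
  proof -
    have "(norm (of_real \<gamma> + \<omega>))\<^sup>2 - (norm (- of_real \<gamma> + \<omega>))\<^sup>2 = 4 * (\<gamma> * Re \<omega>)"
      using parallelogram_Re[of \<omega> "of_real \<gamma>"] by (simp add: add.commute mult.commute)
    then show ?thesis using \<gamma>(1) by simp
  qed
  ultimately show "((\<lambda>s. Re (L (\<lambda>y. g y + of_real s * \<omega>) (u x) / of_real s * cnj \<beta>)) \<longlongrightarrow> Re \<omega>) (at_right 0)"
    by (simp add: a_def F_def)
qed

end

section \<open>The value at a point determines the image\<close>

context mult_iso
begin

lemma L_exp_add:
  assumes "smooth f" "smooth g"
  shows "L (\<lambda>y. exp (f y + g y)) z = L (\<lambda>y. exp (f y)) z * L (\<lambda>y. exp (g y)) z"
  using L_mult[OF smooth_exp[OF assms(1)] smooth_exp[OF assms(2)]] by (simp add: exp_add fun_eq_iff)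

lemma L_exp_sum:
  assumes "finite A" "\<And>j. j \<in> A \<Longrightarrow> smooth (f j)"
  shows "L (\<lambda>y. exp (\<Sum>j\<in>A. f j y)) z = (\<Prod>j\<in>A. L (\<lambda>y. exp (f j y)) z)"
  using assms
proof (induction A rule: finite_induct)
  case (insert j A)
  then show ?case using L_exp_add[of "f j" "\<lambda>y. \<Sum>j\<in>A. f j y" z] by (simp add: smooth_sum)
qed (simp add: L_1)

lemma taylor_bound:
  assumes "x \<notin> bad_taylor" "smooth g"
  shows "\<exists>c>0. \<exists>K. \<exists>\<delta>>0. \<forall>s t. 0 < s \<longrightarrow> s < \<delta> \<longrightarrow> \<bar>t\<bar> < \<delta> \<longrightarrow>
     norm (L (\<lambda>y. of_real c * g y + of_real s * \<omega>) (u x + t *\<^sub>R axis i 1) - L (\<lambda>y. of_real c * g y + of_real s * \<omega>) (u x)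
       - t *\<^sub>R partial_deriv i (L (\<lambda>y. of_real c * g y + of_real s * \<omega>)) (u x)) \<le> K * t\<^sup>2"
proof -
  define D where "D c s t = norm (L (\<lambda>y. of_real c * g y + of_real s * \<omega>) (u x + t *\<^sub>R axis i 1) - L (\<lambda>y. of_real c * g y + of_real s * \<omega>) (u x)
       - t *\<^sub>R partial_deriv i (L (\<lambda>y. of_real c * g y + of_real s * \<omega>)) (u x))" for c s t :: real
  have "\<not> (\<forall>c>0. \<forall>K. \<forall>\<delta>>0. \<exists>s t. 0 < s \<and> s < \<delta> \<and> \<bar>t\<bar> < \<delta> \<and> D c s t > K * t\<^sup>2)"
    using assms unfolding bad_taylor_def D_def mem_Collect_eq by blast
  then obtain c K \<delta> where "c > 0" "\<delta> > 0" "\<not> (\<exists>s t. 0 < s \<and> s < \<delta> \<and> \<bar>t\<bar> < \<delta> \<and> D c s t > K * t\<^sup>2)"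
    by blast
  then have "\<exists>c>0. \<exists>K. \<exists>\<delta>>0. \<forall>s t. 0 < s \<longrightarrow> s < \<delta> \<longrightarrow> \<bar>t\<bar> < \<delta> \<longrightarrow> D c s t \<le> K * t\<^sup>2"
    by (meson not_less)
  then show ?thesis unfolding D_def .
qed

text \<open>For \<open>bad_cont\<close> a punctured neighbourhood is asked, the form used in
  \<open>slope_limit\<close>; it is available at every point because \<open>bad_cont\<close> is
  discrete.\<close>

definition good :: "real^'n \<Rightarrow> bool" where
  "good x \<longleftrightarrow> x \<notin> bad_order \<and> x \<notin> bad_taylor \<and> (\<forall>\<^sub>F z in at x. z \<notin> bad_cont)"

lemma good_generic: "discrete_set {x. \<not> good x}"
proof -
  have "\<forall>\<^sub>F z in at x. z \<notin> bad_cont" for x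
    using discrete_bad_cont islimpt_iff_eventually[of x bad_cont] by (auto simp: discrete_set_def)
  then have "{x. \<not> good x} \<subseteq> bad_order \<union> bad_taylor" by (auto simp: good_def)
  then show ?thesis
    by (rule discrete_set_mono[rotated]) (intro discrete_set_Un discrete_bad_order discrete_bad_taylor)
qed

text \<open>Write \<open>G + \<omega> / t\<close> as \<open>\<omega> / t\<close> times
  \<open>1 - a G\<close> with \<open>a = - t / \<omega>\<close>. Weierstrass factors go to 1, so
  \<open>F (1/t)\<close> is the image of a constant divided by a product \<open>P t\<close> of
  characters. The image of \<open>1/t\<close> is unknown but multiplicative: comparing
  \<open>t\<close> with \<open>2 t\<close> leaves only the fixed factor \<open>m 2\<close>. The
  squares of the normalized \<open>F\<close> converge, hence so does the square of
  \<open>P (2 t) / P t\<close>, and \<open>hom_elimination\<close> kills the first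
  character.\<close>

lemma L_exp_direction:
  assumes x: "good x" and g: "smooth g" "\<And>z. Im (g z) = 0" "g x = 0" "partial_deriv j g x \<noteq> 0"
    and \<omega>: "\<omega> = 1 \<or> \<omega> = \<i>"
  shows "L (\<lambda>y. exp (of_real r * ((- 1 / \<omega>) * g y))) (u x) = 1"
proof -
  have w1: "norm \<omega> = 1" "\<omega> \<noteq> 0" using \<omega> by auto
  obtain i \<gamma> where \<gamma>: "\<gamma> \<noteq> 0" "((\<lambda>t. Re (g (v (u x + t *\<^sub>R axis i 1)))) has_real_derivative \<gamma>) (at 0)"
    using coord_direction[OF g(1,2,4)] by blast
  obtain c K \<delta> where c: "c > 0" "\<delta> > 0" and taylor: "\<And>s t. 0 < s \<Longrightarrow> s < \<delta> \<Longrightarrow> \<bar>t\<bar> < \<delta> \<Longrightarrow>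
     norm (L (\<lambda>y. of_real c * g y + of_real s * \<omega>) (u x + t *\<^sub>R axis i 1) - L (\<lambda>y. of_real c * g y + of_real s * \<omega>) (u x)
       - t *\<^sub>R partial_deriv i (L (\<lambda>y. of_real c * g y + of_real s * \<omega>)) (u x)) \<le> K * t\<^sup>2"
    using taylor_bound[of x g \<omega> i] x g(1) unfolding good_def by blast
  define G where "G y = of_real c * g y" for y
  have G: "smooth G" "\<And>z. Im (G z) = 0" "G x = 0" unfolding G_def using g by (auto intro!: smooth_mult)
  have \<gamma>': "c * \<gamma> \<noteq> 0" "((\<lambda>t. Re (G (v (u x + t *\<^sub>R axis i 1)))) has_real_derivative c * \<gamma>) (at 0)"
    unfolding G_def using \<gamma>(1) c(1) DERIV_cmult[OF \<gamma>(2), of c] by simp_all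
  have cont: "\<forall>\<^sub>F z in at x. z \<notin> bad_cont" using x by (simp add: good_def)
  define F where "F s = L (\<lambda>y. G y + of_real s * \<omega>) (u x)" for s :: real
  define \<beta> where "\<beta> = partial_deriv i (L G) (u x) / of_real (c * \<gamma>)"
  note slope = slope_limit[OF cont G \<gamma>' c(2) taylor[folded G_def] w1(1), folded F_def \<beta>_def]
  have smF: "smooth (\<lambda>y. G y + of_real s * \<omega>)" for s by (intro smooth_add smooth_const G)
  have nF: "norm (F s) = \<bar>s\<bar>" for s using norm_L[OF smF, of s x] w1 by (simp add: F_def G(3) norm_mult)
  have sq: "((\<lambda>s. (F s / of_real s * cnj \<beta>)\<^sup>2) \<longlongrightarrow> \<omega>\<^sup>2) (at_right 0)"
  proof (rule square_limit[where S = "{0<..}"])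
    show "norm (F s / of_real s * cnj \<beta>) = 1" if "s \<in> {0<..}" for s
      using that slope(1) nF[of s] by (simp add: norm_mult norm_divide)
    show "\<forall>\<^sub>F s in at_right 0. s \<in> {0<..}" by (simp add: eventually_at_filter)
  qed (use slope(2) \<omega> in auto)
  obtain N where N: "N \<ge> 1" "\<And>a. L (\<lambda>y. weierstrass_factor N (a * G y)) (u x) = 1"
    using x G unfolding good_def bad_order_def by blast
  define b where "b = - 1 / \<omega>"
  define f where "f j y = (b * G y) ^ j / of_nat j" for j y
  have smf: "smooth (f j)" for j
    unfolding f_def by (intro smooth_linear[OF bounded_linear_divide] smooth_power smooth_mult smooth_const G)
  have smrf: "smooth (\<lambda>y. of_real t * f j y)" for j and t :: real by (intro smooth_mult smooth_const smf)
  define h where "h j t = L (\<lambda>y. exp (of_real t * f j y)) (u x)" for j and t :: real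
  have h_add: "h j (s + t) = h j s * h j t" for j s t
    unfolding h_def using L_exp_add[OF smrf smrf] by (simp add: distrib_right)
  have fx: "f j x = 0" if "j \<ge> 1" for j using that by (simp add: f_def G(3))
  have h_norm: "norm (h j t) = 1" if "j \<ge> 1" for j t
    using norm_L[OF smooth_exp[OF smrf], of t j x] fx[OF that] by (simp add: h_def)
  have h0: "h j 0 = 1" for j by (simp add: h_def L_1)
  have hn: "h j (of_nat n * t) = h j t ^ n" for j n t
    by (induction n) (auto simp: h0 distrib_right h_add)
  define P where "P t = (\<Prod>j=1..N. h j (t ^ j))" for t
  have nP: "norm (P t) = 1" for t unfolding P_def by (simp add: prod_norm[symmetric] h_norm)
  define m where "m d = L (\<lambda>_. d) (u x)" for d
  have m_mult: "m (d * e) = m d * m e" for d e by (simp add: m_def L_const_mult)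
  have m_norm: "norm (m d) = norm d" for d using norm_L[OF smooth_const] by (simp add: m_def)
  have FP: "F (1/t) * P t = m (of_real (1/t)) * m \<omega>" if t: "t > 0" for t
  proof -
    define a where "a = of_real t * b"
    have S: "smooth (\<lambda>y. \<Sum>j=1..N. of_real (t ^ j) * f j y)" by (intro smooth_sum smrf)
    have "P t = L (\<lambda>y. exp (\<Sum>j=1..N. of_real (t ^ j) * f j y)) (u x)"
      unfolding P_def h_def by (subst L_exp_sum) (auto intro!: smooth_mult smf)
    then have "F (1/t) * P t = L (\<lambda>y. (G y + of_real (1/t) * \<omega>) * exp (\<Sum>j=1..N. of_real (t ^ j) * f j y)) (u x)"
      unfolding F_def using L_mult[OF smF smooth_exp[OF S]] by (simp only: fun_eq_iff)
    also have "(\<lambda>y. (G y + of_real (1/t) * \<omega>) * exp (\<Sum>j=1..N. of_real (t ^ j) * f j y)) =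
        (\<lambda>y. (of_real (1/t) * \<omega>) * weierstrass_factor N (a * G y))"
    proof
      fix y
      have "(\<Sum>j=1..N. of_real (t ^ j) * f j y) = (\<Sum>j=1..N. (a * G y) ^ j / of_nat j)"
        by (intro sum.cong refl) (simp add: f_def a_def power_mult_distrib mult_ac)
      moreover have "G y + of_real (1/t) * \<omega> = (of_real (1/t) * \<omega>) * (1 - a * G y)"
        using t w1(2) by (simp add: a_def b_def field_simps)
      ultimately show "(G y + of_real (1/t) * \<omega>) * exp (\<Sum>j=1..N. of_real (t ^ j) * f j y) = (of_real (1/t) * \<omega>) * weierstrass_factor N (a * G y)"
        by (simp add: weierstrass_factor_def)
    qed
    also have "L \<dots> (u x) = m (of_real (1/t) * \<omega>) * L (\<lambda>y. weierstrass_factor N (a * G y)) (u x)"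
      unfolding m_def by (subst L_mult[OF smooth_const smooth_weierstrass[OF G(1)]]) (rule refl)
    finally show ?thesis unfolding N(2) m_mult by simp
  qed
  define E where "E t = (F (1/t) / of_real (1/t) * cnj \<beta>)\<^sup>2" for t
  have E: "(E \<longlongrightarrow> \<omega>\<^sup>2) at_top"
    unfolding E_def
  proof (rule filterlim_compose[OF sq])
    show "filterlim (\<lambda>t::real. 1 / t) (at_right 0) at_top"
      using filterlim_inverse_at_right_top by (simp add: inverse_eq_divide)
  qed
  have E2: "((\<lambda>t. E (2 * t)) \<longlongrightarrow> \<omega>\<^sup>2) at_top"
    by (rule filterlim_compose[OF E]) (rule filterlim_tendsto_pos_mult_at_top[OF tendsto_const _ filterlim_ident], simp)
  define \<kappa> where "\<kappa> = m 2 / 2"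
  have \<kappa>: "\<kappa> \<noteq> 0" using m_norm[of 2] by (auto simp: \<kappa>_def)
  \<comment> \<open>Squaring \<open>P (2 t) / P t\<close> turns the j-th character into its value at
    \<open>2 * (2 ^ j - 1) * t ^ j\<close>; for \<open>j = 1\<close> this is \<open>2 t\<close>, so
    triviality passes back to \<open>h 1\<close>.\<close>
  define h' where "h' j s = h j (2 * (2 ^ j - 1) * s)" for j and s :: real
  have "((\<lambda>t. E t / E (2 * t) / \<kappa>\<^sup>2) \<longlongrightarrow> \<omega>\<^sup>2 / \<omega>\<^sup>2 / \<kappa>\<^sup>2) at_top"
    by (intro tendsto_intros E E2) (use w1 \<kappa> in auto)
  then have "((\<lambda>t. \<Prod>j=1..N. h' j (t ^ j)) \<longlongrightarrow> 1 / \<kappa>\<^sup>2) at_top"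
  proof (rule Lim_transform_eventually[THEN tendsto_eq_rhs])
    show "\<forall>\<^sub>F t in at_top. E t / E (2 * t) / \<kappa>\<^sup>2 = (\<Prod>j=1..N. h' j (t ^ j))"
      using eventually_gt_at_top[of "0::real"]
    proof eventually_elim
      case (elim t)
      have nz: "P t \<noteq> 0" "P (2 * t) \<noteq> 0" "F (1/t) \<noteq> 0" "F (1/(2*t)) \<noteq> 0" "cnj \<beta> \<noteq> 0"
        using nP[of t] nP[of "2 * t"] nF[of "1/t"] nF[of "1/(2*t)"] slope(1) elim by auto
      have "m (of_real (1/t)) = m 2 * m (of_real (1/(2*t)))" by (simp flip: m_mult)
      then have "F (1/t) * P t = m 2 * (F (1/(2*t)) * P (2 * t))"
        using FP[of t] FP[of "2 * t"] elim by simp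
      then have "F (1/t) / F (1/(2*t)) = m 2 * (P (2 * t) / P t)" using nz by (simp add: field_simps)
      moreover have "E t / E (2 * t) = (F (1/t) / F (1/(2*t)) / 2)\<^sup>2"
        unfolding E_def using elim nz by (simp add: power_divide power_mult_distrib field_simps)
      ultimately have "E t / E (2 * t) / \<kappa>\<^sup>2 = (P (2 * t) / P t)\<^sup>2"
        using \<kappa> by (simp add: \<kappa>_def power_divide power_mult_distrib)
      moreover have "P (2 * t) = P t * (\<Prod>j=1..N. h j ((2 ^ j - 1) * t ^ j))"
        unfolding P_def prod.distrib[symmetric] h_add[symmetric] by (simp add: algebra_simps)
      moreover have "h' j s = (h j ((2 ^ j - 1) * s))\<^sup>2" for j s
        using hn[of j 2 "(2 ^ j - 1) * s"] unfolding h'_def mult.assoc by (simp only: of_nat_numeral)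
      ultimately show ?case using nz by (simp add: prod_power_distrib)
    qed
  qed (use w1 in simp)
  \<comment> \<open>\<open>hom_elimination\<close> wants unimodular homomorphisms at every index;
    \<open>h_norm\<close> gives them from 1 on, so index 0 is filled in by the constant 1.\<close>
  moreover define h2 where "h2 j = (if j \<ge> 1 then h' j else (\<lambda>_. 1))" for j
  have "(\<Prod>j=1..N. h' j (t ^ j)) = (\<Prod>j=1..N. h2 j (t ^ j))" for t
    by (rule prod.cong) (auto simp: h2_def)
  ultimately have lim: "((\<lambda>t. \<Prod>j=1..N. h2 j (t ^ j)) \<longlongrightarrow> 1 / \<kappa>\<^sup>2) at_top" by simp
  have "h2 1 s = 1" for s
    by (rule hom_elimination[OF N(1) _ _ lim]) (use \<kappa> in \<open>auto simp: h2_def h'_def distrib_left h_add h_norm\<close>)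
  then have "h' 1 s = 1" for s by (simp add: h2_def)
  then have "h 1 s = 1" for s using h'_def[of 1 "s / 2"] by simp
  from this[of "r / c"] show ?thesis using c(1) by (simp add: h_def f_def G_def b_def mult_ac)
qed

text \<open>\<open>L_exp_direction\<close> handles real functions with nonzero derivative,
  multiplied by \<open>- 1 / \<omega>\<close>, which is -1 or the imaginary unit. A vanishing
  derivative is repaired by adding and subtracting the coordinate \<open>l\<close>, and a complex
  \<open>\<phi>\<close> splits into real and imaginary part.\<close>

lemma L_exp:
  assumes x: "good x" and \<phi>: "smooth \<phi>" "\<phi> x = 0"
  shows "L (\<lambda>y. exp (\<phi> y)) (u x) = 1"
proof -
  fix j :: 'n
  define l where "l z = complex_of_real (z $ j - x $ j)" for z :: "real^'n"
  have l: "smooth l" "\<And>z. Im (l z) = 0" "l x = 0"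
    unfolding l_def by (auto intro!: smooth_of_real smooth_diff smooth_nth)
  have pdl: "partial_deriv j l = (\<lambda>_. 1)"
  proof -
    have "has_pd j (\<lambda>z. z $ j + (- x $ j)) (\<lambda>z. (if j = j then 1 else 0) + 0)" by (rule has_pd_add[OF has_pd_nth has_pd_const])
    from has_pd_linear[OF bounded_linear_of_real this] have "has_pd j l (\<lambda>_. 1)" by (simp add: l_def[abs_def])
    then show ?thesis by (rule has_pd_partial_deriv)
  qed
  have real: "L (\<lambda>y. exp ((- 1 / \<omega>) * g y)) (u x) = 1" if g: "smooth g" "\<And>z. Im (g z) = 0" "g x = 0" and \<omega>: "\<omega> = 1 \<or> \<omega> = \<i>" for g \<omega>
  proof (cases "partial_deriv j g x = 0")
    case False
    then show ?thesis using L_exp_direction[OF x g False \<omega>, of 1] by simp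
  next
    case True
    have gl: "smooth (\<lambda>y. g y + l y)" by (intro smooth_add g l)
    have "partial_deriv j (\<lambda>y. g y + l y) = (\<lambda>y. partial_deriv j g y + partial_deriv j l y)"
      by (rule has_pd_partial_deriv[OF has_pd_add]) (intro smooth_partial_deriv g l)+
    then have "partial_deriv j (\<lambda>y. g y + l y) x \<noteq> 0" using True pdl by simp
    from L_exp_direction[OF x gl _ _ this \<omega>, of 1] have 1: "L (\<lambda>y. exp ((- 1 / \<omega>) * (g y + l y))) (u x) = 1"
      using g l by simp
    have 2: "L (\<lambda>y. exp (- ((- 1 / \<omega>) * l y))) (u x) = 1"
      using L_exp_direction[OF x l _ \<omega>, of j "-1"] pdl by simp
    have "(\<lambda>y. exp ((- 1 / \<omega>) * g y)) = (\<lambda>y. exp ((- 1 / \<omega>) * (g y + l y) + (- ((- 1 / \<omega>) * l y))))"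
      by (simp add: algebra_simps)
    then have "L (\<lambda>y. exp ((- 1 / \<omega>) * g y)) (u x) = L (\<lambda>y. exp ((- 1 / \<omega>) * (g y + l y))) (u x) * L (\<lambda>y. exp (- ((- 1 / \<omega>) * l y))) (u x)"
      by (simp only:) (intro L_exp_add smooth_mult smooth_minus smooth_const gl l)
    then show ?thesis using 1 2 by simp
  qed
  define g1 g2 where "g1 y = - complex_of_real (Re (\<phi> y))" and "g2 y = complex_of_real (Im (\<phi> y))" for y
  have sm: "smooth g1" "smooth g2" unfolding g1_def g2_def
    by (intro smooth_minus smooth_of_real smooth_linear[OF bounded_linear_Re] smooth_linear[OF bounded_linear_Im] \<phi>)+
  have "(\<lambda>y. exp (\<phi> y)) = (\<lambda>y. exp ((- 1 / 1) * g1 y + (- 1 / \<i>) * g2 y))"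
    by (simp add: g1_def g2_def complex_eq_iff fun_eq_iff flip: exp_add) (metis complex_eq mult.commute)
  then have "L (\<lambda>y. exp (\<phi> y)) (u x) = L (\<lambda>y. exp ((- 1 / 1) * g1 y)) (u x) * L (\<lambda>y. exp ((- 1 / \<i>) * g2 y)) (u x)"
    by (simp only:) (intro L_exp_add smooth_mult smooth_const sm)
  also have "\<dots> = 1" using real[of g1 1] real[of g2 \<i>] sm \<phi> by (simp add: g1_def g2_def)
  finally show ?thesis .
qed

text \<open>The factorization of \<open>norm_L_generic\<close> again, now with values:
  \<open>L_exp\<close> has replaced modulus 1 by 1.\<close>

lemma L_value:
  assumes x: "good x" and f: "smooth f"
  shows "L f (u x) = L (\<lambda>_. f x) (u x)"
proof (cases "f x = 0")
  case True
  then show ?thesis using L_zero[OF f True] L_zero[OF smooth_const, of "f x" x] by simp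
next
  case False
  define \<phi> where "\<phi> y = 1 - inverse (f x) * f y" for y
  have phi: "smooth \<phi>" "\<phi> x = 0" unfolding \<phi>_def using f False by (auto intro!: smooth_diff smooth_mult)
  then obtain K where K: "L (\<lambda>y. weierstrass_factor K (1 * \<phi> y)) (u x) = 1"
    using x unfolding good_def bad_order_def by blast
  define \<psi> where "\<psi> y = (\<Sum>k=1..K. \<phi> y ^ k / of_nat k)" for y
  have psi: "smooth \<psi>" "\<psi> x = 0"
    unfolding \<psi>_def using phi(2)
    by (auto intro!: smooth_sum smooth_linear[OF bounded_linear_divide] smooth_power phi(1) simp: power_0_left)
  have "L (\<lambda>y. exp (\<psi> y)) (u x) = 1" by (rule L_exp[OF x psi])
  moreover have "L (\<lambda>y. weierstrass_factor K (1 * \<phi> y)) (u x) = L (\<lambda>y. 1 - \<phi> y) (u x) * L (\<lambda>y. exp (\<psi> y)) (u x)"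
    using L_mult[OF smooth_diff[OF smooth_const phi(1)] smooth_exp[OF psi(1)], of 1]
    by (simp add: weierstrass_factor_def \<psi>_def fun_eq_iff)
  ultimately have 1: "L (\<lambda>y. 1 - \<phi> y) (u x) = 1" using K by simp
  have "L f (u x) = L (\<lambda>y. f x * (1 - \<phi> y)) (u x)" using False by (simp add: \<phi>_def mult.assoc[symmetric])
  also have "\<dots> = L (\<lambda>_. f x) (u x) * L (\<lambda>y. 1 - \<phi> y) (u x)"
    by (subst L_mult) (auto intro!: smooth_diff phi)
  finally show ?thesis using 1 by simp
qed

text \<open>By \<open>L_value\<close> the slope limit concerns only the homomorphism
  \<open>m\<close> of constants. For \<open>\<omega> = 1\<close> it makes \<open>m s / s\<close>
  converge, hence equal to 1 for positive \<open>s\<close>. Then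
  \<open>Re (m \<omega>) = Re \<omega>\<close> on the unit circle, and multiplying by the imaginary
  unit gives the imaginary parts up to the sign in \<open>m \<i>\<close>. That sign is part of the
  statement so that the alternative is the same for all \<open>c\<close>.\<close>

lemma L_const_generic:
  assumes x: "good x"
  shows "L (\<lambda>_. \<i>) (u x) = \<i> \<and> L (\<lambda>_. c) (u x) = c \<or> L (\<lambda>_. \<i>) (u x) = - \<i> \<and> L (\<lambda>_. c) (u x) = cnj c"
proof -
  fix j :: 'n
  define m where "m d = L (\<lambda>_. d) (u x)" for d
  have m_mult: "m (d * e) = m d * m e" for d e by (simp add: m_def L_const_mult)
  have m_norm: "norm (m d) = norm d" for d using norm_L[OF smooth_const] by (simp add: m_def)
  define g where "g z = complex_of_real (z $ j - x $ j)" for z :: "real^'n"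
  have g: "smooth g" "\<And>z. Im (g z) = 0" "g x = 0"
    unfolding g_def by (auto intro!: smooth_of_real smooth_diff smooth_nth)
  have pdg: "partial_deriv j g x \<noteq> 0"
  proof -
    have "has_pd j (\<lambda>z. z $ j + (- x $ j)) (\<lambda>z. (if j = j then 1 else 0) + 0)" by (rule has_pd_add[OF has_pd_nth has_pd_const])
    from has_pd_linear[OF bounded_linear_of_real this] have "has_pd j g (\<lambda>_. 1)" by (simp add: g_def[abs_def])
    then show ?thesis using has_pd_partial_deriv by fastforce
  qed
  obtain i \<gamma> where \<gamma>: "\<gamma> \<noteq> 0" "((\<lambda>t. Re (g (v (u x + t *\<^sub>R axis i 1)))) has_real_derivative \<gamma>) (at 0)"
    using coord_direction[OF g(1,2) pdg] by blast
  define B where "B = partial_deriv i (L g) (u x) / of_real \<gamma>"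
  have limit: "\<exists>c>0. norm (m (of_real c) / of_real c * B) = 1 \<and>
     ((\<lambda>s. Re (m (of_real s) * m \<omega> / of_real s * cnj (m (of_real c) / of_real c * B))) \<longlongrightarrow> Re \<omega>) (at_right 0)"
    if w: "norm \<omega> = 1" for \<omega>
  proof -
    obtain c K \<delta> where c: "c > 0" "\<delta> > 0" and taylor: "\<And>s t. 0 < s \<Longrightarrow> s < \<delta> \<Longrightarrow> \<bar>t\<bar> < \<delta> \<Longrightarrow>
       norm (L (\<lambda>y. of_real c * g y + of_real s * \<omega>) (u x + t *\<^sub>R axis i 1) - L (\<lambda>y. of_real c * g y + of_real s * \<omega>) (u x)
         - t *\<^sub>R partial_deriv i (L (\<lambda>y. of_real c * g y + of_real s * \<omega>)) (u x)) \<le> K * t\<^sup>2"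
      using taylor_bound[of x g \<omega> i] x g(1) unfolding good_def by blast
    define G where "G y = of_real c * g y" for y
    have G: "smooth G" "\<And>z. Im (G z) = 0" "G x = 0" unfolding G_def using g by (auto intro!: smooth_mult)
    have \<gamma>': "c * \<gamma> \<noteq> 0" "((\<lambda>t. Re (G (v (u x + t *\<^sub>R axis i 1)))) has_real_derivative c * \<gamma>) (at 0)"
      unfolding G_def using \<gamma>(1) c(1) DERIV_cmult[OF \<gamma>(2), of c] by simp_all
    have cont: "\<forall>\<^sub>F z in at x. z \<notin> bad_cont" using x by (simp add: good_def)
    note slope = slope_limit[OF cont G \<gamma>' c(2) taylor[folded G_def] w]
    have "partial_deriv i (L G) (u x) = m (of_real c) * partial_deriv i (L g) (u x)"
    proof -
      have "L G = (\<lambda>y. L (\<lambda>_. of_real c) y * L g y)" unfolding G_def by (rule L_mult[OF smooth_const g(1)])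
      moreover have "has_pd i (\<lambda>y. L (\<lambda>_. of_real c) y * L g y)
         (\<lambda>y. L (\<lambda>_. of_real c) y * partial_deriv i (L g) y + partial_deriv i (L (\<lambda>_. of_real c)) y * L g y)"
        by (intro has_pd_mult smooth_partial_deriv L_smooth smooth_const g)
      ultimately show ?thesis using has_pd_partial_deriv L_zero[OF g(1,3)] by (fastforce simp: m_def)
    qed
    then have \<beta>: "partial_deriv i (L G) (u x) / of_real (c * \<gamma>) = m (of_real c) / of_real c * B"
      by (simp add: B_def)
    have "L (\<lambda>y. G y + of_real s * \<omega>) (u x) = m (of_real s) * m \<omega>" for s
      using L_value[OF x smooth_add[OF G(1) smooth_const], of "of_real s * \<omega>"] by (simp add: G(3) m_def L_const_mult)
    with slope c(1) show ?thesis unfolding \<beta> by auto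
  qed
  obtain c1 where c1: "c1 > 0" "norm (m (of_real c1) / of_real c1 * B) = 1"
    "((\<lambda>s. Re (m (of_real s) * m 1 / of_real s * cnj (m (of_real c1) / of_real c1 * B))) \<longlongrightarrow> Re 1) (at_right 0)"
    using limit[of 1] by auto
  define b where "b = m (of_real c1) / of_real c1 * B"
  define k where "k s = m (of_real s) / of_real s" for s :: real
  have m1: "m 1 = 1" by (simp add: m_def L_1)
  have k_mult: "k (s * t) = k s * k t" for s t by (simp add: k_def m_mult)
  have k_norm: "norm (k s) = 1" if "s > 0" for s using that m_norm[of "of_real s"] by (simp add: k_def norm_divide)
  have Rek: "((\<lambda>s. Re (k s * cnj b)) \<longlongrightarrow> 1) (at_right 0)" using c1(3) by (simp add: k_def b_def m1)
  \<comment> \<open>Two unit vectors whose inner product tends to 1 approach each other.\<close>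
  have kb: "(k \<longlongrightarrow> b) (at_right 0)"
  proof -
    have "((\<lambda>s. sqrt (2 - 2 * Re (k s * cnj b))) \<longlongrightarrow> sqrt (2 - 2 * 1)) (at_right 0)" by (intro tendsto_intros Rek)
    moreover have "\<forall>\<^sub>F s in at_right 0. sqrt (2 - 2 * Re (k s * cnj b)) = norm (k s - b)"
      using eventually_at_right_less[of "0::real"]
    proof eventually_elim
      case (elim s)
      have "(norm (k s - b))\<^sup>2 = (norm (k s))\<^sup>2 + (norm b)\<^sup>2 - 2 * Re (k s * cnj b)"
        unfolding cmod_power2 by (simp add: power2_eq_square algebra_simps)
      then have "2 - 2 * Re (k s * cnj b) = (norm (k s - b))\<^sup>2"
        using k_norm[OF elim] c1(2)[folded b_def] by simp
      then show ?case by (simp only: real_sqrt_abs abs_norm_cancel)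
    qed
    ultimately have "((\<lambda>s. norm (k s - b)) \<longlongrightarrow> sqrt (2 - 2 * 1)) (at_right 0)" by (rule Lim_transform_eventually)
    then have "((\<lambda>s. norm (k s - b)) \<longlongrightarrow> 0) (at_right 0)" by simp
    then show ?thesis by (simp only: tendsto_norm_zero_iff LIM_zero_iff)
  qed
  have b0: "b \<noteq> 0" using c1(2) by (auto simp: b_def)
  \<comment> \<open>Rescaling \<open>s\<close> by \<open>t\<close> does not change the limit
    \<open>b\<close>, yet multiplies it by \<open>k t\<close>.\<close>
  have k1: "k t = 1" if t: "t > 0" for t
  proof -
    have "filterlim (\<lambda>s. t * s) (at_right 0) (at_right 0)"
    proof -
      have "((\<lambda>s. t * s) \<longlongrightarrow> t * 0) (at_right 0)" by (intro tendsto_intros)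
      moreover have "\<forall>\<^sub>F s in at_right (0::real). t * s \<in> {0<..} \<and> t * s \<noteq> 0"
        using eventually_at_right_less[of "0::real"] by eventually_elim (use t in auto)
      ultimately show ?thesis by (simp add: filterlim_at)
    qed
    from filterlim_compose[OF kb this] have "((\<lambda>s. k t * k s) \<longlongrightarrow> b) (at_right 0)" by (simp add: k_mult)
    moreover have "((\<lambda>s. k t * k s) \<longlongrightarrow> k t * b) (at_right 0)" by (intro tendsto_intros kb)
    ultimately have "b = k t * b" using tendsto_unique trivial_limit_at_right_real by blast
    then show ?thesis using b0 by simp
  qed
  have ms: "m (of_real t) = of_real t" if "t > 0" for t using k1[OF that] that by (simp add: k_def)
  have "b = 1"
  proof -
    have "(k \<longlongrightarrow> 1) (at_right 0)"
      by (rule tendsto_eventually) (use eventually_at_right_less[of "0::real"] k1 in \<open>auto elim: eventually_mono\<close>)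
    then show ?thesis using kb tendsto_unique trivial_limit_at_right_real by blast
  qed
  then have B: "B = 1" using ms[OF c1(1)] c1(1) by (simp add: b_def)
  have Rem: "Re (m \<omega>) = Re \<omega>" if w: "norm \<omega> = 1" for \<omega>
  proof -
    obtain c where c: "c > 0" "((\<lambda>s. Re (m (of_real s) * m \<omega> / of_real s * cnj (m (of_real c) / of_real c * B))) \<longlongrightarrow> Re \<omega>) (at_right 0)"
      using limit[OF w] by blast
    have "((\<lambda>s. Re (m (of_real s) * m \<omega> / of_real s * cnj (m (of_real c) / of_real c * B))) \<longlongrightarrow> Re (m \<omega>)) (at_right 0)"
      by (rule tendsto_eventually) (use eventually_at_right_less[of "0::real"] ms B c(1) in \<open>auto elim!: eventually_mono\<close>)
    then show ?thesis using c(2) tendsto_unique trivial_limit_at_right_real by blast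
  qed
  have "m \<i> = \<i> \<or> m \<i> = - \<i>"
  proof -
    have "Re (m \<i>) = 0" using Rem[of \<i>] by simp
    moreover have "\<bar>Im (m \<i>)\<bar> = 1" using m_norm[of \<i>] calculation by (simp add: cmod_def)
    ultimately show ?thesis by (auto simp: complex_eq_iff abs_if split: if_splits)
  qed
  moreover have unit: "Im (m \<omega>) = Im (m \<i>) * Im \<omega>" if w: "norm \<omega> = 1" for \<omega>
  proof -
    have "Re (m \<i> * m \<omega>) = - Im \<omega>" using Rem[of "\<i> * \<omega>"] w by (simp add: norm_mult m_mult)
    moreover have "Re (m \<i> * m \<omega>) = - (Im (m \<i>) * Im (m \<omega>))" using Rem[of \<i>] by simp
    ultimately show ?thesis using \<open>m \<i> = \<i> \<or> m \<i> = - \<i>\<close> by auto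
  qed
  ultimately show ?thesis
  proof (cases "c = 0")
    case True
    then have "m c = 0" using m_norm[of 0] by simp
    then show ?thesis using \<open>m \<i> = \<i> \<or> m \<i> = - \<i>\<close> True by (simp add: m_def)
  next
    case False
    then have w: "norm (sgn c) = 1" by (simp add: norm_sgn)
    have ns: "of_real (norm c) * sgn c = c" using False by (simp add: sgn_div_norm scaleR_conv_of_real)
    have mc: "m c = of_real (norm c) * m (sgn c)"
      using m_mult[of "of_real (norm c)" "sgn c"] ms[of "norm c"] False by (simp only: ns zero_less_norm_iff not_False_eq_True)
    consider "m \<i> = \<i>" | "m \<i> = - \<i>" using \<open>m \<i> = \<i> \<or> m \<i> = - \<i>\<close> by blast
    then show ?thesis
    proof cases
      case 1
      then have "m (sgn c) = sgn c" using unit[OF w] Rem[OF w] by (simp add: complex_eq_iff)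
      then have "m c = c" by (simp only: mc ns)
      then show ?thesis using 1 by (simp add: m_def)
    next
      case 2
      then have "m (sgn c) = cnj (sgn c)" using unit[OF w] Rem[OF w] by (simp add: complex_eq_iff)
      then have "m c = cnj (of_real (norm c) * sgn c)" by (simp add: mc)
      then show ?thesis using 2 unfolding ns by (simp add: m_def)
    qed
  qed
qed

text \<open>The image of the constant imaginary unit is continuous with two possible values, so
  connectedness makes the alternative global; density of the good points does the rest.\<close>

theorem L_form:
  "(\<forall>f. smooth f \<longrightarrow> (\<forall>x. L f (u x) = f x)) \<or> (\<forall>f. smooth f \<longrightarrow> (\<forall>x. L f (u x) = cnj (f x)))"
proof -
  have s: "L (\<lambda>_. \<i>) (u x) \<in> {\<i>, - \<i>}" for x
  proof -
    obtain X where X: "\<And>k. good (X k)" "X \<longlonglongrightarrow> x" using discrete_set_seq[OF good_generic, of x] by auto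
    show ?thesis
      by (rule Lim_in_closed_set[OF _ _ _ tendsto_Lu[OF smooth_const X(2)]])
        (use L_const_generic[OF X(1)] in \<open>auto intro!: always_eventually\<close>)
  qed
  have "connected (range (\<lambda>x. L (\<lambda>_. \<i>) (u x)))"
    by (intro connected_continuous_image cont_Lu smooth_const connected_UNIV)
  moreover have "finite (range (\<lambda>x. L (\<lambda>_. \<i>) (u x)))"
    by (rule finite_subset[of _ "{\<i>, - \<i>}"]) (use s in auto)
  ultimately obtain a where a: "range (\<lambda>x. L (\<lambda>_. \<i>) (u x)) = {a}"
    using connected_finite_iff_sing by blast
  then have a': "L (\<lambda>_. \<i>) (u x) = a" for x by blast
  have "a = \<i> \<or> a = - \<i>" using s[of 0] a' by auto
  then show ?thesis
  proof
    assume "a = \<i>"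
    have ii: "\<i> \<noteq> - \<i>" by (simp add: complex_eq_iff)
    have "L f (u x) = f x" if f: "smooth f" for f x
    proof (rule discrete_set_eqI[OF good_generic cont_Lu[OF f] smooth_continuous[OF f]])
      fix x assume "x \<notin> {x. \<not> good x}"
      then have "good x" by simp
      then show "L f (u x) = f x"
        using L_value[OF \<open>good x\<close> f] L_const_generic[OF \<open>good x\<close>, of "f x"] a'[of x] \<open>a = \<i>\<close> ii by auto
    qed
    then show ?thesis by blast
  next
    assume "a = - \<i>"
    have ii: "\<i> \<noteq> - \<i>" by (simp add: complex_eq_iff)
    have "L f (u x) = cnj (f x)" if f: "smooth f" for f x
    proof (rule discrete_set_eqI[OF good_generic cont_Lu[OF f] smooth_continuous[OF smooth_cnj[OF f]]])
      fix x assume "x \<notin> {x. \<not> good x}"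
      then have "good x" by simp
      then show "L f (u x) = cnj (f x)"
        using L_value[OF \<open>good x\<close> f] L_const_generic[OF \<open>good x\<close>, of "f x"] a'[of x] \<open>a = - \<i>\<close> ii by auto
    qed
    then show ?thesis by blast
  qed
qed

text \<open>Coordinates are real, so in either alternative \<open>L\<close> sends them to the
  coordinates of \<open>v\<close>.\<close>

lemma smooth_v: "smooth v"
proof -
  have nth: "smooth (\<lambda>y. v y $ i)" for i
  proof -
    have "L (\<lambda>z. complex_of_real (z $ i)) (u (v y)) = complex_of_real (v y $ i)" for y
      using L_form smooth_coord[of i] by (metis complex_cnj_complex_of_real)
    then have "L (\<lambda>z. complex_of_real (z $ i)) = (\<lambda>y. complex_of_real (v y $ i))" by (simp add: uv fun_eq_iff)
    then have "smooth (\<lambda>y. complex_of_real (v y $ i))" using L_smooth[OF smooth_coord[of i]] by simp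
    from smooth_linear[OF bounded_linear_Re this] show ?thesis by simp
  qed
  have "smooth (\<lambda>y. \<Sum>i\<in>UNIV. v y $ i *\<^sub>R (axis i 1 :: real^'n))"
    by (intro smooth_sum smooth_linear[OF bounded_linear_scaleR_left] nth)
  moreover have "(\<lambda>y. \<Sum>i\<in>UNIV. v y $ i *\<^sub>R (axis i 1 :: real^'n)) = v"
    using basis_expansion[of "v _"] by (simp add: scalar_mult_eq_scaleR fun_eq_iff)
  ultimately show ?thesis by simp
qed

lemma u_diffeo: "smooth_diffeo u"
proof -
  have "bij u" using uv vu by (metis bijI')
  moreover have "inv u = v" using uv vu by (metis inv_unique_comp comp_def eq_id_iff)
  ultimately show ?thesis
    using smooth_v mult_iso.smooth_v[OF swap] by (simp add: smooth_diffeo_def)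
qed

end

section \<open>Multiplicative bijections of the Schwartz space\<close>

lemma schwartz_smooth: "f \<in> schwartz \<Longrightarrow> smooth f"
  by (simp add: schwartz_def)

lemma schwartz_bound:
  assumes "f \<in> schwartz"
  shows "\<exists>C\<ge>0. \<forall>x. norm (iter_pderiv js f x) * (1 + norm x ^ l) \<le> C"
proof -
  obtain C where C: "\<And>x. norm (iter_pderiv js f x) * (1 + norm x ^ l) \<le> C"
    using assms unfolding schwartz_def by blast
  have "0 \<le> norm (iter_pderiv js f 0) * (1 + norm (0 :: real^'a) ^ l)" by simp
  then have "0 \<le> C" using C[of 0] by linarith
  then show ?thesis using C by blast
qed

text \<open>Polynomial growth of every derivative: these functions multiply the Schwartz space into
  itself, which covers constants, coordinates and characters at once.\<close>

definition temperate :: "(real^'n::finite \<Rightarrow> complex) \<Rightarrow> bool" where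
  "temperate f \<longleftrightarrow> smooth f \<and> (\<forall>js. \<exists>C k. \<forall>x. norm (iter_pderiv js f x) \<le> C * (1 + norm x ^ k))"

lemma temperate_smooth: "temperate f \<Longrightarrow> smooth f"
  by (simp add: temperate_def)

lemma temperate_partial_deriv: "temperate f \<Longrightarrow> temperate (partial_deriv i f)"
  unfolding temperate_def by (auto simp: smooth_partial_deriv iter_pderiv_append[symmetric])

lemma schwartz_partial_deriv: "f \<in> schwartz \<Longrightarrow> partial_deriv i f \<in> schwartz"
  unfolding schwartz_def by (auto simp: smooth_partial_deriv iter_pderiv_append[symmetric])

lemma schwartz_temperate: assumes "f \<in> schwartz" shows "temperate f"
  unfolding temperate_def
proof (intro conjI allI)
  show "smooth f" by (rule schwartz_smooth[OF assms])
  fix js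
  obtain C where C: "C \<ge> 0" "\<And>x. norm (iter_pderiv js f x) * (1 + norm x ^ 0) \<le> C" using schwartz_bound[OF assms] by blast
  have "norm (iter_pderiv js f x) \<le> C * (1 + norm x ^ 0)" for x
    using C(2)[of x] C(1) by simp
  then show "\<exists>C k. \<forall>x. norm (iter_pderiv js f x) \<le> C * (1 + norm x ^ k)" by blast
qed

text \<open>Peeling off the innermost derivative, the Leibniz rule yields two products of the same
  kind, so the induction runs without a binomial formula.\<close>

lemma temperate_mult_schwartz:
  assumes "temperate f" "g \<in> schwartz"
  shows "(\<lambda>x. f x * g x) \<in> schwartz"
proof -
  have "\<forall>l. \<exists>C. \<forall>x. norm (iter_pderiv js (\<lambda>x. f x * g x) x) * (1 + norm x ^ l) \<le> C" for js
    using assms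
  proof (induction js arbitrary: f g rule: rev_induct)
    case Nil
    show ?case
    proof
      fix l
      obtain C k where C: "\<And>x. norm (iter_pderiv [] f x) \<le> C * (1 + norm x ^ k)"
        using Nil(1) unfolding temperate_def by blast
      have C0: "C \<ge> 0" using C[of 0] order_trans[OF norm_ge_zero] by (fastforce simp: zero_le_mult_iff power_0_left split: if_splits)
      obtain D1 D2 D3 where D: "\<And>x. norm (g x) * (1 + norm x ^ l) \<le> D1" "\<And>x. norm (g x) * (1 + norm x ^ k) \<le> D2"
        "\<And>x. norm (g x) * (1 + norm x ^ (k + l)) \<le> D3"
        using schwartz_bound[OF Nil(2), of "[]"] by (metis iter_pderiv.simps(1))
      have "norm (f x * g x) * (1 + norm x ^ l) \<le> C * (D1 + D2 + D3)" for x
      proof -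
        have "norm (f x * g x) * (1 + norm x ^ l) \<le> (C * (1 + norm x ^ k)) * norm (g x) * (1 + norm x ^ l)"
          unfolding norm_mult using C[of x] by (intro mult_right_mono) auto
        also have "\<dots> = C * (norm (g x) * (1 + norm x ^ l) + norm (g x) * norm x ^ k + norm (g x) * norm x ^ (k + l))"
          by (simp add: algebra_simps power_add)
        also have "\<dots> \<le> C * (D1 + D2 + D3)"
          using D[of x] by (intro mult_left_mono[OF _ C0] add_mono) (auto simp: distrib_left intro: order_trans[rotated])
        finally show ?thesis .
      qed
      then show "\<exists>C. \<forall>x. norm (iter_pderiv [] (\<lambda>x. f x * g x) x) * (1 + norm x ^ l) \<le> C" by auto
    qed
  next
    case (snoc i js)
    have sm: "smooth f" "smooth g" using snoc.prems by (auto simp: temperate_smooth schwartz_smooth)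
    have "partial_deriv i (\<lambda>x. f x * g x) = (\<lambda>x. f x * partial_deriv i g x + partial_deriv i f x * g x)"
      by (rule has_pd_partial_deriv[OF has_pd_mult]) (intro smooth_partial_deriv sm)+
    then have eq: "iter_pderiv (js @ [i]) (\<lambda>x. f x * g x) =
        (\<lambda>x. iter_pderiv js (\<lambda>x. f x * partial_deriv i g x) x + iter_pderiv js (\<lambda>x. partial_deriv i f x * g x) x)"
      by (simp only: iter_pderiv_append) (rule iter_pderiv_add; intro smooth_mult smooth_partial_deriv sm)
    show ?case
    proof
      fix l
      obtain C1 where C1: "\<And>x. norm (iter_pderiv js (\<lambda>x. f x * partial_deriv i g x) x) * (1 + norm x ^ l) \<le> C1"
        using snoc.IH[OF snoc.prems(1) schwartz_partial_deriv[OF snoc.prems(2)]] by blast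
      obtain C2 where C2: "\<And>x. norm (iter_pderiv js (\<lambda>x. partial_deriv i f x * g x) x) * (1 + norm x ^ l) \<le> C2"
        using snoc.IH[OF temperate_partial_deriv[OF snoc.prems(1)] snoc.prems(2)] by blast
      have "norm (iter_pderiv (js @ [i]) (\<lambda>x. f x * g x) x) * (1 + norm x ^ l) \<le> C1 + C2" for x
      proof -
        have "norm (iter_pderiv (js @ [i]) (\<lambda>x. f x * g x) x) * (1 + norm x ^ l) \<le>
          (norm (iter_pderiv js (\<lambda>x. f x * partial_deriv i g x) x) + norm (iter_pderiv js (\<lambda>x. partial_deriv i f x * g x) x)) * (1 + norm x ^ l)"
          unfolding eq by (intro mult_right_mono norm_triangle_ineq) auto
        then show ?thesis using C1[of x] C2[of x] by (simp add: distrib_right)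
      qed
      then show "\<exists>C. \<forall>x. norm (iter_pderiv (js @ [i]) (\<lambda>x. f x * g x) x) * (1 + norm x ^ l) \<le> C" by blast
    qed
  qed
  moreover have "smooth (\<lambda>x. f x * g x)" using assms by (intro smooth_mult) (auto simp: temperate_smooth schwartz_smooth)
  ultimately show ?thesis by (simp add: schwartz_def)
qed

lemma schwartz_mult: "f \<in> schwartz \<Longrightarrow> g \<in> schwartz \<Longrightarrow> (\<lambda>x. f x * g x) \<in> schwartz"
  by (rule temperate_mult_schwartz[OF schwartz_temperate])

lemma compact_support_schwartz:
  fixes f :: "real^'n::finite \<Rightarrow> complex"
  assumes "smooth f" "\<And>y. \<rho> \<le> dist x y \<Longrightarrow> f y = 0"
  shows "f \<in> schwartz"
  unfolding schwartz_def
proof (intro CollectI conjI allI assms(1))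
  fix l and js :: "'n list"
  let ?h = "\<lambda>y. norm (iter_pderiv js f y) * (1 + norm y ^ l)"
  have "bounded (?h ` cball x \<rho>)"
    by (intro compact_imp_bounded compact_continuous_image continuous_intros continuous_on_subset[OF smooth_continuous[OF smooth_iter_pderiv[OF assms(1)]]]) auto
  then obtain C where "\<forall>z\<in>?h ` cball x \<rho>. norm z \<le> C" unfolding bounded_iff by blast
  then have C: "?h y \<le> C" if "y \<in> cball x \<rho>" for y using that by fastforce
  have "?h y \<le> max C 0" for y
  proof (cases "y \<in> cball x \<rho>")
    case True then show ?thesis using C by fastforce
  next
    case False
    then show ?thesis
      using iter_pderiv_outside[where x = x and \<rho> = \<rho> and h = f and y = y and js = js] assms(2) by auto
  qed
  then show "\<exists>C. \<forall>y. ?h y \<le> C" by blast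
qed

lemma bump_schwartz: "r > 0 \<Longrightarrow> bump x r \<in> schwartz"
  by (rule compact_support_schwartz[OF smooth_bump, of r x]) (auto intro: bump_outside)

lemma bump_mult_schwartz: "r > 0 \<Longrightarrow> smooth f \<Longrightarrow> (\<lambda>z. bump x r z * f z) \<in> schwartz"
  by (rule compact_support_schwartz[of _ r x]) (auto intro!: smooth_mult smooth_bump simp: bump_outside)

lemma schwartz_0: "(\<lambda>_. 0) \<in> schwartz"
  by (rule compact_support_schwartz[of _ 0 0]) auto

lemma schwartz_level_compact:
  assumes "h \<in> schwartz"
  shows "compact {y. h y = 1}"
proof -
  obtain C where C: "\<And>x. norm (iter_pderiv [] h x) * (1 + norm x ^ 1) \<le> C" using schwartz_bound[OF assms] by blast
  have "norm y \<le> C" if "h y = 1" for y using C[of y] that by simp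
  then have "bounded {y. h y = 1}" by (auto simp: bounded_iff)
  moreover have "closed {y. h y = 1}"
    using smooth_continuous[OF schwartz_smooth[OF assms]] by (intro closed_Collect_eq) (auto intro: continuous_intros)
  ultimately show ?thesis by (simp add: compact_eq_bounded_closed)
qed

section \<open>Recovering points from products\<close>

locale schwartz_mult_iso =
  fixes T U :: "(real^'n::finite \<Rightarrow> complex) \<Rightarrow> real^'n \<Rightarrow> complex"
  assumes T_S: "f \<in> schwartz \<Longrightarrow> T f \<in> schwartz" and U_S: "f \<in> schwartz \<Longrightarrow> U f \<in> schwartz"
    and TU: "f \<in> schwartz \<Longrightarrow> T (U f) = f" and UT: "f \<in> schwartz \<Longrightarrow> U (T f) = f"
    and T_mult: "f \<in> schwartz \<Longrightarrow> g \<in> schwartz \<Longrightarrow> T (\<lambda>x. f x * g x) = (\<lambda>x. T f x * T g x)"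
    and U_mult: "f \<in> schwartz \<Longrightarrow> g \<in> schwartz \<Longrightarrow> U (\<lambda>x. f x * g x) = (\<lambda>x. U f x * U g x)"
begin

lemma swap: "schwartz_mult_iso U T"
  by unfold_locales (fact T_S U_S TU UT T_mult U_mult)+

lemma T_0: "T (\<lambda>_. 0) = (\<lambda>_. 0)"
  using T_mult[OF schwartz_0 U_S[OF schwartz_0]] TU[OF schwartz_0] by simp

definition near1 :: "real^'n \<Rightarrow> (real^'n \<Rightarrow> complex) \<Rightarrow> bool" where
  "near1 x g \<longleftrightarrow> g \<in> schwartz \<and> (\<forall>\<^sub>F z in nhds x. g z = 1)"

definition core :: "real^'n \<Rightarrow> (real^'n) set" where
  "core x = {y. \<forall>g. near1 x g \<longrightarrow> T g y = 1}"

lemma near1_bump: "r > 0 \<Longrightarrow> near1 x (bump x r)"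
  by (simp add: near1_def bump_schwartz bump_1_ev)

lemma near1_ball:
  assumes "near1 x g" shows "\<exists>r>0. \<forall>z\<in>ball x r. g z = 1"
  using assms unfolding near1_def eventually_nhds_metric by (auto simp: dist_commute)

text \<open>Finite intersection property of compact level sets. Finitely many functions equal to 1
  near \<open>x\<close> share a ball; a bump \<open>b\<close> in it satisfies
  \<open>b g = b\<close>, which forces \<open>T g = 1\<close> wherever \<open>T b\<close> is
  nonzero, and \<open>T b\<close> is not identically 0 by injectivity.\<close>

lemma core_nonempty: "core x \<noteq> {}"
proof -
  define F where "F = (\<lambda>g. {y. T g y = 1}) ` {g. near1 x g}"
  let ?S = "{y. T (bump x 1) y = 1}"
  have "?S \<inter> \<Inter>F \<noteq> {}"
  proof (rule compact_imp_fip)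
    show "compact ?S" by (intro schwartz_level_compact T_S bump_schwartz) simp
    show "closed S" if "S \<in> F" for S
      using that unfolding F_def near1_def by (auto intro: compact_imp_closed schwartz_level_compact T_S)
    fix F' assume F': "finite F'" "F' \<subseteq> F"
    then obtain H where H: "finite H" "H \<subseteq> {g. near1 x g}" "F' = (\<lambda>g. {y. T g y = 1}) ` H"
      unfolding F_def by (meson finite_subset_image)
    define H1 where "H1 = insert (bump x 1) H"
    have H1: "finite H1" "\<And>g. g \<in> H1 \<Longrightarrow> near1 x g" using H near1_bump[of 1 x] by (auto simp: H1_def)
    have "\<forall>\<^sub>F z in nhds x. \<forall>g\<in>H1. g z = 1"
      using H1 by (intro eventually_ball_finite) (auto simp: near1_def)
    then obtain r where r: "r > 0" "\<And>z g. z \<in> ball x r \<Longrightarrow> g \<in> H1 \<Longrightarrow> g z = 1"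
      unfolding eventually_nhds_metric by (auto simp: dist_commute)
    have fg: "(\<lambda>z. bump x r z * g z) = bump x r" if "g \<in> H1" for g
    proof
      fix z show "bump x r z * g z = bump x r z"
        using r(2)[of z g] that bump_outside[OF r(1), of x z] by (cases "z \<in> ball x r") auto
    qed
    have "bump x r \<noteq> (\<lambda>_. 0)" using bump_1[OF r(1), of x x] r(1) by (metis dist_self half_gt_zero less_imp_le zero_neq_one)
    then have "T (bump x r) \<noteq> (\<lambda>_. 0)"
      using UT[OF bump_schwartz[OF r(1)], of x] UT[OF schwartz_0] T_0 by metis
    then obtain y where y: "T (bump x r) y \<noteq> 0" by auto
    have "T g y = 1" if "g \<in> H1" for g
    proof -
      have "T (bump x r) y * T g y = T (bump x r) y"
        using T_mult[OF bump_schwartz[OF r(1)], of g x] H1(2)[OF that] fg[OF that] by (simp add: near1_def fun_eq_iff)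
      then show ?thesis using y by simp
    qed
    then show "?S \<inter> \<Inter>F' \<noteq> {}" by (auto simp: H(3) H1_def)
  qed
  then show ?thesis by (auto simp: F_def core_def)
qed

text \<open>Otherwise a bump at \<open>x\<close> times \<open>U a\<close> is 0, although both
  factors have images with value 1 at \<open>y\<close>.\<close>

lemma core_support:
  assumes y: "y \<in> core x" and a: "near1 y a" and r: "r > 0"
  shows "\<exists>z\<in>ball x r. U a z \<noteq> 0"
proof (rule ccontr)
  assume "\<not> ?thesis"
  then have "(\<lambda>z. bump x r z * U a z) = (\<lambda>_. 0)" using bump_outside[OF r, of x] by (force simp: fun_eq_iff)
  then have "T (\<lambda>z. bump x r z * U a z) y = 0" by (simp add: T_0)
  moreover have "T (\<lambda>z. bump x r z * U a z) = (\<lambda>z. T (bump x r) z * T (U a) z)"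
    using a by (intro T_mult bump_schwartz[OF r] U_S) (simp add: near1_def)
  moreover have "T (U a) = a" using a TU by (simp add: near1_def)
  moreover have "T (bump x r) y = 1" using y near1_bump[OF r] by (simp add: core_def)
  moreover have "a y = 1" using a by (auto simp: near1_def dest: eventually_nhds_x_imp_x)
  ultimately show False by simp
qed

lemma near1_bump_mult:
  assumes "near1 y h"
  shows "\<exists>r>0. \<forall>s. 0 < s \<longrightarrow> s \<le> r \<longrightarrow> (\<lambda>z. bump y s z * h z) = bump y s"
proof -
  obtain r where r: "r > 0" "\<And>z. z \<in> ball y r \<Longrightarrow> h z = 1" using near1_ball[OF assms] by blast
  have "bump y s z * h z = bump y s z" if "0 < s" "s \<le> r" for s z
    using r(2)[of z] bump_outside[OF that(1), of y z] that by (cases "z \<in> ball y s") auto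
  then show ?thesis using r(1) by (auto simp: fun_eq_iff)
qed

text \<open>Take bumps \<open>b\<close>, \<open>a\<close> at \<open>y\<close> with
  \<open>b a = b\<close> and \<open>a h = a\<close>. \<open>U b\<close> is nonzero at points tending
  to \<open>x\<close>, so \<open>U a\<close> is 1 there and, by continuity, at \<open>x\<close>;
  hence \<open>U a\<close> is nonzero near \<open>x\<close>, which forces \<open>U h = 1\<close>
  there.\<close>

lemma core_near1:
  assumes y: "y \<in> core x" and h: "near1 y h"
  shows "near1 x (U h)"
proof -
  obtain r where r: "r > 0" "\<And>s. 0 < s \<Longrightarrow> s \<le> r \<Longrightarrow> (\<lambda>z. bump y s z * h z) = bump y s" using near1_bump_mult[OF h] by blast
  let ?a = "bump y r"
  have a: "near1 y ?a" by (rule near1_bump[OF r(1)])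
  obtain s where s: "s > 0" "(\<lambda>z. bump y s z * ?a z) = bump y s" using near1_bump_mult[OF a] by blast
  have S: "h \<in> schwartz" "?a \<in> schwartz" "bump y s \<in> schwartz" using h r s by (auto simp: near1_def bump_schwartz)
  have 1: "U ?a z * U h z = U ?a z" for z using U_mult[OF S(2,1)] r by (simp add: fun_eq_iff)
  have 2: "U (bump y s) z * U ?a z = U (bump y s) z" for z using U_mult[OF S(3,2)] s by (simp add: fun_eq_iff)
  have cont: "continuous_on UNIV (U ?a)" by (intro smooth_continuous schwartz_smooth U_S S)
  have "U ?a x = 1"
  proof -
    have "\<exists>z. dist z x < inverse (real (Suc n)) \<and> U ?a z = 1" for n
    proof -
      obtain z where "z \<in> ball x (inverse (real (Suc n)))" "U (bump y s) z \<noteq> 0"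
        using core_support[OF y near1_bump[OF s(1)], of "inverse (real (Suc n))"] by auto
      then show ?thesis using 2[of z] by (intro exI[of _ z]) (auto simp: dist_commute)
    qed
    then obtain Z where Z: "\<And>n. dist (Z n) x < inverse (real (Suc n))" "\<And>n. U ?a (Z n) = 1" by metis
    have "Z \<longlonglongrightarrow> x"
      by (rule metric_tendsto_imp_tendsto[OF LIMSEQ_inverse_real_of_nat]) (use Z(1) in \<open>auto intro!: always_eventually less_imp_le\<close>)
    then have "(\<lambda>n. U ?a (Z n)) \<longlonglongrightarrow> U ?a x" by (rule continuous_on_tendsto_compose[OF cont]) auto
    then show ?thesis by (simp add: Z(2) LIMSEQ_const_iff)
  qed
  then have "x \<in> {z. U ?a z \<noteq> 0}" by simp
  moreover have "open {z. U ?a z \<noteq> 0}" by (intro open_Collect_neq cont continuous_on_const)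
  ultimately have "\<forall>\<^sub>F z in nhds x. U ?a z \<noteq> 0" using eventually_nhds_in_open by fastforce
  then have "\<forall>\<^sub>F z in nhds x. U h z = 1"
    by (rule eventually_mono) (use 1 in force)
  then show ?thesis using S by (simp add: near1_def U_S)
qed

text \<open>Disjoint bumps at two candidates have product 0, but \<open>U\<close> of each is 1 at
  \<open>x\<close>.\<close>

lemma core_unique:
  assumes "y \<in> core x" "y' \<in> core x" shows "y = y'"
proof (rule ccontr)
  assume "y \<noteq> y'"
  define r where "r = dist y y' / 2"
  have r: "r > 0" using \<open>y \<noteq> y'\<close> by (simp add: r_def)
  have "bump y r z * bump y' r z = 0" for z
  proof (cases "r \<le> dist y z")
    case False
    then have "r \<le> dist y' z" using dist_triangle2[of y y' z] by (simp add: r_def dist_commute)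
    then show ?thesis using bump_outside[OF r, of y' z] by simp
  qed (simp add: bump_outside[OF r])
  then have "(\<lambda>z. bump y r z * bump y' r z) = (\<lambda>_. 0)" by (simp only:)
  then have "U (\<lambda>z. bump y r z * bump y' r z) x = 0" using schwartz_mult_iso.T_0[OF swap] by (simp only:)
  then have "U (bump y r) x * U (bump y' r) x = 0" using U_mult[OF bump_schwartz[OF r] bump_schwartz[OF r]] by simp
  moreover have "U (bump y r) x = 1" "U (bump y' r) x = 1"
    using core_near1[OF assms(1) near1_bump[OF r]] core_near1[OF assms(2) near1_bump[OF r]]
    by (auto simp: near1_def dest: eventually_nhds_x_imp_x)
  ultimately show False by simp
qed

definition pt :: "real^'n \<Rightarrow> real^'n" where "pt x = (SOME y. y \<in> core x)"

lemma pt_core: "pt x \<in> core x"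
  unfolding pt_def using core_nonempty[of x] some_in_eq by blast

lemma pt_inverse: "schwartz_mult_iso.pt U (pt x) = x"
proof -
  interpret inv: schwartz_mult_iso U T by (rule swap)
  have "x \<in> inv.core (pt x)"
    unfolding inv.core_def using core_near1[OF pt_core] by (auto simp: near1_def dest: eventually_nhds_x_imp_x)
  then show ?thesis using inv.core_unique[OF inv.pt_core] by blast
qed

lemma near1_T:
  assumes "near1 x g" shows "near1 (pt x) (T g)"
proof -
  interpret inv: schwartz_mult_iso U T by (rule swap)
  have "x \<in> inv.core (pt x)" using inv.pt_core[of "pt x"] pt_inverse by simp
  from inv.core_near1[OF this] assms show ?thesis .
qed

lemma near1_U: "near1 (pt x) h \<Longrightarrow> near1 x (U h)"
  by (rule core_near1[OF pt_core])

text \<open>The products with a small bump agree, and the image of the bump is 1 at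
  \<open>pt x\<close>.\<close>

lemma T_local:
  assumes "f \<in> schwartz" "g \<in> schwartz" "\<forall>\<^sub>F z in nhds x. f z = g z"
  shows "T f (pt x) = T g (pt x)"
proof -
  obtain r where r: "r > 0" "\<And>z. dist z x < r \<Longrightarrow> f z = g z" using assms(3) unfolding eventually_nhds_metric by blast
  have "(\<lambda>z. bump x r z * f z) = (\<lambda>z. bump x r z * g z)"
  proof
    fix z show "bump x r z * f z = bump x r z * g z"
      using r(2)[of z] bump_outside[OF r(1), of x z] by (cases "dist z x < r") (auto simp: dist_commute)
  qed
  then have "T (bump x r) (pt x) * T f (pt x) = T (bump x r) (pt x) * T g (pt x)"
    using T_mult[OF bump_schwartz[OF r(1)]] assms by (metis (no_types, lifting))
  moreover have "T (bump x r) (pt x) = 1" using pt_core near1_bump[OF r(1)] by (simp add: core_def)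
  ultimately show ?thesis by simp
qed

text \<open>If \<open>U\<close> of a bump at \<open>pt x\<close> is 1 near \<open>z\<close>, then
  that bump is 1 at \<open>pt z\<close>, so \<open>pt z\<close> lies within its radius.\<close>

lemma cont_pt: "continuous_on UNIV pt"
proof -
  have "isCont pt x" for x
    unfolding continuous_at_eps_delta
  proof (intro allI impI)
    fix e :: real assume e: "e > 0"
    have "near1 x (U (bump (pt x) e))" by (rule near1_U[OF near1_bump[OF e]])
    then obtain r where r: "r > 0" "\<And>z. z \<in> ball x r \<Longrightarrow> U (bump (pt x) e) z = 1" using near1_ball by blast
    have "dist (pt z) (pt x) < e" if z: "dist z x < r" for z
    proof -
      have "\<forall>\<^sub>F w in nhds z. U (bump (pt x) e) w = 1"
        by (rule eventually_mono[OF eventually_nhds_in_open[of "ball x r"]]) (use z r in \<open>auto simp: dist_commute\<close>)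
      then have "near1 z (U (bump (pt x) e))" by (simp add: near1_def U_S bump_schwartz e)
      from near1_T[OF this] have "bump (pt x) e (pt z) = 1"
        by (auto simp: near1_def TU bump_schwartz e dest: eventually_nhds_x_imp_x)
      then show ?thesis using bump_outside[OF e, of "pt x" "pt z"] by (force simp: dist_commute)
    qed
    then show "\<exists>d>0. \<forall>z. dist z x < d \<longrightarrow> dist (pt z) (pt x) < e" using r(1) by blast
  qed
  then show ?thesis by (simp add: continuous_at_imp_continuous_on)
qed

section \<open>Extension from Schwartz functions to smooth functions\<close>

text \<open>The cutoff is centred at the preimage of \<open>y\<close> and moves with
  \<open>y\<close>; by locality every cutoff equal to 1 near that preimage gives the same
  value.\<close>

definition ext :: "(real^'n \<Rightarrow> complex) \<Rightarrow> real^'n \<Rightarrow> complex" where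
  "ext f y = T (\<lambda>z. bump (schwartz_mult_iso.pt U y) 1 z * f z) y"

lemma ext_pt: "ext f (pt x) = T (\<lambda>z. bump x 1 z * f z) (pt x)"
  by (simp add: ext_def pt_inverse)

lemma pt_inverse': "pt (schwartz_mult_iso.pt U y) = y"
  using schwartz_mult_iso.pt_inverse[OF swap] .

lemma ext_eq:
  assumes "smooth f" "g \<in> schwartz" "\<forall>\<^sub>F z in nhds x. f z = g z"
  shows "ext f (pt x) = T g (pt x)"
  unfolding ext_pt
proof (rule T_local[OF bump_mult_schwartz[OF _ assms(1)] assms(2)])
  show "\<forall>\<^sub>F z in nhds x. bump x 1 z * f z = g z"
    using eventually_conj[OF bump_1_ev[of 1 x, OF zero_less_one] assms(3)] by (rule eventually_mono) auto
qed simp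

text \<open>One fixed cutoff represents \<open>ext f\<close> on a whole neighbourhood, so smoothness
  follows from \<open>smooth_local\<close> despite the moving centre.\<close>

lemma ext_eq_near:
  assumes "smooth f"
  shows "\<forall>\<^sub>F y in nhds (pt x). ext f y = T (\<lambda>z. bump x 1 z * f z) y"
proof -
  let ?v = "schwartz_mult_iso.pt U"
  have "open (?v -` ball x (1/2))" by (rule open_vimage[OF open_ball schwartz_mult_iso.cont_pt[OF swap]])
  from eventually_nhds_in_open[OF this, of "pt x"]
  have "\<forall>\<^sub>F y in nhds (pt x). y \<in> ?v -` ball x (1/2)" by (simp add: pt_inverse)
  then show ?thesis
  proof eventually_elim
    case (elim y)
    have "\<forall>\<^sub>F z in nhds (?v y). f z = bump x 1 z * f z"
      by (rule eventually_mono[OF eventually_nhds_in_open[of "ball x (1/2)"]]) (use elim in \<open>auto simp: bump_1\<close>)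
    from ext_eq[OF assms bump_mult_schwartz[OF _ assms] this]
    show ?case by (simp add: pt_inverse')
  qed
qed

lemma smooth_ext:
  assumes "smooth f" shows "smooth (ext f)"
proof (rule smooth_local)
  fix y
  let ?x = "schwartz_mult_iso.pt U y"
  have "smooth (T (\<lambda>z. bump ?x 1 z * f z))" by (intro schwartz_smooth T_S bump_mult_schwartz assms) simp
  moreover have "\<forall>\<^sub>F z in nhds y. ext f z = T (\<lambda>z. bump ?x 1 z * f z) z"
    using ext_eq_near[OF assms, of ?x] by (simp add: pt_inverse')
  ultimately show "\<exists>g. smooth g \<and> (\<forall>\<^sub>F z in nhds y. ext f z = g z)" by blast
qed

lemma ext_mult:
  assumes "smooth f" "smooth g"
  shows "ext (\<lambda>x. f x * g x) = (\<lambda>y. ext f y * ext g y)"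
proof
  fix y
  let ?x = "schwartz_mult_iso.pt U y"
  let ?f = "\<lambda>z. bump ?x 1 z * f z" and ?g = "\<lambda>z. bump ?x 1 z * g z"
  have S: "?f \<in> schwartz" "?g \<in> schwartz" by (intro bump_mult_schwartz assms; simp)+
  have "ext (\<lambda>x. f x * g x) (pt ?x) = T (\<lambda>z. ?f z * ?g z) (pt ?x)"
  proof (rule ext_eq[OF smooth_mult[OF assms] schwartz_mult[OF S]])
    show "\<forall>\<^sub>F z in nhds ?x. f z * g z = ?f z * ?g z" using bump_1_ev[of 1 ?x] by (auto elim!: eventually_mono)
  qed
  then show "ext (\<lambda>x. f x * g x) y = ext f y * ext g y" using T_mult[OF S] by (simp add: pt_inverse' ext_def)
qed

lemma ext_local:
  assumes "smooth f" "smooth g" "\<forall>\<^sub>F z in nhds x. f z = g z"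
  shows "ext f (pt x) = ext g (pt x)"
  unfolding ext_pt by (rule T_local[OF bump_mult_schwartz[OF _ assms(1)] bump_mult_schwartz[OF _ assms(2)]]) (use assms(3) in \<open>auto elim: eventually_mono\<close>)

lemma ext_inverse:
  assumes "smooth f" shows "ext (schwartz_mult_iso.ext U T f) = f"
proof
  fix y
  interpret inv: schwartz_mult_iso U T by (rule swap)
  let ?x = "inv.pt y"
  let ?f = "\<lambda>z. bump y 1 z * f z"
  have S: "?f \<in> schwartz" by (intro bump_mult_schwartz assms) simp
  have "\<forall>\<^sub>F z in nhds ?x. inv.ext f z = U ?f z" using inv.ext_eq_near[OF assms, of y] .
  from ext_eq[OF inv.smooth_ext[OF assms] U_S[OF S] this]
  show "ext (inv.ext f) y = f y" by (simp add: pt_inverse' TU[OF S] bump_1)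
qed

theorem mult_iso_ext: "mult_iso ext (schwartz_mult_iso.ext U T) pt (schwartz_mult_iso.pt U)"
proof -
  interpret inv: schwartz_mult_iso U T by (rule swap)
  show ?thesis
    by unfold_locales
      (fact smooth_ext inv.smooth_ext ext_mult inv.ext_mult ext_inverse inv.ext_inverse pt_inverse pt_inverse' cont_pt inv.cont_pt ext_local inv.ext_local)+
qed

theorem T_form:
  "\<exists>u. smooth_diffeo u \<and> ((\<forall>f\<in>schwartz. \<forall>x. T f (u x) = f x) \<or> (\<forall>f\<in>schwartz. \<forall>x. T f (u x) = cnj (f x)))"
proof (intro exI conjI)
  show "smooth_diffeo pt" by (rule mult_iso.u_diffeo[OF mult_iso_ext])
  have "T f (pt x) = ext f (pt x)" if "f \<in> schwartz" for f x
    using ext_eq[OF schwartz_smooth[OF that] that, of x] by simp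
  then show "(\<forall>f\<in>schwartz. \<forall>x. T f (pt x) = f x) \<or> (\<forall>f\<in>schwartz. \<forall>x. T f (pt x) = cnj (f x))"
    using mult_iso.L_form[OF mult_iso_ext] schwartz_smooth by (metis (no_types, lifting))
qed

end

section \<open>Integration of Schwartz functions\<close>

lemma inj_axis_1: "inj (\<lambda>i::'n::finite. axis i (1::real))"
  by (auto simp: inj_on_def axis_eq_axis)

lemma Basis_real_vec: "(Basis :: (real^'n::finite) set) = range (\<lambda>i. axis i 1)"
  by (auto simp: Basis_vec_def)

text \<open>Lebesgue measure is an image of a product measure indexed by \<open>Basis\<close>; the
  work is reindexing basis vectors by coordinates.\<close>

lemma lborel_vec_prod:
  fixes f :: "'n::finite \<Rightarrow> real \<Rightarrow> 'b::{real_normed_field,banach,second_countable_topology}"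
  assumes "\<And>i. integrable lborel (f i)"
  shows "integrable lborel (\<lambda>x::real^'n. \<Prod>i\<in>UNIV. f i (x $ i))"
    and "(\<integral>x. (\<Prod>i\<in>UNIV. f i ((x::real^'n) $ i)) \<partial>lborel) = (\<Prod>i\<in>UNIV. \<integral>s. f i s \<partial>lborel)"
proof -
  interpret product_sigma_finite "\<lambda>_::real^'n. lborel :: real measure" by standard
  define g where "g b = f (inv (\<lambda>i::'n. axis i (1::real)) b)" for b
  have g_axis: "g (axis i 1) = f i" for i by (simp add: g_def inv_f_f[OF inj_axis_1])
  have g: "integrable lborel (g b)" for b using assms by (simp add: g_def)
  have gm [measurable]: "g b \<in> borel_measurable borel" for b using borel_measurable_integrable[OF g[of b]] by simp
  have reindex: "(\<Prod>b\<in>Basis. h b) = (\<Prod>i\<in>UNIV. h (axis i 1))" for h :: "real^'n \<Rightarrow> 'b"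
    unfolding Basis_real_vec by (subst prod.reindex[OF inj_axis_1]) simp
  have eq: "(\<Prod>i\<in>UNIV. f i (x $ i)) = (\<Prod>b\<in>Basis. g b (x \<bullet> b))" for x :: "real^'n"
    by (simp add: reindex g_axis inner_axis)
  have comp: "(\<Prod>b\<in>Basis. g b ((\<Sum>c\<in>Basis. w c *\<^sub>R c) \<bullet> b)) = (\<Prod>b\<in>Basis. g b (w b))" for w :: "real^'n \<Rightarrow> real"
    by (intro prod.cong refl) (simp add: inner_sum_left inner_Basis if_distrib sum.delta cong: if_cong)
  have m1 [measurable]: "(\<lambda>x::real^'n. \<Prod>b\<in>Basis. g b (x \<bullet> b)) \<in> borel_measurable borel" by measurable
  have m2: "(\<lambda>w. \<Sum>c\<in>(Basis::(real^'n) set). w c *\<^sub>R c) \<in> measurable (\<Pi>\<^sub>M b\<in>Basis. lborel) borel" by measurable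
  show "integrable lborel (\<lambda>x::real^'n. \<Prod>i\<in>UNIV. f i (x $ i))"
    unfolding eq lborel_eq[where 'a = "real^'n"]
    by (subst integrable_distr_eq[OF m2 m1]) (simp only: comp, intro product_integrable_prod finite_Basis g)
  show "(\<integral>x. (\<Prod>i\<in>UNIV. f i ((x::real^'n) $ i)) \<partial>lborel) = (\<Prod>i\<in>UNIV. \<integral>s. f i s \<partial>lborel)"
  proof -
    have "(\<integral>x. (\<Prod>b\<in>Basis. g b ((x::real^'n) \<bullet> b)) \<partial>lborel) = (\<integral>w. (\<Prod>b\<in>(Basis::(real^'n) set). g b (w b)) \<partial>(\<Pi>\<^sub>M b\<in>Basis. lborel))"
      unfolding lborel_eq[where 'a = "real^'n"] by (subst integral_distr[OF m2 m1]) (simp only: comp)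
    also have "\<dots> = (\<Prod>b\<in>(Basis::(real^'n) set). \<integral>s. g b s \<partial>lborel)"
      by (intro product_integral_prod finite_Basis g)
    finally show ?thesis unfolding eq by (simp only: reindex g_axis)
  qed
qed

lemma integrable_inverse_square: "integrable lborel (\<lambda>x::real. inverse (1 + x\<^sup>2))"
  using integrable_inverse_1_plus_square by (simp add: set_integrable_def einterval_def)

text \<open>A common integrable majorant, up to constants, of all Schwartz functions; its product
  form reduces integrability to one variable.\<close>

definition decay :: "real^'n::finite \<Rightarrow> real" where
  "decay x = (\<Prod>i\<in>UNIV. inverse (1 + (x $ i)\<^sup>2))"

lemma integrable_decay: "integrable lborel (decay :: real^'n::finite \<Rightarrow> real)"
  unfolding decay_def[abs_def] by (rule lborel_vec_prod(1)[OF integrable_inverse_square])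

lemma decay_pos: "decay x > 0"
  unfolding decay_def by (intro prod_pos) (auto intro: add_pos_nonneg)

lemma partial_deriv_const: "partial_deriv i (\<lambda>_. c) = (\<lambda>_. 0)"
  by (rule has_pd_partial_deriv[OF has_pd_const])

lemma temperate_const: "temperate (\<lambda>_. c)"
proof -
  have "\<exists>d. iter_pderiv js (\<lambda>_::real^'a. c) = (\<lambda>_. d)" for js
    by (induction js) (auto simp: partial_deriv_const)
  then have "\<exists>C k. \<forall>x. norm (iter_pderiv js (\<lambda>_::real^'a. c) x) \<le> C * (1 + norm x ^ k)" for js
  proof -
    obtain d where d: "iter_pderiv js (\<lambda>_::real^'a. c) = (\<lambda>_. d)" using \<open>\<And>js. \<exists>d. iter_pderiv js (\<lambda>_. c) = (\<lambda>_. d)\<close> by blast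
    have "norm d \<le> norm d * (1 + norm x ^ 0)" for x :: "real^'a" by simp
    then show ?thesis unfolding d by blast
  qed
  then show ?thesis by (simp add: temperate_def)
qed

lemma temperateI:
  assumes "smooth f" "\<And>x. norm (f x) \<le> C * (1 + norm x ^ k)" "\<And>i. temperate (partial_deriv i f)"
  shows "temperate f"
  unfolding temperate_def
proof (intro conjI allI assms(1))
  fix js show "\<exists>C k. \<forall>x. norm (iter_pderiv js f x) \<le> C * (1 + norm x ^ k)"
  proof (cases js rule: rev_cases)
    case Nil then show ?thesis using assms(2) by auto
  next
    case (snoc ks i)
    then show ?thesis using assms(3)[of i] by (simp add: temperate_def iter_pderiv_append)
  qed
qed

lemma has_pd_coord: "has_pd i (\<lambda>x::real^'n. complex_of_real (x $ j)) (\<lambda>x. of_real (if i = j then 1 else 0))"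
  by (rule has_pd_linear[OF bounded_linear_of_real has_pd_nth])

lemma temperate_coord: "temperate (\<lambda>x::real^'n::finite. complex_of_real (x $ j))"
proof (rule temperateI)
  show "smooth (\<lambda>x::real^'n. complex_of_real (x $ j))" by (intro smooth_of_real smooth_nth)
  show "norm (complex_of_real (x $ j)) \<le> 1 * (1 + norm x ^ 1)" for x :: "real^'n"
    using component_le_norm_cart[of x j] by simp
  show "temperate (partial_deriv i (\<lambda>x::real^'n. complex_of_real (x $ j)))" for i
    using has_pd_partial_deriv[OF has_pd_coord, of i j] by (simp add: temperate_const)
qed

lemma schwartz_scale: "f \<in> schwartz \<Longrightarrow> (\<lambda>x. c * f x) \<in> schwartz"
  by (rule temperate_mult_schwartz[OF temperate_const])

lemma schwartz_coord_mult: "f \<in> schwartz \<Longrightarrow> (\<lambda>x. complex_of_real (x $ j) * f x) \<in> schwartz"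
  by (rule temperate_mult_schwartz[OF temperate_coord])

lemma schwartz_add: assumes "f \<in> schwartz" "g \<in> schwartz" shows "(\<lambda>x. f x + g x) \<in> schwartz"
  unfolding schwartz_def
proof (intro CollectI conjI allI smooth_add schwartz_smooth assms)
  fix l js
  obtain C where C: "\<And>x. norm (iter_pderiv js f x) * (1 + norm x ^ l) \<le> C" using schwartz_bound[OF assms(1)] by blast
  obtain D where D: "\<And>x. norm (iter_pderiv js g x) * (1 + norm x ^ l) \<le> D" using schwartz_bound[OF assms(2)] by blast
  have "norm (iter_pderiv js (\<lambda>x. f x + g x) x) * (1 + norm x ^ l) \<le> C + D" for x
  proof -
    have "norm (iter_pderiv js (\<lambda>x. f x + g x) x) * (1 + norm x ^ l) \<le> (norm (iter_pderiv js f x) + norm (iter_pderiv js g x)) * (1 + norm x ^ l)"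
      unfolding iter_pderiv_add[OF assms[THEN schwartz_smooth]] by (intro mult_right_mono norm_triangle_ineq) auto
    then show ?thesis using C[of x] D[of x] by (simp add: distrib_right)
  qed
  then show "\<exists>C. \<forall>x. norm (iter_pderiv js (\<lambda>x. f x + g x) x) * (1 + norm x ^ l) \<le> C" by blast
qed

lemma schwartz_bounded: "f \<in> schwartz \<Longrightarrow> \<exists>C\<ge>0. \<forall>x. norm (f x) \<le> C"
proof -
  assume "f \<in> schwartz"
  then obtain C where C: "C \<ge> 0" "\<And>x. norm (iter_pderiv [] f x) * (1 + norm x ^ 0) \<le> C" using schwartz_bound by blast
  have "norm (f x) \<le> C" for x using C(2)[of x] C(1) by simp
  then show ?thesis using C(1) by blast
qed

text \<open>\<open>f / decay\<close> is \<open>f\<close> times a polynomial, hence again a Schwartz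
  function and bounded.\<close>

lemma schwartz_decay:
  fixes f :: "real^'n::finite \<Rightarrow> complex"
  assumes "f \<in> schwartz" shows "\<exists>C\<ge>0. \<forall>x. norm (f x) \<le> C * decay x"
proof -
  have "(\<lambda>x. (\<Prod>i\<in>A. 1 + complex_of_real (x $ i) * complex_of_real (x $ i)) * f x) \<in> schwartz" if "finite A" for A
    using that
  proof (induction A rule: finite_induct)
    case empty then show ?case using assms by simp
  next
    case (insert i A)
    let ?h = "\<lambda>x. (\<Prod>i\<in>A. 1 + complex_of_real (x $ i) * complex_of_real (x $ i)) * f x"
    have "(\<lambda>x. ?h x + complex_of_real (x $ i) * (complex_of_real (x $ i) * ?h x)) \<in> schwartz"
      by (intro schwartz_add schwartz_coord_mult insert.IH)
    moreover have "(\<lambda>x. ?h x + complex_of_real (x $ i) * (complex_of_real (x $ i) * ?h x))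
        = (\<lambda>x. (\<Prod>i\<in>insert i A. 1 + complex_of_real (x $ i) * complex_of_real (x $ i)) * f x)"
      using insert.hyps by (simp add: algebra_simps)
    ultimately show ?case by simp
  qed
  from schwartz_bounded[OF this[of UNIV]]
  obtain C where C: "C \<ge> 0" "\<And>x. norm ((\<Prod>i\<in>UNIV. 1 + complex_of_real (x $ i) * complex_of_real (x $ i)) * f x) \<le> C" by auto
  have "norm (f x) \<le> C * decay x" for x
  proof -
    have "(\<Prod>i\<in>UNIV. 1 + complex_of_real (x $ i) * complex_of_real (x $ i)) = of_real (inverse (decay x))"
      by (simp add: decay_def prod_inversef power2_eq_square flip: prod_inversef)
    then have "inverse (decay x) * norm (f x) \<le> C" using C(2)[of x] decay_pos[of x] by (simp add: norm_mult norm_inverse)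
    then show ?thesis using decay_pos[of x] by (simp add: field_simps)
  qed
  with C(1) show ?thesis by blast
qed

lemma continuous_borel: "continuous_on UNIV f \<Longrightarrow> f \<in> borel_measurable lborel"
  by (simp add: borel_measurable_continuous_onI)

lemma schwartz_measurable: "f \<in> schwartz \<Longrightarrow> f \<in> borel_measurable lborel"
  by (intro continuous_borel smooth_continuous schwartz_smooth)

lemma schwartz_integrable: assumes "f \<in> schwartz" shows "integrable lborel f"
proof -
  obtain C where C: "C \<ge> 0" "\<And>x. norm (f x) \<le> C * decay x" using schwartz_decay[OF assms] by blast
  show ?thesis
    by (rule Bochner_Integration.integrable_bound[OF integrable_mult_right[OF integrable_decay, of C] schwartz_measurable[OF assms]])
      (use C in \<open>auto simp: abs_mult abs_of_pos[OF decay_pos]\<close>)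
qed

text \<open>From \<open>a^2 <= 2 (a + s)^2 + 2 s^2\<close>. One majorant thereby dominates all
  difference quotients with steps at most 1.\<close>

lemma decay_shift:
  assumes "\<bar>s\<bar> \<le> 1"
  shows "decay (x + s *\<^sub>R axis i 1) \<le> 3 * decay x"
proof -
  have 1: "inverse (1 + (x $ i + s)\<^sup>2) \<le> 3 * inverse (1 + (x $ i)\<^sup>2)"
  proof -
    have "s\<^sup>2 \<le> 1" using assms by (simp add: abs_square_le_1)
    have "(x $ i)\<^sup>2 \<le> 2 * (x $ i + s)\<^sup>2 + 2 * s\<^sup>2"
      using zero_le_power2[of "x $ i + 2 * s"] by (simp add: power2_eq_square algebra_simps)
    moreover have "1 + a \<le> 3 * (1 + b)" if "a \<le> 2 * b + 2 * d" "d \<le> 1" "0 \<le> b" for a b d :: real using that by simp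
    ultimately have "1 + (x $ i)\<^sup>2 \<le> 3 * (1 + (x $ i + s)\<^sup>2)"
      using \<open>s\<^sup>2 \<le> 1\<close> zero_le_power2[of "x $ i + s"] by blast
    then show ?thesis
      using add_pos_nonneg[OF zero_less_one zero_le_power2[of "x $ i"]] add_pos_nonneg[OF zero_less_one zero_le_power2[of "x $ i + s"]]
      by (simp add: field_simps)
  qed
  have split: "decay y = inverse (1 + (y $ i)\<^sup>2) * (\<Prod>j\<in>UNIV - {i}. inverse (1 + (y $ j)\<^sup>2))" for y
    unfolding decay_def by (subst prod.remove[of UNIV i]) auto
  have "(\<Prod>j\<in>UNIV - {i}. inverse (1 + ((x + s *\<^sub>R axis i 1) $ j)\<^sup>2)) = (\<Prod>j\<in>UNIV - {i}. inverse (1 + (x $ j)\<^sup>2))"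
    by (intro prod.cong refl) (auto simp: axis_def)
  then have "decay (x + s *\<^sub>R axis i 1) = inverse (1 + (x $ i + s)\<^sup>2) * (\<Prod>j\<in>UNIV - {i}. inverse (1 + (x $ j)\<^sup>2))"
    by (simp add: split[of "x + s *\<^sub>R axis i 1"])
  also have "\<dots> \<le> (3 * inverse (1 + (x $ i)\<^sup>2)) * (\<Prod>j\<in>UNIV - {i}. inverse (1 + (x $ j)\<^sup>2))"
    by (intro mult_right_mono 1 prod_nonneg) auto
  finally show ?thesis by (simp add: split[of x])
qed

lemma integral_affine:
  fixes f :: "real^'n::finite \<Rightarrow> complex"
  assumes "c \<noteq> 0" "f \<in> borel_measurable lborel"
  shows "(\<integral>x. f x \<partial>lborel) = \<bar>c\<bar> ^ DIM(real^'n) *\<^sub>R (\<integral>x. f (a + c *\<^sub>R x) \<partial>lborel)"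
proof -
  have [measurable]: "f \<in> borel_measurable borel" using assms(2) by simp
  show ?thesis
    by (subst lborel_affine[OF assms(1), of a]) (simp add: integral_density integral_distr)
qed

lemma integral_translation:
  fixes f :: "real^'n::finite \<Rightarrow> complex"
  assumes "f \<in> borel_measurable lborel"
  shows "(\<integral>x. f (x + a) \<partial>lborel) = (\<integral>x. f x \<partial>lborel)"
  using integral_affine[of 1 f a] assms by (simp add: add.commute)

lemma integral_reflect:
  fixes f :: "real^'n::finite \<Rightarrow> complex"
  assumes "f \<in> borel_measurable lborel"
  shows "(\<integral>x. f (- x) \<partial>lborel) = (\<integral>x. f x \<partial>lborel)"
  using integral_affine[of "-1" f 0] assms by simp

text \<open>Dominated convergence is about sequences, so derivatives of integrals are tested on null
  sequences; steps beyond 1 are dropped with an initial segment.\<close>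

lemma has_vector_derivative_seqI:
  fixes F :: "real \<Rightarrow> complex"
  assumes "\<And>h. (\<And>k. h k \<noteq> 0) \<Longrightarrow> (\<And>k. \<bar>h k\<bar> \<le> 1) \<Longrightarrow> h \<longlonglongrightarrow> 0 \<Longrightarrow> (\<lambda>k. (F (h k) - F 0) / of_real (h k)) \<longlonglongrightarrow> D"
  shows "(F has_vector_derivative D) (at 0)"
proof -
  have "((\<lambda>t. (F t - F 0) / of_real t) \<longlongrightarrow> D) (at 0)"
    unfolding tendsto_at_iff_sequentially comp_def
  proof (intro allI impI)
    fix h :: "nat \<Rightarrow> real" assume h: "\<forall>i. h i \<in> UNIV - {0}" "h \<longlonglongrightarrow> 0"
    then have "\<forall>\<^sub>F k in sequentially. dist (h k) 0 < 1" by (intro tendstoD) auto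
    then obtain N where N: "\<And>k. k \<ge> N \<Longrightarrow> \<bar>h k\<bar> < 1" by (auto simp: eventually_sequentially dist_norm)
    have "(\<lambda>k. (F (h (k + N)) - F 0) / of_real (h (k + N))) \<longlonglongrightarrow> D"
      by (rule assms) (use h N in \<open>auto intro: less_imp_le LIMSEQ_ignore_initial_segment\<close>)
    then show "(\<lambda>k. (F (h k) - F 0) / of_real (h k)) \<longlonglongrightarrow> D" by (rule LIMSEQ_offset)
  qed
  then have "((\<lambda>t. (F t - F 0) / of_real t - D) \<longlongrightarrow> 0) (at 0)" by (simp only: LIM_zero_iff)
  from tendsto_norm_zero[OF this]
  have "((\<lambda>t. norm (F (0 + t) - F 0 - t *\<^sub>R D) / norm t) \<longlongrightarrow> 0) (at 0)"
  proof (rule Lim_transform_eventually)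
    show "\<forall>\<^sub>F t in at 0. norm ((F t - F 0) / of_real t - D) = norm (F (0 + t) - F 0 - t *\<^sub>R D) / norm t"
      using eventually_neq_at_within[of "0::real" 0 UNIV]
    proof eventually_elim
      case (elim t)
      have "(F t - F 0) / of_real t - D = (F t - F 0 - t *\<^sub>R D) / of_real t"
        using elim by (simp add: scaleR_conv_of_real diff_divide_distrib)
      then show ?case by (simp add: norm_divide)
    qed
  qed
  then show ?thesis
    unfolding has_vector_derivative_def has_derivative_at by (auto intro: bounded_linear_scaleR_left)
qed

lemma vector_derivative_seqD:
  fixes F :: "real \<Rightarrow> complex"
  assumes "(F has_vector_derivative D) (at 0)" "\<And>k. h k \<noteq> 0" "h \<longlonglongrightarrow> 0"
  shows "(\<lambda>k. (F (h k) - F 0) / of_real (h k)) \<longlonglongrightarrow> D"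
proof -
  have "((\<lambda>t. norm (F (0 + t) - F 0 - t *\<^sub>R D) / norm t) \<longlongrightarrow> 0) (at 0)"
    using assms(1) unfolding has_vector_derivative_def has_derivative_at by blast
  moreover have "filterlim h (at 0) sequentially" using assms(2,3) by (simp add: filterlim_at)
  ultimately have "(\<lambda>k. norm (F (0 + h k) - F 0 - h k *\<^sub>R D) / norm (h k)) \<longlonglongrightarrow> 0" by (rule filterlim_compose)
  moreover have "norm (F (0 + h k) - F 0 - h k *\<^sub>R D) / norm (h k) = norm ((F (h k) - F 0) / of_real (h k) - D)" for k
  proof -
    have "(F (h k) - F 0) / of_real (h k) - D = (F (h k) - F 0 - h k *\<^sub>R D) / of_real (h k)"
      using assms(2)[of k] by (simp add: scaleR_conv_of_real diff_divide_distrib)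
    then show ?thesis by (simp add: norm_divide)
  qed
  ultimately have "(\<lambda>k. norm ((F (h k) - F 0) / of_real (h k) - D)) \<longlonglongrightarrow> 0" by simp
  then show ?thesis by (simp only: tendsto_norm_zero_iff LIM_zero_iff)
qed

text \<open>By translation invariance the integral of the shifted \<open>g\<close> is constant in
  the shift; its derivative at 0, taken under the integral, is the integral of the partial
  derivative.\<close>

lemma integral_partial_deriv_0:
  fixes g :: "real^'n::finite \<Rightarrow> complex"
  assumes g: "g \<in> schwartz"
  shows "(\<integral>x. partial_deriv i g x \<partial>lborel) = 0"
proof -
  let ?I = "\<lambda>s. \<integral>x. g (x + s *\<^sub>R axis i 1) \<partial>lborel"
  obtain C where C: "C \<ge> 0" "\<And>x. norm (partial_deriv i g x) \<le> C * decay x"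
    using schwartz_decay[OF schwartz_partial_deriv[OF g]] by blast
  have cg: "continuous_on UNIV g" by (intro smooth_continuous schwartz_smooth g)
  have shift_cont: "continuous_on UNIV (\<lambda>x. g (x + s *\<^sub>R axis i 1))" for s
    by (intro continuous_on_compose2[OF cg] continuous_intros) auto
  have pd: "has_pd i g (partial_deriv i g)" by (intro smooth_partial_deriv schwartz_smooth g)
  have quot: "norm (g (x + s *\<^sub>R axis i 1) - g x) \<le> (C * (3 * decay x)) * \<bar>s\<bar>" if s: "\<bar>s\<bar> \<le> 1" for x s
  proof -
    have "norm ((\<lambda>t. g (x + t *\<^sub>R axis i 1)) s - (\<lambda>t. g (x + t *\<^sub>R axis i 1)) 0) \<le> (C * (3 * decay x)) * norm (s - 0)"
    proof (rule differentiable_bound[where S = "closed_segment 0 s"])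
      fix t assume t: "t \<in> closed_segment 0 s"
      have t1: "\<bar>t\<bar> \<le> 1" using t s by (auto simp: closed_segment_eq_real_ivl split: if_splits)
      show "((\<lambda>t. g (x + t *\<^sub>R axis i 1)) has_derivative (\<lambda>h. h *\<^sub>R partial_deriv i g (x + t *\<^sub>R axis i 1))) (at t within closed_segment 0 s)"
        unfolding has_vector_derivative_def[symmetric] by (rule has_pd_line[OF pd])
      have "norm (partial_deriv i g (x + t *\<^sub>R axis i 1)) \<le> C * (3 * decay x)"
        using C(2)[of "x + t *\<^sub>R axis i 1"] mult_left_mono[OF decay_shift[OF t1, of x i] C(1)] by linarith
      from mult_left_mono[OF this abs_ge_zero]
      show "onorm (\<lambda>h. h *\<^sub>R partial_deriv i g (x + t *\<^sub>R axis i 1)) \<le> C * (3 * decay x)"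
        by (intro onorm_le) (simp add: mult.commute)
    qed auto
    then show ?thesis by simp
  qed
  have int_shift: "integrable lborel (\<lambda>x. g (x + s *\<^sub>R axis i 1))" if "\<bar>s\<bar> \<le> 1" for s
  proof -
    obtain D where D: "D \<ge> 0" "\<And>x. norm (g x) \<le> D * decay x" using schwartz_decay[OF g] by blast
    show ?thesis
    proof (rule Bochner_Integration.integrable_bound[OF integrable_mult_right[OF integrable_decay, of "D * 3"] continuous_borel[OF shift_cont]])
      have "norm (g (x + s *\<^sub>R axis i 1)) \<le> norm (D * 3 * decay x)" for x
        using D(2)[of "x + s *\<^sub>R axis i 1"] mult_left_mono[OF decay_shift[OF that, of x i] D(1)] by simp
      then show "AE x in lborel. norm (g (x + s *\<^sub>R axis i 1)) \<le> norm (D * 3 * decay x)" by simp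
    qed
  qed
  have "(?I has_vector_derivative (\<integral>x. partial_deriv i g x \<partial>lborel)) (at 0)"
  proof (rule has_vector_derivative_seqI)
    fix h :: "nat \<Rightarrow> real" assume h: "\<And>k. h k \<noteq> 0" "\<And>k. \<bar>h k\<bar> \<le> 1" "h \<longlonglongrightarrow> 0"
    have "(\<lambda>k. \<integral>x. (g (x + h k *\<^sub>R axis i 1) - g x) / of_real (h k) \<partial>lborel) \<longlonglongrightarrow> (\<integral>x. partial_deriv i g x \<partial>lborel)"
    proof (rule integral_dominated_convergence[where w = "\<lambda>x. C * 3 * decay x"])
      show "partial_deriv i g \<in> borel_measurable lborel" by (intro schwartz_measurable schwartz_partial_deriv g)
      show "(\<lambda>x. (g (x + h k *\<^sub>R axis i 1) - g x) / of_real (h k)) \<in> borel_measurable lborel" for k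
        by (intro continuous_borel continuous_intros shift_cont cg) (use h in auto)
      show "integrable lborel (\<lambda>x. C * 3 * decay x)" by (rule integrable_mult_right[OF integrable_decay])
      show "AE x in lborel. (\<lambda>k. (g (x + h k *\<^sub>R axis i 1) - g x) / of_real (h k)) \<longlonglongrightarrow> partial_deriv i g x"
        using vector_derivative_seqD[OF has_pdD[OF pd] h(1,3)] by simp
      show "AE x in lborel. norm ((g (x + h k *\<^sub>R axis i 1) - g x) / of_real (h k)) \<le> C * 3 * decay x" for k
        using quot[OF h(2)] h(1)[of k] by (simp add: norm_divide field_simps)
    qed
    moreover have "(\<integral>x. (g (x + h k *\<^sub>R axis i 1) - g x) / of_real (h k) \<partial>lborel) = (?I (h k) - ?I 0) / of_real (h k)" for k
      using int_shift[OF h(2)[of k]] schwartz_integrable[OF g] by simp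
    ultimately show "(\<lambda>k. (?I (h k) - ?I 0) / of_real (h k)) \<longlonglongrightarrow> (\<integral>x. partial_deriv i g x \<partial>lborel)" by (simp only:)
  qed
  moreover have "?I = (\<lambda>s. \<integral>x. g x \<partial>lborel)"
    using integral_translation[OF schwartz_measurable[OF g]] by simp
  ultimately have "((\<lambda>s::real. \<integral>x. g x \<partial>lborel) has_vector_derivative (\<integral>x. partial_deriv i g x \<partial>lborel)) (at 0)" by simp
  then show ?thesis using vector_derivative_at by fastforce
qed

section \<open>The Fourier transform\<close>

lemma norm_cis_diff: "norm (cis a - cis b) \<le> \<bar>a - b\<bar>"
proof -
  have "norm (cis (a - b) - 1) \<le> \<bar>a - b\<bar>" unfolding cis_conv_exp using iexp_approx1[of "a - b" 0] by simp
  moreover have "cis a - cis b = cis b * (cis (a - b) - 1)"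
    by (simp add: algebra_simps cis_mult)
  ultimately show ?thesis by (simp add: norm_mult)
qed

lemma has_pd_character:
  fixes t :: "real^'n::finite"
  shows "has_pd i (\<lambda>x. cis (- 2 * pi * (x \<bullet> t))) (\<lambda>x. (- 2 * pi * \<i> * of_real (t $ i)) * cis (- 2 * pi * (x \<bullet> t)))"
proof -
  have "has_pd i (\<lambda>x::real^'n. (- 2 * pi * \<i>) * of_real (x \<bullet> t)) (\<lambda>x. (- 2 * pi * \<i>) * of_real (t $ i))"
    unfolding has_pd_def
    by (auto intro!: derivative_eq_intros simp: inner_add_left inner_axis inner_axis' has_vector_derivative_of_real mult_ac)
  from has_pd_field_compose[OF DERIV_exp this] show ?thesis
    by (simp add: cis_conv_exp mult_ac)
qed

lemma smooth_character: "smooth (\<lambda>x::real^'n::finite. cis (- 2 * pi * (x \<bullet> t)))"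
proof -
  have "smooth (\<lambda>x::real^'n. x \<bullet> t)"
    unfolding inner_vec_def by (intro smooth_sum smooth_linear[OF bounded_linear_inner_left] smooth_nth)
  then have "smooth (\<lambda>x::real^'n. exp ((- 2 * pi * \<i>) * of_real (x \<bullet> t)))"
    by (intro smooth_exp smooth_mult smooth_const smooth_of_real)
  then show ?thesis by (simp add: cis_conv_exp mult_ac)
qed

lemma temperate_character: "temperate (\<lambda>x::real^'n::finite. cis (- 2 * pi * (x \<bullet> t)))"
  unfolding temperate_def
proof (intro conjI allI smooth_character)
  fix js :: "'n list"
  have "\<exists>c. iter_pderiv js (\<lambda>x::real^'n. cis (- 2 * pi * (x \<bullet> t))) = (\<lambda>x. c * cis (- 2 * pi * (x \<bullet> t)))"
  proof (induction js)
    case Nil show ?case by (intro exI[of _ 1]) simp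
  next
    case (Cons i js)
    then obtain c where "iter_pderiv js (\<lambda>x::real^'n. cis (- 2 * pi * (x \<bullet> t))) = (\<lambda>x. c * cis (- 2 * pi * (x \<bullet> t)))" by blast
    then have "iter_pderiv (i # js) (\<lambda>x::real^'n. cis (- 2 * pi * (x \<bullet> t))) = (\<lambda>x. c * ((- 2 * pi * \<i> * of_real (t $ i)) * cis (- 2 * pi * (x \<bullet> t))))"
      using has_pd_partial_deriv[OF has_pd_linear[OF bounded_linear_mult_right has_pd_character]] by simp
    then show ?case by (intro exI[of _ "c * (- 2 * pi * \<i> * of_real (t $ i))"]) (simp only: mult.assoc)
  qed
  then obtain c where "iter_pderiv js (\<lambda>x::real^'n. cis (- 2 * pi * (x \<bullet> t))) = (\<lambda>x. c * cis (- 2 * pi * (x \<bullet> t)))" by blast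
  then have "\<forall>x. norm (iter_pderiv js (\<lambda>x::real^'n. cis (- 2 * pi * (x \<bullet> t))) x) \<le> norm c * (1 + norm x ^ 0)"
    by (simp add: norm_mult)
  then show "\<exists>C k. \<forall>x. norm (iter_pderiv js (\<lambda>x::real^'n. cis (- 2 * pi * (x \<bullet> t))) x) \<le> C * (1 + norm x ^ k)" by blast
qed

lemma schwartz_character: "f \<in> schwartz \<Longrightarrow> (\<lambda>x. f x * cis (- 2 * pi * (x \<bullet> t))) \<in> schwartz"
  using temperate_mult_schwartz[OF temperate_character] by (simp add: mult.commute)

lemma fourier_integrable: "f \<in> schwartz \<Longrightarrow> integrable lborel (\<lambda>x. f x * cis (- 2 * pi * (x \<bullet> t)))"
  by (intro schwartz_integrable schwartz_character)

lemma fourier_bounded: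
  assumes "f \<in> schwartz" shows "norm (fourier f t) \<le> (\<integral>x. norm (f x) \<partial>lborel)"
  unfolding fourier_def
  by (rule order_trans[OF integral_norm_bound]) (simp add: norm_mult)

lemma fourier_continuous:
  fixes f :: "real^'n::finite \<Rightarrow> complex"
  assumes f: "f \<in> schwartz" shows "continuous_on UNIV (fourier f)"
proof (rule continuous_on_sequentiallyI)
  fix T and t :: "real^'n" assume "T \<longlonglongrightarrow> t"
  show "(\<lambda>k. fourier f (T k)) \<longlonglongrightarrow> fourier f t"
    unfolding fourier_def
  proof (rule integral_dominated_convergence[where w = "\<lambda>x. norm (f x)"])
    show "integrable lborel (\<lambda>x. norm (f x))" by (intro integrable_norm schwartz_integrable f)
    show "(\<lambda>x. f x * cis (- 2 * pi * (x \<bullet> t))) \<in> borel_measurable lborel"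
      "(\<lambda>x. f x * cis (- 2 * pi * (x \<bullet> T k))) \<in> borel_measurable lborel" for k
      by (intro schwartz_measurable schwartz_character f)+
    show "AE x in lborel. (\<lambda>k. f x * cis (- 2 * pi * (x \<bullet> T k))) \<longlonglongrightarrow> f x * cis (- 2 * pi * (x \<bullet> t))"
      by (intro always_eventually allI tendsto_intros \<open>T \<longlonglongrightarrow> t\<close>)
    show "AE x in lborel. norm (f x * cis (- 2 * pi * (x \<bullet> T k))) \<le> norm (f x)" for k
      by (simp add: norm_mult)
  qed
qed

text \<open>Differentiation under the integral: the difference quotients of the character are
  bounded by \<open>2 pi |x $ i|\<close>, and \<open>f\<close> times a coordinate is still
  integrable.\<close>

lemma has_pd_fourier:
  assumes f: "f \<in> schwartz"
  shows "has_pd i (fourier f) (fourier (\<lambda>x. (- 2 * pi * \<i>) * (of_real (x $ i) * f x)))"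
  unfolding has_pd_def
proof
  fix t
  let ?g = "\<lambda>x. (- 2 * pi * \<i>) * (of_real (x $ i) * f x)"
  have g: "?g \<in> schwartz" by (intro schwartz_scale schwartz_coord_mult f)
  show "((\<lambda>s. fourier f (t + s *\<^sub>R axis i 1)) has_vector_derivative fourier ?g t) (at 0)"
  proof (rule has_vector_derivative_seqI)
    fix h :: "nat \<Rightarrow> real" assume h: "\<And>k. h k \<noteq> 0" "\<And>k. \<bar>h k\<bar> \<le> 1" "h \<longlonglongrightarrow> 0"
    let ?e = "\<lambda>t x. cis (- 2 * pi * (x \<bullet> t))"
    have "(\<lambda>k. \<integral>x. (f x * ?e (t + h k *\<^sub>R axis i 1) x - f x * ?e t x) / of_real (h k) \<partial>lborel) \<longlonglongrightarrow> (\<integral>x. ?g x * ?e t x \<partial>lborel)"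
    proof (rule integral_dominated_convergence[where w = "\<lambda>x. norm (?g x)"])
      show "integrable lborel (\<lambda>x. norm (?g x))" by (intro integrable_norm schwartz_integrable g)
      show "(\<lambda>x. ?g x * ?e t x) \<in> borel_measurable lborel" by (intro schwartz_measurable schwartz_character g)
      show "(\<lambda>x. (f x * ?e (t + h k *\<^sub>R axis i 1) x - f x * ?e t x) / of_real (h k)) \<in> borel_measurable lborel" for k
        by (intro borel_measurable_divide borel_measurable_diff borel_measurable_const schwartz_measurable schwartz_character f)
      show "AE x in lborel. (\<lambda>k. (f x * ?e (t + h k *\<^sub>R axis i 1) x - f x * ?e t x) / of_real (h k)) \<longlonglongrightarrow> ?g x * ?e t x"
      proof (intro always_eventually allI)
        fix x
        have "((\<lambda>s. ?e (t + s *\<^sub>R axis i 1) x) has_vector_derivative (- 2 * pi * \<i> * of_real (x $ i)) * ?e t x) (at 0)"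
          using has_pdD[OF has_pd_character[of i x], of t] by (simp add: inner_commute)
        from tendsto_mult[OF tendsto_const[of "f x"] vector_derivative_seqD[OF this h(1,3)]]
        show "(\<lambda>k. (f x * ?e (t + h k *\<^sub>R axis i 1) x - f x * ?e t x) / of_real (h k)) \<longlonglongrightarrow> ?g x * ?e t x"
          by (simp add: algebra_simps)
      qed
      show "AE x in lborel. norm ((f x * ?e (t + h k *\<^sub>R axis i 1) x - f x * ?e t x) / of_real (h k)) \<le> norm (?g x)" for k
      proof (intro always_eventually allI)
        fix x
        have "norm (?e (t + h k *\<^sub>R axis i 1) x - ?e t x) \<le> \<bar>- 2 * pi * (x \<bullet> (t + h k *\<^sub>R axis i 1)) - (- 2 * pi * (x \<bullet> t))\<bar>"
          by (rule norm_cis_diff)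
        also have "- 2 * pi * (x \<bullet> (t + h k *\<^sub>R axis i 1)) - (- 2 * pi * (x \<bullet> t)) = - 2 * pi * (h k * x $ i)"
          by (simp add: inner_add_right inner_axis algebra_simps)
        finally have 1: "norm (?e (t + h k *\<^sub>R axis i 1) x - ?e t x) \<le> 2 * pi * \<bar>x $ i\<bar> * \<bar>h k\<bar>"
          by (simp add: abs_mult mult_ac)
        have "norm ((f x * ?e (t + h k *\<^sub>R axis i 1) x - f x * ?e t x) / of_real (h k)) = norm (f x) * (norm (?e (t + h k *\<^sub>R axis i 1) x - ?e t x) / \<bar>h k\<bar>)"
          by (simp add: norm_divide norm_mult flip: right_diff_distrib)
        also have "\<dots> \<le> norm (f x) * (2 * pi * \<bar>x $ i\<bar>)"
          using 1 h(1)[of k] by (intro mult_left_mono) (simp_all add: divide_le_eq)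
        finally show "norm ((f x * ?e (t + h k *\<^sub>R axis i 1) x - f x * ?e t x) / of_real (h k)) \<le> norm (?g x)"
          by (simp add: norm_mult mult_ac)
      qed
    qed
    moreover have "(\<integral>x. (f x * ?e (t + h k *\<^sub>R axis i 1) x - f x * ?e t x) / of_real (h k) \<partial>lborel) =
        (fourier f (t + h k *\<^sub>R axis i 1) - fourier f (t + 0 *\<^sub>R axis i 1)) / of_real (h k)" for k
      unfolding fourier_def
      by (subst integral_divide_zero, subst Bochner_Integration.integral_diff[OF fourier_integrable[OF f] fourier_integrable[OF f]]) simp
    ultimately show "(\<lambda>k. (fourier f (t + h k *\<^sub>R axis i 1) - fourier f (t + 0 *\<^sub>R axis i 1)) / of_real (h k)) \<longlonglongrightarrow> fourier ?g t"
      unfolding fourier_def[of ?g] by (simp only:)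
  qed
qed

lemma smooth_fourier:
  assumes "f \<in> schwartz" shows "smooth (fourier f)"
proof -
  have "Ck n (fourier f)" for n using assms
  proof (induction n arbitrary: f)
    case 0 then show ?case by (simp add: fourier_continuous)
  next
    case (Suc n)
    have "Ck n (fourier (\<lambda>x. (- 2 * pi * \<i>) * (of_real (x $ i) * f x)))" for i
      by (intro Suc.IH schwartz_scale schwartz_coord_mult Suc.prems)
    then show ?case using has_pd_fourier[OF Suc.prems] fourier_continuous[OF Suc.prems] by auto
  qed
  then show ?thesis by (simp add: smooth_iff_Ck)
qed

lemma iter_pderiv_fourier:
  assumes "f \<in> schwartz" shows "\<exists>g\<in>schwartz. iter_pderiv js (fourier f) = fourier g"
proof (induction js)
  case Nil then show ?case using assms by auto
next
  case (Cons i js)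
  then obtain g where g: "g \<in> schwartz" "iter_pderiv js (fourier f) = fourier g" by blast
  then have "iter_pderiv (i # js) (fourier f) = fourier (\<lambda>x. (- 2 * pi * \<i>) * (of_real (x $ i) * g x))"
    using has_pd_partial_deriv[OF has_pd_fourier[OF g(1)]] by simp
  moreover have "(\<lambda>x. (- 2 * pi * \<i>) * (of_real (x $ i) * g x)) \<in> schwartz" by (intro schwartz_scale schwartz_coord_mult g)
  ultimately show ?case by blast
qed

text \<open>Integration by parts: \<open>integral_partial_deriv_0\<close> for \<open>f\<close> times
  the character, expanded by the product rule.\<close>

lemma fourier_partial_deriv:
  assumes f: "f \<in> schwartz"
  shows "fourier (partial_deriv i f) t = (2 * pi * \<i> * of_real (t $ i)) * fourier f t"
proof -
  let ?e = "\<lambda>x. cis (- 2 * pi * (x \<bullet> t))"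
  let ?c = "- 2 * pi * \<i> * of_real (t $ i)"
  have "partial_deriv i (\<lambda>x. f x * ?e x) = (\<lambda>x. f x * (?c * ?e x) + partial_deriv i f x * ?e x)"
    by (rule has_pd_partial_deriv[OF has_pd_mult[OF smooth_partial_deriv(1)[OF schwartz_smooth[OF f]] has_pd_character]])
  then have "(\<integral>x. ?c * (f x * ?e x) + partial_deriv i f x * ?e x \<partial>lborel) = 0"
    using integral_partial_deriv_0[OF schwartz_character[OF f], of i t] by (simp add: mult.left_commute)
  then have "?c * fourier f t + fourier (partial_deriv i f) t = 0"
    unfolding fourier_def
    using Bochner_Integration.integral_add[OF integrable_mult_right[OF fourier_integrable[OF f]] fourier_integrable[OF schwartz_partial_deriv[OF f]], of ?c t i t]
    by simp
  then show ?thesis by (simp add: algebra_simps add_eq_0_iff)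
qed

text \<open>One power of \<open>norm t\<close> is traded for a derivative of \<open>f\<close>,
  coordinate by coordinate; the constant drops out because \<open>2 pi\<close> is at least
  1.\<close>

lemma fourier_decay:
  fixes f :: "real^'n::finite \<Rightarrow> complex"
  shows "f \<in> schwartz \<Longrightarrow> \<exists>C. \<forall>t. norm t ^ l * norm (fourier f t) \<le> C"
proof (induction l arbitrary: f)
  case 0 then show ?case using fourier_bounded by auto
next
  case (Suc l)
  have "\<exists>C. \<forall>t. norm t ^ l * norm (fourier (partial_deriv i f) t) \<le> C" for i
    by (rule Suc.IH[OF schwartz_partial_deriv[OF Suc.prems]])
  then obtain C where C: "\<And>i t. norm t ^ l * norm (fourier (partial_deriv i f) t) \<le> C i" by metis
  have "norm t ^ Suc l * norm (fourier f t) \<le> (\<Sum>i\<in>UNIV. C i)" for t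
  proof -
    have "norm t * norm (fourier f t) \<le> (\<Sum>i\<in>UNIV. \<bar>t $ i\<bar>) * norm (fourier f t)"
      by (intro mult_right_mono norm_le_l1_cart) auto
    also have "\<dots> \<le> (\<Sum>i\<in>UNIV. norm (fourier (partial_deriv i f) t))"
      unfolding sum_distrib_right
    proof (intro sum_mono)
      fix i
      have "1 * (\<bar>t $ i\<bar> * norm (fourier f t)) \<le> (2 * pi) * (\<bar>t $ i\<bar> * norm (fourier f t))"
        by (rule mult_right_mono) (use pi_ge_two in auto)
      then show "\<bar>t $ i\<bar> * norm (fourier f t) \<le> norm (fourier (partial_deriv i f) t)"
        by (simp add: fourier_partial_deriv[OF Suc.prems] norm_mult mult_ac)
    qed
    finally have "norm t ^ l * (norm t * norm (fourier f t)) \<le> norm t ^ l * (\<Sum>i\<in>UNIV. norm (fourier (partial_deriv i f) t))"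
      by (rule mult_left_mono) auto
    also have "\<dots> \<le> (\<Sum>i\<in>UNIV. C i)" unfolding sum_distrib_left by (intro sum_mono C)
    finally show ?thesis by (simp add: mult_ac)
  qed
  then show ?case by blast
qed

theorem fourier_schwartz:
  assumes f: "f \<in> schwartz" shows "fourier f \<in> schwartz"
  unfolding schwartz_def
proof (intro CollectI conjI allI smooth_fourier f)
  fix l js
  obtain g where g: "g \<in> schwartz" "iter_pderiv js (fourier f) = fourier g" using iter_pderiv_fourier[OF f] by blast
  obtain C where C: "\<And>t. norm t ^ l * norm (fourier g t) \<le> C" using fourier_decay[OF g(1)] by blast
  have "norm (iter_pderiv js (fourier f) t) * (1 + norm t ^ l) \<le> (\<integral>x. norm (g x) \<partial>lborel) + C" for t
    using fourier_bounded[OF g(1), of t] C[of t] by (simp add: g(2) algebra_simps)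
  then show "\<exists>C. \<forall>t. norm (iter_pderiv js (fourier f) t) * (1 + norm t ^ l) \<le> C" by blast
qed

section \<open>Gaussians and Fourier inversion\<close>

definition gauss1 :: "real \<Rightarrow> real" where "gauss1 s = exp (- pi * s\<^sup>2)"

lemma gauss1_le: "gauss1 s \<le> inverse (1 + s\<^sup>2)"
proof -
  have "1 + s\<^sup>2 \<le> 1 + pi * s\<^sup>2" using mult_right_mono[of 1 pi "s\<^sup>2"] pi_ge_two by simp
  also have "\<dots> \<le> exp (pi * s\<^sup>2)" by (rule exp_ge_add_one_self)
  finally have "inverse (exp (pi * s\<^sup>2)) \<le> inverse (1 + s\<^sup>2)"
    by (intro le_imp_inverse_le) (auto intro: add_pos_nonneg)
  then show ?thesis by (simp add: gauss1_def exp_minus)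
qed

lemma integrable_gauss1: "integrable lborel gauss1"
  by (rule Bochner_Integration.integrable_bound[OF integrable_inverse_square])
    (use gauss1_le in \<open>auto simp: gauss1_def intro!: borel_measurable_continuous_onI continuous_intros\<close>)

lemma integrable_gauss1_cis: "integrable lborel (\<lambda>s. of_real (gauss1 (c * s)) * cis (b * s))" if "c \<noteq> 0"
proof -
  have "integrable lborel (\<lambda>s. gauss1 (0 + c * s))" using lborel_integrable_real_affine[OF integrable_gauss1 that, of 0] .
  then show ?thesis
    by (rule Bochner_Integration.integrable_bound)
      (auto simp: norm_mult gauss1_def intro!: borel_measurable_continuous_onI continuous_intros)
qed

text \<open>The characteristic function of the standard normal law, rescaled by
  \<open>sqrt (2 * pi)\<close> so that the Gaussian becomes its own transform.\<close>

lemma fourier_gauss1: "(\<integral>s. of_real (gauss1 s) * cis (- 2 * pi * (s * t)) \<partial>lborel) = of_real (gauss1 t)"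
proof -
  define c where "c = sqrt (2 * pi)"
  have c: "c > 0" "c\<^sup>2 = 2 * pi" "c * c = 2 * pi" by (auto simp: c_def power2_eq_square[symmetric])
  have "of_real (exp (- ((- c * t)\<^sup>2) / 2)) = char std_normal_distribution (- c * t)"
    by (simp add: char_std_normal_distribution)
  also have "\<dots> = (\<integral>x. std_normal_density x *\<^sub>R iexp ((- c * t) * x) \<partial>lborel)"
    unfolding char_def by (subst integral_density) (auto simp: normal_density_nonneg)
  also have "\<dots> = \<bar>c\<bar> *\<^sub>R (\<integral>s. std_normal_density (0 + c * s) *\<^sub>R iexp ((- c * t) * (0 + c * s)) \<partial>lborel)"
    by (rule lborel_integral_real_affine) (use c in simp)
  also have "\<dots> = (\<integral>s. \<bar>c\<bar> *\<^sub>R (std_normal_density (0 + c * s) *\<^sub>R iexp ((- c * t) * (0 + c * s))) \<partial>lborel)"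
    by (rule integral_scaleR_right[symmetric])
  also have "\<dots> = (\<integral>s. of_real (gauss1 s) * cis (- 2 * pi * (s * t)) \<partial>lborel)"
  proof (rule Bochner_Integration.integral_cong[OF refl])
    fix s
    have 1: "c * std_normal_density (c * s) = gauss1 s"
      using c by (simp add: std_normal_density_def gauss1_def power_mult_distrib flip: c_def)
    have 2: "(- c * t) * (c * s) = - 2 * pi * (s * t)" using c(3) by (simp add: mult_ac)
    show "\<bar>c\<bar> *\<^sub>R (std_normal_density (0 + c * s) *\<^sub>R iexp ((- c * t) * (0 + c * s))) = of_real (gauss1 s) * cis (- 2 * pi * (s * t))"
      using c(1) by (simp only: scaleR_scaleR add_0 abs_of_pos 1 2) (simp only: scaleR_conv_of_real cis_conv_exp)
  qed
  finally show ?thesis using c by (simp add: gauss1_def power_mult_distrib)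
qed

definition gauss :: "real^'n::finite \<Rightarrow> complex" where
  "gauss x = (\<Prod>i\<in>UNIV. of_real (gauss1 (x $ i)))"

lemma cis_sum: "cis (\<Sum>i\<in>A. f i) = (\<Prod>i\<in>A. cis (f i))"
  by (induction A rule: infinite_finite_induct) (auto simp: cis_mult[symmetric])

lemma gauss_character:
  "gauss (c *\<^sub>R x) * cis (b * (x \<bullet> t)) = (\<Prod>i\<in>UNIV. of_real (gauss1 (c * x $ i)) * cis (b * (x $ i * t $ i)))"
  by (simp add: gauss_def inner_vec_def sum_distrib_left cis_sum prod.distrib)

lemma integrable_gauss_character:
  assumes "c \<noteq> 0"
  shows "integrable lborel (\<lambda>x::real^'n::finite. gauss (c *\<^sub>R x) * cis (b * (x \<bullet> t)))"
proof -
  have "integrable lborel (\<lambda>s. of_real (gauss1 (c * s)) * cis (b * (s * t $ i)))" for i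
    using integrable_gauss1_cis[OF assms, of "b * t $ i"] by (simp add: mult_ac)
  from lborel_vec_prod(1)[of "\<lambda>i s. of_real (gauss1 (c * s)) * cis (b * (s * t $ i))", OF this]
  show ?thesis unfolding gauss_character .
qed

lemma fourier_gauss: "fourier gauss t = gauss t"
proof -
  have i: "integrable lborel (\<lambda>s. of_real (gauss1 (1 * s)) * cis (- 2 * pi * (s * t $ i)))" for i
    using integrable_gauss1_cis[of 1 "- 2 * pi * t $ i"] by (simp add: mult_ac)
  have "fourier gauss t = (\<integral>x. (\<Prod>i\<in>UNIV. of_real (gauss1 (1 * x $ i)) * cis (- 2 * pi * (x $ i * t $ i))) \<partial>lborel)"
    unfolding fourier_def gauss_character[symmetric] by simp
  also have "\<dots> = (\<Prod>i\<in>UNIV. \<integral>s. of_real (gauss1 (1 * s)) * cis (- 2 * pi * (s * t $ i)) \<partial>lborel)"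
    by (rule lborel_vec_prod(2)[of "\<lambda>i s. of_real (gauss1 (1 * s)) * cis (- 2 * pi * (s * t $ i))", OF i])
  also have "\<dots> = gauss t" by (simp add: fourier_gauss1[simplified] gauss_def)
  finally show ?thesis .
qed

lemma gauss_0: "gauss 0 = 1" by (simp add: gauss_def gauss1_def)

lemma continuous_gauss: "continuous_on UNIV (gauss :: real^'n::finite \<Rightarrow> complex)"
  unfolding gauss_def[abs_def] gauss1_def by (intro continuous_intros)

lemma norm_gauss_le_1: "norm (gauss x) \<le> 1"
  unfolding gauss_def prod_norm[symmetric] by (intro prod_le_1) (auto simp: gauss1_def)

text \<open>The kernel has modulus 1, so absolute integrability of the double integrand is that of
  \<open>f\<close> times that of \<open>h\<close>.\<close>

lemma fubini_kernel:
  fixes f h :: "real^'n::finite \<Rightarrow> complex" and k :: "real^'n \<Rightarrow> real^'n \<Rightarrow> complex"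
  assumes f: "integrable lborel f" "continuous_on UNIV f" and h: "integrable lborel h" "continuous_on UNIV h"
    and k: "continuous_on UNIV (\<lambda>p. k (fst p) (snd p))" "\<And>y t. norm (k y t) = 1"
  shows "(\<integral>t. h t * (\<integral>y. f y * k y t \<partial>lborel) \<partial>lborel) = (\<integral>y. f y * (\<integral>t. h t * k y t \<partial>lborel) \<partial>lborel)"
proof -
  let ?F = "\<lambda>y t. f y * (h t * k y t)"
  have c1: "continuous_on UNIV (\<lambda>p. f (fst p))" "continuous_on UNIV (\<lambda>p. h (snd p))"
    for q :: "(real^'n) \<times> (real^'n)"
    by (intro continuous_on_compose2[OF f(2)] continuous_on_compose2[OF h(2)] continuous_intros; simp)+
  have "continuous_on UNIV (case_prod ?F)"
    unfolding case_prod_beta' by (intro continuous_intros c1 k(1))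
  then have meas: "case_prod ?F \<in> borel_measurable (lborel \<Otimes>\<^sub>M lborel)"
    unfolding lborel_prod by (rule continuous_borel)
  have kc: "continuous_on UNIV (k y)" for y
    using continuous_on_compose2[OF k(1), of UNIV "\<lambda>t. (y, t)"] by (simp add: continuous_on_Pair continuous_on_const continuous_on_id)
  have int: "integrable lborel (\<lambda>t. h t * k y t)" for y
    by (rule Bochner_Integration.integrable_bound[OF h(1)])
      (auto simp: norm_mult k(2) intro!: borel_measurable_continuous_onI continuous_intros h(2) kc)
  have "integrable (lborel \<Otimes>\<^sub>M lborel) (case_prod ?F)"
  proof (rule lborel_pair.Fubini_integrable[OF meas])
    have "(\<lambda>y. \<integral>t. norm (case_prod ?F (y, t)) \<partial>lborel) = (\<lambda>y. norm (f y) * (\<integral>t. norm (h t) \<partial>lborel))"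
      by (simp add: norm_mult k(2))
    then show "integrable lborel (\<lambda>y. \<integral>t. norm (case_prod ?F (y, t)) \<partial>lborel)"
      using integrable_mult_left[OF integrable_norm[OF f(1)]] by simp
    show "AE y in lborel. integrable lborel (\<lambda>t. case_prod ?F (y, t))"
      using int by (auto intro!: always_eventually integrable_mult_right)
  qed
  from lborel_pair.Fubini_integral[OF this]
  have "(\<integral>t. (\<integral>y. ?F y t \<partial>lborel) \<partial>lborel) = (\<integral>y. (\<integral>t. ?F y t \<partial>lborel) \<partial>lborel)" .
  moreover have "(\<integral>y. ?F y t \<partial>lborel) = h t * (\<integral>y. f y * k y t \<partial>lborel)" for t
    by (subst integral_mult_right_zero[symmetric]) (simp add: mult_ac)
  ultimately show ?thesis by simp
qed

text \<open>The Gaussian factor makes the double integral absolutely convergent; exchanging the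
  integrals produces the transform of a Gaussian, that is an average of \<open>f\<close> around
  \<open>x\<close> at scale \<open>\<epsilon>\<close>.\<close>

lemma gauss_mean:
  assumes f: "f \<in> schwartz" and \<epsilon>: "\<epsilon> > 0"
  shows "(\<integral>t. (gauss (\<epsilon> *\<^sub>R t) * cis (2 * pi * (t \<bullet> x))) * fourier f t \<partial>lborel) = (\<integral>z. f (x + \<epsilon> *\<^sub>R z) * gauss z \<partial>lborel)"
proof -
  let ?h = "\<lambda>t. gauss (\<epsilon> *\<^sub>R t) * cis (2 * pi * (t \<bullet> x))"
  let ?k = "\<lambda>y t. cis (- 2 * pi * (y \<bullet> t))"
  let ?d = "DIM(real^'a)"
  have cf: "continuous_on UNIV f" by (intro smooth_continuous schwartz_smooth f)
  have cg: "continuous_on UNIV (\<lambda>t. gauss (\<epsilon> *\<^sub>R t))" by (intro continuous_on_compose2[OF continuous_gauss] continuous_intros) simp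
  have ch: "continuous_on UNIV ?h" by (intro continuous_intros cg)
  have ck: "continuous_on UNIV (\<lambda>p. ?k (fst p) (snd p))" by (intro continuous_intros)
  have inner: "(\<integral>t. ?h t * ?k y t \<partial>lborel) = of_real ((1/\<epsilon>) ^ ?d) * gauss ((1/\<epsilon>) *\<^sub>R (y - x))" for y
  proof -
    have ck': "continuous_on UNIV (?k y)" by (intro continuous_intros)
    have "(\<integral>t. ?h t * ?k y t \<partial>lborel) = \<bar>1/\<epsilon>\<bar> ^ ?d *\<^sub>R (\<integral>s. ?h (0 + (1/\<epsilon>) *\<^sub>R s) * ?k y (0 + (1/\<epsilon>) *\<^sub>R s) \<partial>lborel)"
      by (rule integral_affine) (use \<epsilon> in \<open>auto intro!: borel_measurable_continuous_onI continuous_intros ch ck' cg\<close>)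
    also have "(\<lambda>s. ?h (0 + (1/\<epsilon>) *\<^sub>R s) * ?k y (0 + (1/\<epsilon>) *\<^sub>R s)) = (\<lambda>s. gauss s * cis (- 2 * pi * (s \<bullet> ((1/\<epsilon>) *\<^sub>R (y - x)))))"
      using \<epsilon> by (simp add: fun_eq_iff mult.assoc cis_mult inner_commute[of y] algebra_simps inner_diff_right)
    also have "(\<integral>s. gauss s * cis (- 2 * pi * (s \<bullet> ((1/\<epsilon>) *\<^sub>R (y - x)))) \<partial>lborel) = gauss ((1/\<epsilon>) *\<^sub>R (y - x))"
      using fourier_gauss[of "(1/\<epsilon>) *\<^sub>R (y - x)"] unfolding fourier_def .
    finally show ?thesis using \<epsilon> by (simp add: scaleR_conv_of_real)
  qed
  have "(\<integral>t. ?h t * fourier f t \<partial>lborel) = (\<integral>y. f y * (\<integral>t. ?h t * ?k y t \<partial>lborel) \<partial>lborel)"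
    unfolding fourier_def
    by (rule fubini_kernel[OF schwartz_integrable[OF f] cf integrable_gauss_character ch ck]) (use \<epsilon> in auto)
  also have "\<dots> = (\<integral>y. f y * (of_real ((1/\<epsilon>) ^ ?d) * gauss ((1/\<epsilon>) *\<^sub>R (y - x))) \<partial>lborel)"
    unfolding inner ..
  also have "\<dots> = \<bar>\<epsilon>\<bar> ^ ?d *\<^sub>R (\<integral>z. f (x + \<epsilon> *\<^sub>R z) * (of_real ((1/\<epsilon>) ^ ?d) * gauss ((1/\<epsilon>) *\<^sub>R (x + \<epsilon> *\<^sub>R z - x))) \<partial>lborel)"
    by (rule integral_affine)
      (use \<epsilon> in \<open>auto intro!: borel_measurable_continuous_onI continuous_intros cf continuous_on_compose2[OF continuous_gauss]\<close>)
  also have "(\<lambda>z. f (x + \<epsilon> *\<^sub>R z) * (of_real ((1/\<epsilon>) ^ ?d) * gauss ((1/\<epsilon>) *\<^sub>R (x + \<epsilon> *\<^sub>R z - x)))) = (\<lambda>z. of_real ((1/\<epsilon>) ^ ?d) * (f (x + \<epsilon> *\<^sub>R z) * gauss z))"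
    using \<epsilon> by (simp add: fun_eq_iff)
  also have "\<bar>\<epsilon>\<bar> ^ ?d *\<^sub>R (\<integral>z. of_real ((1/\<epsilon>) ^ ?d) * (f (x + \<epsilon> *\<^sub>R z) * gauss z) \<partial>lborel) = (\<integral>z. f (x + \<epsilon> *\<^sub>R z) * gauss z \<partial>lborel)"
  proof -
    have "\<epsilon> ^ ?d * (1/\<epsilon>) ^ ?d = 1" using \<epsilon> by (simp flip: power_mult_distrib)
    then have "(of_real (\<epsilon> ^ ?d) :: complex) * of_real ((1/\<epsilon>) ^ ?d) = 1" by (metis of_real_1 of_real_mult)
    moreover have "a *\<^sub>R (b * c) = c" if "of_real a * b = 1" for a and b c :: complex
      using that by (simp add: scaleR_conv_of_real mult.assoc[symmetric])
    ultimately show ?thesis using \<epsilon> by (simp only: integral_mult_right_zero abs_of_pos)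
  qed
  finally show ?thesis .
qed

text \<open>Let \<open>\<epsilon>\<close> tend to 0 in \<open>gauss_mean\<close> on both sides, by
  dominated convergence; the Gaussian has total mass \<open>fourier gauss 0 = 1\<close>.\<close>

theorem fourier_inversion:
  assumes f: "f \<in> schwartz"
  shows "(\<integral>t. fourier f t * cis (2 * pi * (t \<bullet> x)) \<partial>lborel) = f x"
proof -
  define \<epsilon> where "\<epsilon> k = inverse (real (Suc k))" for k
  have \<epsilon>: "\<epsilon> k > 0" "\<epsilon> \<longlonglongrightarrow> 0" for k
    unfolding \<epsilon>_def using LIMSEQ_inverse_real_of_nat by auto
  have cf: "continuous_on UNIV f" by (intro smooth_continuous schwartz_smooth f)
  have cF: "continuous_on UNIV (fourier f)" by (rule fourier_continuous[OF f])
  have cg: "continuous_on UNIV (\<lambda>t::real^'a. gauss (c *\<^sub>R t))" for c by (intro continuous_on_compose2[OF continuous_gauss] continuous_intros) simp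
  have "(\<lambda>k. \<integral>t. (gauss (\<epsilon> k *\<^sub>R t) * cis (2 * pi * (t \<bullet> x))) * fourier f t \<partial>lborel) \<longlonglongrightarrow> (\<integral>t. (1 * cis (2 * pi * (t \<bullet> x))) * fourier f t \<partial>lborel)"
  proof (rule integral_dominated_convergence[where w = "\<lambda>t. norm (fourier f t)"])
    show "integrable lborel (\<lambda>t. norm (fourier f t))" by (intro integrable_norm schwartz_integrable fourier_schwartz f)
    show "(\<lambda>t. (1 * cis (2 * pi * (t \<bullet> x))) * fourier f t) \<in> borel_measurable lborel"
      "(\<lambda>t. (gauss (\<epsilon> k *\<^sub>R t) * cis (2 * pi * (t \<bullet> x))) * fourier f t) \<in> borel_measurable lborel" for k
      by (intro continuous_borel continuous_intros cF cg)+
    show "AE t in lborel. (\<lambda>k. (gauss (\<epsilon> k *\<^sub>R t) * cis (2 * pi * (t \<bullet> x))) * fourier f t) \<longlonglongrightarrow> (1 * cis (2 * pi * (t \<bullet> x))) * fourier f t"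
    proof (intro always_eventually allI)
      fix t :: "real^'a"
      have "(\<lambda>k. \<epsilon> k *\<^sub>R t) \<longlonglongrightarrow> 0 *\<^sub>R t" by (rule tendsto_scaleR[OF \<epsilon>(2) tendsto_const])
      then have "(\<lambda>k. gauss (\<epsilon> k *\<^sub>R t)) \<longlonglongrightarrow> gauss (0 *\<^sub>R t)" by (rule continuous_on_tendsto_compose[OF continuous_gauss]) auto
      then have "(\<lambda>k. gauss (\<epsilon> k *\<^sub>R t)) \<longlonglongrightarrow> 1" by (simp add: gauss_0)
      then show "(\<lambda>k. (gauss (\<epsilon> k *\<^sub>R t) * cis (2 * pi * (t \<bullet> x))) * fourier f t) \<longlonglongrightarrow> (1 * cis (2 * pi * (t \<bullet> x))) * fourier f t"
        by (intro tendsto_intros)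
    qed
    show "AE t in lborel. norm ((gauss (\<epsilon> k *\<^sub>R t) * cis (2 * pi * (t \<bullet> x))) * fourier f t) \<le> norm (fourier f t)" for k
      by (intro AE_I2) (simp add: norm_mult mult_left_le_one_le norm_gauss_le_1)
  qed
  then have 1: "(\<lambda>k. \<integral>z. f (x + \<epsilon> k *\<^sub>R z) * gauss z \<partial>lborel) \<longlonglongrightarrow> (\<integral>t. (1 * cis (2 * pi * (t \<bullet> x))) * fourier f t \<partial>lborel)"
    by (simp only: gauss_mean[OF f \<epsilon>(1)])
  obtain C where C: "C \<ge> 0" "\<And>x. norm (f x) \<le> C" using schwartz_bounded[OF f] by blast
  have ig: "integrable lborel (gauss :: real^'a \<Rightarrow> complex)" using integrable_gauss_character[of 1 0] by simp
  have "(\<lambda>k. \<integral>z. f (x + \<epsilon> k *\<^sub>R z) * gauss z \<partial>lborel) \<longlonglongrightarrow> (\<integral>z. f x * gauss (z::real^'a) \<partial>lborel)"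
  proof (rule integral_dominated_convergence[where w = "\<lambda>z::real^'a. C * norm (gauss z)"])
    show "integrable lborel (\<lambda>z::real^'a. C * norm (gauss z))" by (intro integrable_mult_right integrable_norm ig)
    show "(\<lambda>z::real^'a. f x * gauss z) \<in> borel_measurable lborel" "(\<lambda>z. f (x + \<epsilon> k *\<^sub>R z) * gauss z) \<in> borel_measurable lborel" for k
      by (intro continuous_borel continuous_intros continuous_gauss continuous_on_compose2[OF cf]; simp)+
    show "AE z in lborel. (\<lambda>k. f (x + \<epsilon> k *\<^sub>R z) * gauss z) \<longlonglongrightarrow> f x * gauss z"
    proof (intro always_eventually allI)
      fix z
      have "(\<lambda>k. x + \<epsilon> k *\<^sub>R z) \<longlonglongrightarrow> x + 0 *\<^sub>R z" by (rule tendsto_add[OF tendsto_const tendsto_scaleR[OF \<epsilon>(2) tendsto_const]])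
      then have "(\<lambda>k. f (x + \<epsilon> k *\<^sub>R z)) \<longlonglongrightarrow> f (x + 0 *\<^sub>R z)" by (rule continuous_on_tendsto_compose[OF cf]) auto
      then show "(\<lambda>k. f (x + \<epsilon> k *\<^sub>R z) * gauss z) \<longlonglongrightarrow> f x * gauss z" by (intro tendsto_intros) simp
    qed
    show "AE z in lborel. norm (f (x + \<epsilon> k *\<^sub>R z) * gauss z) \<le> C * norm (gauss z)" for k
      using C by (auto simp: norm_mult intro!: mult_right_mono)
  qed
  moreover have "(\<integral>z. f x * gauss (z::real^'a) \<partial>lborel) = f x"
    using fourier_gauss[of "0 :: real^'a"] by (simp add: fourier_def gauss_0)
  ultimately have "(\<lambda>k. \<integral>z. f (x + \<epsilon> k *\<^sub>R z) * gauss z \<partial>lborel) \<longlonglongrightarrow> f x" by metis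
  from LIMSEQ_unique[OF 1 this] show ?thesis by (simp add: mult.commute)
qed

text \<open>The reflected forward transform, so that properties are inherited;
  \<open>inv_fourier_eq\<close> is the usual integral.\<close>

definition inv_fourier :: "(real^'n::finite \<Rightarrow> complex) \<Rightarrow> real^'n \<Rightarrow> complex" where
  "inv_fourier f x = fourier f (- x)"

lemma inv_fourier_eq: "inv_fourier f x = (\<integral>t. f t * cis (2 * pi * (t \<bullet> x)) \<partial>lborel)"
  by (simp add: inv_fourier_def fourier_def)

lemma inv_fourier_fourier: "f \<in> schwartz \<Longrightarrow> inv_fourier (fourier f) = f"
  by (simp add: fun_eq_iff inv_fourier_eq fourier_inversion)

lemma fourier_reflect:
  assumes "f \<in> borel_measurable lborel"
  shows "fourier (\<lambda>x. f (- x)) t = fourier f (- t)"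
proof -
  have "(\<lambda>x. f x * cis (- 2 * pi * (x \<bullet> - t))) \<in> borel_measurable lborel"
    by (intro borel_measurable_times[OF assms continuous_borel] continuous_intros)
  from integral_reflect[OF this] show ?thesis by (simp add: fourier_def)
qed

lemma fourier_inv_fourier: "f \<in> schwartz \<Longrightarrow> fourier (inv_fourier f) = f"
proof
  fix t assume f: "f \<in> schwartz"
  have "fourier (\<lambda>x. fourier f (- x)) t = fourier (fourier f) (- t)"
    by (intro fourier_reflect schwartz_measurable fourier_schwartz f)
  also have "\<dots> = f t" using inv_fourier_fourier[OF f] by (simp add: inv_fourier_def fun_eq_iff)
  finally show "fourier (inv_fourier f) t = f t" by (simp add: inv_fourier_def[abs_def])
qed

text \<open>Reflection is the square of the Fourier transform, so the derivatives of
  \<open>f (- x)\<close> need not be computed.\<close>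

lemma schwartz_reflect: assumes "f \<in> schwartz" shows "(\<lambda>x. f (- x)) \<in> schwartz"
proof -
  have "fourier (fourier f) \<in> schwartz" by (intro fourier_schwartz assms)
  moreover have "fourier (fourier f) = (\<lambda>x. f (- x))"
    using inv_fourier_fourier[OF assms] by (metis (no_types, lifting) inv_fourier_def minus_minus)
  ultimately show ?thesis by simp
qed

lemma inv_fourier_schwartz: "f \<in> schwartz \<Longrightarrow> inv_fourier f \<in> schwartz"
  unfolding inv_fourier_def[abs_def] by (intro schwartz_reflect fourier_schwartz)

section \<open>Convolution and the two forms of the theorem\<close>

text \<open>Fubini in the inversion integral of the product: the inner integral is the inversion
  formula for \<open>g\<close> at \<open>x - y\<close>.\<close>

theorem convolution_eq:
  assumes f: "f \<in> schwartz" and g: "g \<in> schwartz"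
  shows "convolution f g = inv_fourier (\<lambda>t. fourier f t * fourier g t)"
proof
  fix x
  let ?h = "\<lambda>t. fourier g t * cis (2 * pi * (t \<bullet> x))"
  have cf: "continuous_on UNIV f" by (intro smooth_continuous schwartz_smooth f)
  have ch: "continuous_on UNIV ?h" by (intro continuous_intros fourier_continuous g)
  have ih: "integrable lborel ?h"
    by (rule Bochner_Integration.integrable_bound[OF schwartz_integrable[OF fourier_schwartz[OF g]] continuous_borel[OF ch]])
      (simp add: norm_mult)
  have "inv_fourier (\<lambda>t. fourier f t * fourier g t) x = (\<integral>t. ?h t * (\<integral>y. f y * cis (- 2 * pi * (y \<bullet> t)) \<partial>lborel) \<partial>lborel)"
    by (simp add: inv_fourier_eq fourier_def[of f] mult_ac)
  also have "\<dots> = (\<integral>y. f y * (\<integral>t. ?h t * cis (- 2 * pi * (y \<bullet> t)) \<partial>lborel) \<partial>lborel)"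
    by (rule fubini_kernel[OF schwartz_integrable[OF f] cf ih ch]) (auto intro!: continuous_intros)
  also have "(\<lambda>y. \<integral>t. ?h t * cis (- 2 * pi * (y \<bullet> t)) \<partial>lborel) = (\<lambda>y. g (x - y))"
  proof
    fix y
    have "(\<lambda>t. ?h t * cis (- 2 * pi * (y \<bullet> t))) = (\<lambda>t. fourier g t * cis (2 * pi * (t \<bullet> (x - y))))"
      by (simp add: fun_eq_iff mult.assoc cis_mult inner_diff_right inner_commute[of y] algebra_simps)
    then show "(\<integral>t. ?h t * cis (- 2 * pi * (y \<bullet> t)) \<partial>lborel) = g (x - y)"
      by (simp only: fourier_inversion[OF g])
  qed
  finally show "convolution f g x = inv_fourier (\<lambda>t. fourier f t * fourier g t) x" by (simp add: Defs.convolution_def)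
qed

text \<open>The form for part (2), where the transform and its inverse exchange roles by
  reflection.\<close>

lemma convolution_eq':
  assumes f: "f \<in> schwartz" and g: "g \<in> schwartz"
  shows "convolution f g = fourier (\<lambda>t. inv_fourier f t * inv_fourier g t)"
proof
  fix x
  have "(\<lambda>t. fourier f t * fourier g t) \<in> borel_measurable lborel"
    by (intro schwartz_measurable schwartz_mult fourier_schwartz f g)
  from fourier_reflect[OF this, of x]
  show "convolution f g x = fourier (\<lambda>t. inv_fourier f t * inv_fourier g t) x"
    by (simp add: convolution_eq[OF f g] inv_fourier_def)
qed

lemma fourier_cnj: "fourier (\<lambda>y. cnj (f y)) x = cnj (fourier f (- x))"
  unfolding fourier_def by (subst Bochner_Integration.integral_cnj[symmetric]) (simp add: cis_cnj)

lemma smooth_diffeo_reflect: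
  assumes "smooth_diffeo u" shows "smooth_diffeo (\<lambda>x. u (- x))"
proof -
  have b: "bij u" "smooth u" "smooth (inv u)" using assms by (auto simp: smooth_diffeo_def)
  have inv: "inv (\<lambda>x. u (- x)) = (\<lambda>y. - inv u y)"
    by (rule inv_equality) (use b(1) in \<open>auto simp: bij_is_inj bij_is_surj surj_f_inv_f inv_f_f\<close>)
  have "bij (\<lambda>x. u (- x))" using bij_comp[OF bij_uminus b(1)] by (simp add: o_def)
  moreover have "smooth (\<lambda>x. u (- x))" using smooth_affine_comp[OF b(2), of 0 "-1"] by simp
  ultimately show ?thesis using smooth_minus[OF b(3)] by (simp add: smooth_diffeo_def inv)
qed

theorem theorem1p3:
  fixes T :: "(real^'n::finite \<Rightarrow> complex) \<Rightarrow> (real^'n \<Rightarrow> complex)"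
  assumes bij: "bij_betw T schwartz schwartz"
  shows
   "((\<forall>f\<in>schwartz. \<forall>g\<in>schwartz. T (convolution f g) = (\<lambda>x. T f x * T g x)) \<longrightarrow>
      (\<exists>u. smooth_diffeo u \<and>
        ((\<forall>f\<in>schwartz. \<forall>x. T f (u x) = fourier f x) \<or>
         (\<forall>f\<in>schwartz. \<forall>x. T f (u x) = fourier (\<lambda>y. cnj (f y)) x))))
    \<and>
    ((\<forall>f\<in>schwartz. \<forall>g\<in>schwartz. T (\<lambda>x. f x * g x) = convolution (T f) (T g)) \<longrightarrow>
      (\<exists>u. smooth_diffeo u \<and>
        ((\<forall>f\<in>schwartz. T f = fourier (f \<circ> u)) \<or>
         (\<forall>f\<in>schwartz. T f = fourier (\<lambda>y. cnj ((f \<circ> u) y))))))"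
proof -
  define U where "U = inv_into schwartz T"
  have T_schwartz: "T f \<in> schwartz" if "f \<in> schwartz" for f using bij that by (auto simp: bij_betw_def)
  have U_schwartz: "U f \<in> schwartz" if "f \<in> schwartz" for f
    using bij_betw_inv_into[OF bij] that by (auto simp: bij_betw_def U_def)
  have T_U: "T (U f) = f" if "f \<in> schwartz" for f using bij_betw_inv_into_right[OF bij that] by (simp add: U_def)
  have U_T: "U (T f) = f" if "f \<in> schwartz" for f using bij_betw_inv_into_left[OF bij that] by (simp add: U_def)
  show ?thesis
  proof (intro conjI impI)
    assume hom: "\<forall>f\<in>schwartz. \<forall>g\<in>schwartz. T (convolution f g) = (\<lambda>x. T f x * T g x)"
    let ?T = "\<lambda>f. T (inv_fourier f)" and ?U = "\<lambda>f. fourier (U f)"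
    have mult: "?T (\<lambda>x. f x * g x) = (\<lambda>x. ?T f x * ?T g x)" if "f \<in> schwartz" "g \<in> schwartz" for f g
      using hom[rule_format, OF inv_fourier_schwartz[OF that(1)] inv_fourier_schwartz[OF that(2)]]
      by (simp add: convolution_eq inv_fourier_schwartz that fourier_inv_fourier)
    interpret schwartz_mult_iso ?T ?U
    proof
      show U_mult: "?U (\<lambda>x. f x * g x) = (\<lambda>x. ?U f x * ?U g x)" if fg: "f \<in> schwartz" "g \<in> schwartz" for f g
      proof -
        have S: "?U f \<in> schwartz" "?U g \<in> schwartz" using fg by (simp_all add: fourier_schwartz U_schwartz)
        have "?T (\<lambda>x. ?U f x * ?U g x) = (\<lambda>x. f x * g x)"
          unfolding mult[OF S] using fg by (simp add: inv_fourier_fourier U_schwartz T_U)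
        then have "?U (\<lambda>x. f x * g x) = fourier (U (?T (\<lambda>x. ?U f x * ?U g x)))" by simp
        then show ?thesis using S by (simp add: U_T inv_fourier_schwartz schwartz_mult fourier_inv_fourier)
      qed
    qed (simp_all add: T_schwartz U_schwartz T_U U_T inv_fourier_schwartz fourier_schwartz inv_fourier_fourier fourier_inv_fourier mult)
    obtain u where u: "smooth_diffeo u" and form:
      "(\<forall>f\<in>schwartz. \<forall>x. ?T f (u x) = f x) \<or> (\<forall>f\<in>schwartz. \<forall>x. ?T f (u x) = cnj (f x))"
      using T_form by blast
    have Tf: "?T (fourier f) = T f" if "f \<in> schwartz" for f using that by (simp add: inv_fourier_fourier)
    from form show "\<exists>u. smooth_diffeo u \<and>
        ((\<forall>f\<in>schwartz. \<forall>x. T f (u x) = fourier f x) \<or>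
         (\<forall>f\<in>schwartz. \<forall>x. T f (u x) = fourier (\<lambda>y. cnj (f y)) x))"
    proof
      assume *: "\<forall>f\<in>schwartz. \<forall>x. ?T f (u x) = f x"
      have "T f (u x) = fourier f x" if "f \<in> schwartz" for f x
        using *[rule_format, OF fourier_schwartz[OF that], of x] Tf[OF that] by simp
      then show ?thesis using u by blast
    next
      assume *: "\<forall>f\<in>schwartz. \<forall>x. ?T f (u x) = cnj (f x)"
      \<comment> \<open>\<open>cnj (fourier f (- x))\<close> is the transform of the conjugate of
        \<open>f\<close>, so the witness is \<open>u\<close> after a reflection.\<close>
      have "T f (u (- x)) = fourier (\<lambda>y. cnj (f y)) x" if "f \<in> schwartz" for f x
        using *[rule_format, OF fourier_schwartz[OF that], of "- x"] Tf[OF that] by (simp add: fourier_cnj)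
      then show ?thesis using smooth_diffeo_reflect[OF u] by blast
    qed
  next
    assume hom: "\<forall>f\<in>schwartz. \<forall>g\<in>schwartz. T (\<lambda>x. f x * g x) = convolution (T f) (T g)"
    let ?T = "\<lambda>f. inv_fourier (T f)" and ?U = "\<lambda>f. U (fourier f)"
    have mult: "?T (\<lambda>x. f x * g x) = (\<lambda>x. ?T f x * ?T g x)" if fg: "f \<in> schwartz" "g \<in> schwartz" for f g
      using hom[rule_format, OF fg] fg
      by (simp add: convolution_eq' T_schwartz inv_fourier_fourier schwartz_mult inv_fourier_schwartz)
    interpret schwartz_mult_iso ?T ?U
    proof
      show U_mult: "?U (\<lambda>x. f x * g x) = (\<lambda>x. ?U f x * ?U g x)" if fg: "f \<in> schwartz" "g \<in> schwartz" for f g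
      proof -
        have S: "?U f \<in> schwartz" "?U g \<in> schwartz" using fg by (simp_all add: fourier_schwartz U_schwartz)
        have "?T (\<lambda>x. ?U f x * ?U g x) = (\<lambda>x. f x * g x)"
          unfolding mult[OF S] using fg by (simp add: inv_fourier_fourier fourier_schwartz T_U)
        then have "?U (\<lambda>x. f x * g x) = U (fourier (?T (\<lambda>x. ?U f x * ?U g x)))" by simp
        then show ?thesis using S by (simp add: U_T T_schwartz schwartz_mult fourier_inv_fourier)
      qed
    qed (simp_all add: T_schwartz U_schwartz T_U U_T inv_fourier_schwartz fourier_schwartz inv_fourier_fourier fourier_inv_fourier mult)
    obtain u where u: "smooth_diffeo u" and form:
      "(\<forall>f\<in>schwartz. \<forall>x. ?T f (u x) = f x) \<or> (\<forall>f\<in>schwartz. \<forall>x. ?T f (u x) = cnj (f x))"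
      using T_form by blast
    \<comment> \<open>\<open>T_form\<close> evaluates \<open>?T f\<close> at \<open>u x\<close>,
      whereas the claim composes \<open>f\<close> with the diffeomorphism; the witness is therefore
      \<open>inv u\<close>.\<close>
    have bu: "bij u" and v: "smooth_diffeo (inv u)"
      using u by (auto simp: smooth_diffeo_def bij_imp_bij_inv inv_inv_eq)
    have Tf: "T f = fourier (?T f)" if "f \<in> schwartz" for f using that by (simp add: fourier_inv_fourier T_schwartz)
    have uv: "u (inv u y) = y" for y using bu by (simp add: bij_is_surj surj_f_inv_f)
    from form show "\<exists>u. smooth_diffeo u \<and>
        ((\<forall>f\<in>schwartz. T f = fourier (f \<circ> u)) \<or>
         (\<forall>f\<in>schwartz. T f = fourier (\<lambda>y. cnj ((f \<circ> u) y))))"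
    proof
      assume *: "\<forall>f\<in>schwartz. \<forall>x. ?T f (u x) = f x"
      have "?T f = f \<circ> inv u" if "f \<in> schwartz" for f
        using *[rule_format, OF that, of "inv u _"] by (simp add: uv fun_eq_iff)
      then have "T f = fourier (f \<circ> inv u)" if "f \<in> schwartz" for f using Tf[OF that] that by simp
      then show ?thesis using v by blast
    next
      assume *: "\<forall>f\<in>schwartz. \<forall>x. ?T f (u x) = cnj (f x)"
      have "?T f = (\<lambda>y. cnj ((f \<circ> inv u) y))" if "f \<in> schwartz" for f
        using *[rule_format, OF that, of "inv u _"] by (simp add: uv fun_eq_iff)
      then have "T f = fourier (\<lambda>y. cnj ((f \<circ> inv u) y))" if "f \<in> schwartz" for f using Tf[OF that] that by simp
      then show ?thesis using v by blast
    qed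
  qed
qed

end
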